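(* Let $G$ be a second-countable ample Hausdorff groupoid. Suppose that $G$ is minimal and effective. If the complex Steinberg algebra $A(G)$ is algebraically purely infinite, then $C^*_r(G)$ is $C^*$-purely infinite.
   Context: **Groupoids.** A topological groupoid $G$ has unit space $G^{(0)}$ and range and source maps $r,s:G\to G^{(0)}$. An open bisection is an open set $B\subseteq G$ such that $r$ and $s$ restrict to homeomorphisms of $B$ onto open subsets of $G^{(0)}$. $G$ is ample if it has a basis of compact open bisections. A subset $U\subseteq G^{(0)}$ is invariant if $s(\gamma)\in U\iff r(\gamma)\in U$ for all $\gamma\in G$; $G$ is minimal if the only open invariant subsets of $G^{(0)}$ are $\emptyset$ and $G^{(0)}$. $G$ is effective if for every nonempty compact open bisection $B\subseteq G\setminus G^{(0)}$ there is $\gamma\in B$ with $s(\gamma)\ne r(\gamma)$. **Algebras.** $A(G)$ is the complex algebra of locally constant, compactly supported functions $G\to \mathbb{C}$ with convolution $(f*g)(\gamma)=\sum_{\alpha\beta=\gamma}f(\alpha)g(\beta)$ and involution $f^*(\gamma)=\overline{f(\gamma^{-1})}$. $C_c(G)$ (continuous compactly supported functions) is a $*$-algebra with the same operations. For $u\in G^{(0)}$ let $G_u=s^{-1}(u)$ and $R_u:C_c(G)\to\mathcal{B}(\ell^2(G_u))$, $R_u(f)\delta_\gamma=\sum_{s(\alpha)=r(\gamma)}f(\alpha)\delta_{\alpha\gamma}$. $C^*_r(G)$ is the completion of the image of $C_c(G)$ under $\bigoplus_u R_u$. **Algebraic definitions.** For a ring $R$, $x\in M_k(R)$, $y\in M_n(R)$,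 write $x\precsim_{\mathrm{ring}}y$ if there are $\alpha\in M_{kn}(R)$ ($k\times n$) and $\beta\in M_{nk}(R)$ with $x=\alpha y\beta$. $RaR:=\mathrm{span}\{cad:c,d\in R\}$. $R$ is algebraically purely infinite if (a) no quotient of $R$ is a division ring, and (b) whenever $a\in R$ and $b\in RaR$ we have $b\precsim_{\mathrm{ring}}a$. **$C^*$-algebraic definitions.** For a $C^*$-algebra $A$ and $a,b\in A^+$, $b\precsim_{C^*}a$ means there is a sequence $\alpha_i\in A$ with $\alpha_i a\alpha_i^*\to b$ in norm. $A$ is $C^*$-purely infinite if (a) there are no nonzero $*$-homomorphisms $A\to\mathbb{C}$, and (b) for all $a,b\in A^+$: $b\precsim_{C^*}a$ if and only if $b\in\overline{AaA}$, where $AaA=\mathrm{span}\{cad:c,d\in A\}$. *)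

theory Defs
  imports
    "HOL-Analysis.Analysis"
    "HOL-Algebra.QuotRing"
    "HOL-Algebra.Generated_Groups"
begin

section \<open>Topological groupoids\<close>

text \<open>
  A groupoid lives on a whole type of arrows, and its units are the arrows of the form
  \<open>src x\<close>. The total function \<open>mul\<close> is only meaningful on the composable pairs, those
  with \<open>src x = rng y\<close>. The topology is the one of the type of arrows; in the theorem,
  Hausdorff and second countable are the type classes \<^class>\<open>t2_space\<close> and
  \<^class>\<open>second_countable_topology\<close>.
\<close>

record 'g groupoid =
  rng :: "'g \<Rightarrow> 'g"
  src :: "'g \<Rightarrow> 'g"
  mul :: "'g \<Rightarrow> 'g \<Rightarrow> 'g"
  ginv :: "'g \<Rightarrow> 'g"

definition units :: "'g groupoid \<Rightarrow> 'g set" where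
  "units G = range (src G)"

definition composable :: "'g groupoid \<Rightarrow> ('g \<times> 'g) set" where
  "composable G = {(x, y). src G x = rng G y}"

definition is_groupoid :: "'g groupoid \<Rightarrow> bool" where
  "is_groupoid G \<longleftrightarrow>
     (\<forall>x. src G (src G x) = src G x \<and> rng G (src G x) = src G x
        \<and> src G (rng G x) = rng G x \<and> rng G (rng G x) = rng G x) \<and>
     (\<forall>x y. src G x = rng G y \<longrightarrow> src G (mul G x y) = src G y \<and> rng G (mul G x y) = rng G x) \<and>
     (\<forall>x y z. src G x = rng G y \<longrightarrow> src G y = rng G z \<longrightarrow>
        mul G (mul G x y) z = mul G x (mul G y z)) \<and>
     (\<forall>x. mul G (rng G x) x = x \<and> mul G x (src G x) = x) \<and>
     (\<forall>x. src G (ginv G x) = rng G x \<and> rng G (ginv G x) = src G x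
        \<and> mul G (ginv G x) x = src G x \<and> mul G x (ginv G x) = rng G x)"

text \<open>Continuity of \<open>rng\<close> and \<open>src\<close> follows, since \<open>rng x = x x\<inverse>\<close> and \<open>src x = x\<inverse> x\<close>.\<close>

definition topological_groupoid :: "'g::topological_space groupoid \<Rightarrow> bool" where
  "topological_groupoid G \<longleftrightarrow> is_groupoid G
     \<and> continuous_on (composable G) (\<lambda>(x, y). mul G x y)
     \<and> continuous_on UNIV (ginv G)"

definition open_bisection :: "'g::topological_space groupoid \<Rightarrow> 'g set \<Rightarrow> bool" where
  "open_bisection G B \<longleftrightarrow> open B
     \<and> openin (top_of_set (units G)) (rng G ` B) \<and> (\<exists>k. homeomorphism B (rng G ` B) (rng G) k)
     \<and> openin (top_of_set (units G)) (src G ` B) \<and> (\<exists>k. homeomorphism B (src G ` B) (src G) k)"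

definition ample :: "'g::topological_space groupoid \<Rightarrow> bool" where
  "ample G \<longleftrightarrow> topological_groupoid G \<and> topological_basis {B. compact B \<and> open_bisection G B}"

definition invariant :: "'g groupoid \<Rightarrow> 'g set \<Rightarrow> bool" where
  "invariant G U \<longleftrightarrow> (\<forall>\<gamma>. src G \<gamma> \<in> U \<longleftrightarrow> rng G \<gamma> \<in> U)"

definition minimal :: "'g::topological_space groupoid \<Rightarrow> bool" where
  "minimal G \<longleftrightarrow>
     (\<forall>U. openin (top_of_set (units G)) U \<longrightarrow> invariant G U \<longrightarrow> U = {} \<or> U = units G)"

definition effective :: "'g::topological_space groupoid \<Rightarrow> bool" where
  "effective G \<longleftrightarrow>
     (\<forall>B. compact B \<longrightarrow> open_bisection G B \<longrightarrow> B \<noteq> {} \<longrightarrow> B \<subseteq> - units G \<longrightarrow>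
        (\<exists>\<gamma>\<in>B. src G \<gamma> \<noteq> rng G \<gamma>))"


section \<open>Rings without unit and algebraic pure infiniteness\<close>

text \<open>
  Rings need not have a unit. They are represented by the ring records of HOL-Algebra, of
  which the field \<open>one\<close> is never used (a unit of a quotient is asked for explicitly).
\<close>

definition two_sided_ideal :: "'a set \<Rightarrow> 'a ring \<Rightarrow> bool" where
  "two_sided_ideal I R \<longleftrightarrow> additive_subgroup I R
     \<and> (\<forall>x\<in>I. \<forall>r\<in>carrier R. r \<otimes>\<^bsub>R\<^esub> x \<in> I \<and> x \<otimes>\<^bsub>R\<^esub> r \<in> I)"

definition division_ring :: "'a ring \<Rightarrow> bool" where
  "division_ring D \<longleftrightarrow>
     (\<exists>e. Ring.ring (D\<lparr>one := e\<rparr>) \<and> Units (D\<lparr>one := e\<rparr>) = carrier D - {\<zero>\<^bsub>D\<^esub>})"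

text \<open>
  The relation \<open>x \<precsim> y\<close> for a \<open>k \<times> k\<close> matrix \<open>x\<close> and an \<open>n \<times> n\<close> matrix \<open>y\<close>; matrices are
  functions of two indices, of which only the values below the dimensions matter.
\<close>

definition ring_precsim ::
  "'a ring \<Rightarrow> nat \<Rightarrow> (nat \<Rightarrow> nat \<Rightarrow> 'a) \<Rightarrow> nat \<Rightarrow> (nat \<Rightarrow> nat \<Rightarrow> 'a) \<Rightarrow> bool" where
  "ring_precsim R k x n y \<longleftrightarrow>
     (\<exists>\<alpha> \<beta>. (\<forall>i<k. \<forall>j<n. \<alpha> i j \<in> carrier R) \<and> (\<forall>i<n. \<forall>j<k. \<beta> i j \<in> carrier R) \<and>
        (\<forall>i<k. \<forall>j<k. x i j =
           (\<Oplus>\<^bsub>R\<^esub>p\<in>{..<n}. \<Oplus>\<^bsub>R\<^esub>q\<in>{..<n}. \<alpha> i p \<otimes>\<^bsub>R\<^esub> y p q \<otimes>\<^bsub>R\<^esub> \<beta> q j)))"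

text \<open>For a ring, the span is the additive subgroup generated by the products \<open>c a d\<close>.\<close>

definition ring_RaR :: "'a ring \<Rightarrow> 'a \<Rightarrow> 'a set" where
  "ring_RaR R a = generate (add_monoid R)
     {c \<otimes>\<^bsub>R\<^esub> a \<otimes>\<^bsub>R\<^esub> d | c d. c \<in> carrier R \<and> d \<in> carrier R}"

definition algebraically_purely_infinite :: "'a ring \<Rightarrow> bool" where
  "algebraically_purely_infinite R \<longleftrightarrow>
     (\<forall>I. two_sided_ideal I R \<longrightarrow> \<not> division_ring (R Quot I)) \<and>
     (\<forall>a\<in>carrier R. \<forall>b\<in>ring_RaR R a. ring_precsim R 1 (\<lambda>_ _. b) 1 (\<lambda>_ _. a))"


section \<open>The Steinberg algebra\<close>

text \<open>For \<open>f\<close> and \<open>g\<close> in \<open>C\<^sub>c(G)\<close>, only finitely many terms of the sum are nonzero.\<close>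

definition convolution ::
  "'g groupoid \<Rightarrow> ('g \<Rightarrow> complex) \<Rightarrow> ('g \<Rightarrow> complex) \<Rightarrow> 'g \<Rightarrow> complex" where
  "convolution G f g = (\<lambda>\<gamma>. \<Sum>\<^sub>\<infinity>(\<alpha>, \<beta>)\<in>{(\<alpha>, \<beta>) \<in> composable G. mul G \<alpha> \<beta> = \<gamma>}. f \<alpha> * g \<beta>)"

definition compactly_supported :: "('g::topological_space \<Rightarrow> complex) \<Rightarrow> bool" where
  "compactly_supported f \<longleftrightarrow> compact (closure {x. f x \<noteq> 0})"

definition locally_constant :: "('g::topological_space \<Rightarrow> complex) \<Rightarrow> bool" where
  "locally_constant f \<longleftrightarrow> (\<forall>x. \<exists>U. open U \<and> x \<in> U \<and> f constant_on U)"

definition steinberg_algebra :: "'g::topological_space groupoid \<Rightarrow> ('g \<Rightarrow> complex) ring" where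
  "steinberg_algebra G =
     \<lparr>carrier = {f. locally_constant f \<and> compactly_supported f},
      mult = convolution G, one = undefined,
      zero = (\<lambda>_. 0), add = (\<lambda>f g x. f x + g x)\<rparr>"

definition Cc :: "('g::topological_space \<Rightarrow> complex) set" where
  "Cc = {f. continuous_on UNIV f \<and> compactly_supported f}"


section \<open>The Hilbert space of square-summable functions\<close>

typedef 'a ell2 = "{f :: 'a \<Rightarrow> complex. (\<lambda>x. (cmod (f x))\<^sup>2) summable_on UNIV}"
  morphisms ell2_fun Abs_ell2
  by (rule exI[of _ "\<lambda>_. 0"]) simp

setup_lifting type_definition_ell2

lemma square_summable_add:
  fixes f g :: "'a \<Rightarrow> complex"
  assumes "(\<lambda>x. (cmod (f x))\<^sup>2) summable_on UNIV" "(\<lambda>x. (cmod (g x))\<^sup>2) summable_on UNIV"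
  shows "(\<lambda>x. (cmod (f x + g x))\<^sup>2) summable_on UNIV"
proof (rule summable_on_comparison_test)
  show "(\<lambda>x. 2 * (cmod (f x))\<^sup>2 + 2 * (cmod (g x))\<^sup>2) summable_on UNIV"
    by (intro summable_on_add summable_on_cmult_right assms)
  fix x
  have "(cmod (f x + g x))\<^sup>2 \<le> (cmod (f x) + cmod (g x))\<^sup>2"
    by (intro power_mono norm_triangle_ineq) auto
  also have "\<dots> \<le> 2 * (cmod (f x))\<^sup>2 + 2 * (cmod (g x))\<^sup>2"
    using sum_squares_bound[of "cmod (f x)" "cmod (g x)"] by (simp add: power2_sum)
  finally show "(cmod (f x + g x))\<^sup>2 \<le> 2 * (cmod (f x))\<^sup>2 + 2 * (cmod (g x))\<^sup>2" .
qed auto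

lemma square_summable_scale:
  fixes f :: "'a \<Rightarrow> complex"
  assumes "(\<lambda>x. (cmod (f x))\<^sup>2) summable_on UNIV"
  shows "(\<lambda>x. (cmod (c * f x))\<^sup>2) summable_on UNIV"
  using summable_on_cmult_right[OF assms, of "(cmod c)\<^sup>2"] by (simp add: norm_mult power_mult_distrib)

lemma square_summable_prod:
  fixes f g :: "'a \<Rightarrow> complex"
  assumes "(\<lambda>x. (cmod (f x))\<^sup>2) summable_on UNIV" "(\<lambda>x. (cmod (g x))\<^sup>2) summable_on UNIV"
  shows "(\<lambda>x. cmod (f x) * cmod (g x)) summable_on UNIV"
proof (rule summable_on_comparison_test)
  show "(\<lambda>x. (cmod (f x))\<^sup>2 + (cmod (g x))\<^sup>2) summable_on UNIV"
    by (intro summable_on_add assms)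
  fix x
  show "cmod (f x) * cmod (g x) \<le> (cmod (f x))\<^sup>2 + (cmod (g x))\<^sup>2"
    using sum_squares_bound[of "cmod (f x)" "cmod (g x)"]
      mult_nonneg_nonneg[of "cmod (f x)" "cmod (g x)"] by (simp del: mult_nonneg_nonneg)
qed auto

lemma square_summable_inner:
  fixes f g :: "'a \<Rightarrow> complex"
  assumes "(\<lambda>x. (cmod (f x))\<^sup>2) summable_on UNIV" "(\<lambda>x. (cmod (g x))\<^sup>2) summable_on UNIV"
  shows "(\<lambda>x. inner (f x) (g x)) summable_on UNIV"
proof (rule abs_summable_summable, rule summable_on_comparison_test)
  show "(\<lambda>x. cmod (f x) * cmod (g x)) summable_on UNIV"
    by (rule square_summable_prod[OF assms])
qed (auto simp: Cauchy_Schwarz_ineq2)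

instantiation ell2 :: (type) real_inner
begin

lift_definition zero_ell2 :: "'a ell2" is "\<lambda>_. 0" by simp

lift_definition plus_ell2 :: "'a ell2 \<Rightarrow> 'a ell2 \<Rightarrow> 'a ell2" is "\<lambda>f g x. f x + g x"
  by (rule square_summable_add)

lift_definition uminus_ell2 :: "'a ell2 \<Rightarrow> 'a ell2" is "\<lambda>f x. - f x" by simp

lift_definition minus_ell2 :: "'a ell2 \<Rightarrow> 'a ell2 \<Rightarrow> 'a ell2" is "\<lambda>f g x. f x - g x"
  subgoal for f g using square_summable_add[of f "\<lambda>x. - g x"] by simp
  done

lift_definition scaleR_ell2 :: "real \<Rightarrow> 'a ell2 \<Rightarrow> 'a ell2" is "\<lambda>r f x. of_real r * f x"
  by (rule square_summable_scale)

definition "norm (\<xi> :: 'a ell2) = sqrt (\<Sum>\<^sub>\<infinity>x. (cmod (ell2_fun \<xi> x))\<^sup>2)"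

definition "inner (\<xi> :: 'a ell2) \<eta> = (\<Sum>\<^sub>\<infinity>x. inner (ell2_fun \<xi> x) (ell2_fun \<eta> x))"

definition "dist (\<xi> :: 'a ell2) \<eta> = norm (\<xi> - \<eta>)"

definition "sgn (\<xi> :: 'a ell2) = inverse (norm \<xi>) *\<^sub>R \<xi>"

definition "(uniformity :: ('a ell2 \<times> 'a ell2) filter) =
  (INF e\<in>{0<..}. principal {(x, y). dist x y < e})"

definition "open (U :: 'a ell2 set) \<longleftrightarrow> (\<forall>x\<in>U. \<forall>\<^sub>F (x', y) in uniformity. x' = x \<longrightarrow> y \<in> U)"

instance
proof
  fix x y z :: "'a ell2" and a b :: real and U :: "'a ell2 set"
  note sq = ell2_fun[simplified]
  show "x + y + z = x + (y + z)" "x + y = y + x" "0 + x = x" "- x + x = 0" "x - y = x + - y"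
    by (transfer, simp add: algebra_simps)+
  show "a *\<^sub>R (x + y) = a *\<^sub>R x + a *\<^sub>R y" "(a + b) *\<^sub>R x = a *\<^sub>R x + b *\<^sub>R x"
    "a *\<^sub>R b *\<^sub>R x = (a * b) *\<^sub>R x" "1 *\<^sub>R x = x"
    by (transfer, simp add: algebra_simps)+
  show "dist x y = norm (x - y)" "sgn x = inverse (norm x) *\<^sub>R x"
    "uniformity = (INF e\<in>{0<..}. principal {(x :: 'a ell2, y). dist x y < e})"
    "open U \<longleftrightarrow> (\<forall>x\<in>U. \<forall>\<^sub>F (x', y) in uniformity. x' = x \<longrightarrow> y \<in> U)"
    by (simp_all only: dist_ell2_def sgn_ell2_def uniformity_ell2_def open_ell2_def)
  show "inner x y = inner y x"
    by (simp add: inner_ell2_def inner_commute)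
  show "inner (x + y) z = inner x z + inner y z"
    unfolding inner_ell2_def
    by (subst infsum_add[symmetric])
       (auto simp: plus_ell2.rep_eq inner_add_left intro!: square_summable_inner sq)
  show "inner (a *\<^sub>R x) y = a * inner x y"
    unfolding inner_ell2_def
    by (subst infsum_cmult_right[symmetric])
       (auto simp: scaleR_ell2.rep_eq scaleR_conv_of_real[symmetric] intro!: square_summable_inner sq)
  show "0 \<le> inner x x"
    unfolding inner_ell2_def by (intro infsum_nonneg) auto
  show "norm x = sqrt (inner x x)"
    by (simp add: norm_ell2_def inner_ell2_def power2_norm_eq_inner)
  show "inner x x = 0 \<longleftrightarrow> x = 0"
  proof
    assume "inner x x = 0"
    then have "inner (ell2_fun x i) (ell2_fun x i) = 0" for i
      unfolding inner_ell2_def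
      by (intro nonneg_infsum_le_0D[of "\<lambda>i. inner (ell2_fun x i) (ell2_fun x i)" UNIV])
         (auto intro!: square_summable_inner sq)
    then show "x = 0" by (intro ell2_fun_inject[THEN iffD1]) (auto simp: zero_ell2.rep_eq)
  qed (simp add: inner_ell2_def zero_ell2.rep_eq)
qed

end

lemma ell2_square_summable: "(\<lambda>i. (cmod (ell2_fun x i))\<^sup>2) summable_on UNIV"
  using ell2_fun[of x] by simp

lemma ell2_norm_bound_finite: "(\<Sum>i\<in>F. (cmod (ell2_fun x i))\<^sup>2) \<le> (norm x)\<^sup>2"
proof (cases "finite F")
  case True
  then have "(\<Sum>i\<in>F. (cmod (ell2_fun x i))\<^sup>2) \<le> (\<Sum>\<^sub>\<infinity>i. (cmod (ell2_fun x i))\<^sup>2)"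
    by (intro finite_sum_le_infsum ell2_square_summable) auto
  also have "\<dots> = (norm x)\<^sup>2"
    by (simp add: norm_ell2_def infsum_nonneg)
  finally show ?thesis .
qed auto

lemma ell2_coord_le_norm: "cmod (ell2_fun x i) \<le> norm x"
  by (rule power2_le_imp_le) (use ell2_norm_bound_finite[of x "{i}"] in auto)

text \<open>Completeness ensures that norm-closed subspaces of bounded operators are complete.\<close>

instance ell2 :: (type) banach
proof
  fix X :: "nat \<Rightarrow> 'a ell2"
  assume "Cauchy X"
  have coord: "Cauchy (\<lambda>n. ell2_fun (X n) i)" for i
  proof (rule metric_CauchyI)
    fix e :: real assume "e > 0"
    then obtain M where M: "\<forall>m\<ge>M. \<forall>n\<ge>M. dist (X m) (X n) < e"
      using \<open>Cauchy X\<close> unfolding Cauchy_def by blast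
    have "dist (ell2_fun (X m) i) (ell2_fun (X n) i) \<le> dist (X m) (X n)" for m n
      using ell2_coord_le_norm[of "X m - X n" i]
      by (simp add: dist_norm minus_ell2.rep_eq)
    then show "\<exists>M. \<forall>m\<ge>M. \<forall>n\<ge>M. dist (ell2_fun (X m) i) (ell2_fun (X n) i) < e"
      using M by (meson le_less_trans)
  qed
  define f where "f = (\<lambda>i. lim (\<lambda>n. ell2_fun (X n) i))"
  have lim: "(\<lambda>n. ell2_fun (X n) i) \<longlonglongrightarrow> f i" for i
    using Cauchy_convergent[OF coord[of i]] unfolding f_def convergent_LIMSEQ_iff .
  have tail: "\<exists>M. \<forall>m\<ge>M. \<forall>F. (\<Sum>i\<in>F. (cmod (ell2_fun (X m) i - f i))\<^sup>2) \<le> e\<^sup>2" if "e > 0" for e :: real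
  proof -
    obtain M where M: "\<forall>m\<ge>M. \<forall>n\<ge>M. dist (X m) (X n) < e"
      using \<open>Cauchy X\<close> \<open>e > 0\<close> unfolding Cauchy_def by blast
    have "(\<Sum>i\<in>F. (cmod (ell2_fun (X m) i - f i))\<^sup>2) \<le> e\<^sup>2" if "m \<ge> M" for m F
    proof (rule LIMSEQ_le_const2)
      show "(\<lambda>n. \<Sum>i\<in>F. (cmod (ell2_fun (X m) i - ell2_fun (X n) i))\<^sup>2)
              \<longlonglongrightarrow> (\<Sum>i\<in>F. (cmod (ell2_fun (X m) i - f i))\<^sup>2)"
        by (intro tendsto_intros lim)
      have "(\<Sum>i\<in>F. (cmod (ell2_fun (X m) i - ell2_fun (X n) i))\<^sup>2) \<le> e\<^sup>2" if "n \<ge> M" for n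
      proof -
        have "(\<Sum>i\<in>F. (cmod (ell2_fun (X m) i - ell2_fun (X n) i))\<^sup>2) \<le> (norm (X m - X n))\<^sup>2"
          using ell2_norm_bound_finite[of "X m - X n" F] by (simp add: minus_ell2.rep_eq)
        also have "\<dots> \<le> e\<^sup>2"
          using M \<open>m \<ge> M\<close> \<open>n \<ge> M\<close> by (intro power_mono) (auto simp: dist_norm less_imp_le)
        finally show ?thesis .
      qed
      then show "\<exists>N. \<forall>n\<ge>N. (\<Sum>i\<in>F. (cmod (ell2_fun (X m) i - ell2_fun (X n) i))\<^sup>2) \<le> e\<^sup>2"
        by blast
    qed
    then show ?thesis by blast
  qed
  have diff: "(\<lambda>i. (cmod (ell2_fun (X m) i - f i))\<^sup>2) summable_on UNIV"
    if "\<forall>F. (\<Sum>i\<in>F. (cmod (ell2_fun (X m) i - f i))\<^sup>2) \<le> C" for m C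
    using that by (intro nonneg_bdd_above_summable_on) (auto intro!: bdd_aboveI[of _ C])
  have f: "(\<lambda>i. (cmod (f i))\<^sup>2) summable_on UNIV"
  proof -
    obtain m where "\<forall>F. (\<Sum>i\<in>F. (cmod (ell2_fun (X m) i - f i))\<^sup>2) \<le> 1\<^sup>2"
      using tail[of 1] by auto
    from square_summable_add[OF ell2_square_summable[of "X m"] square_summable_scale[OF diff[OF this], of "-1"]]
    show ?thesis by simp
  qed
  have "X \<longlonglongrightarrow> Abs_ell2 f"
  proof (rule metric_LIMSEQ_I)
    fix e :: real assume "e > 0"
    then obtain M where M: "\<forall>m\<ge>M. \<forall>F. (\<Sum>i\<in>F. (cmod (ell2_fun (X m) i - f i))\<^sup>2) \<le> (e/2)\<^sup>2"
      using tail[of "e/2"] by auto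
    have "dist (X m) (Abs_ell2 f) < e" if "m \<ge> M" for m
    proof -
      have b: "\<forall>F. (\<Sum>i\<in>F. (cmod (ell2_fun (X m) i - f i))\<^sup>2) \<le> (e/2)\<^sup>2"
        using M \<open>m \<ge> M\<close> by blast
      then have "(\<Sum>\<^sub>\<infinity>i. (cmod (ell2_fun (X m) i - f i))\<^sup>2) \<le> (e/2)\<^sup>2"
        by (intro infsum_le_finite_sums diff[OF b]) auto
      then have "dist (X m) (Abs_ell2 f) \<le> sqrt ((e/2)\<^sup>2)"
        by (simp add: dist_norm norm_ell2_def minus_ell2.rep_eq Abs_ell2_inverse f del: real_sqrt_abs)
      then show ?thesis using \<open>e > 0\<close> by simp
    qed
    then show "\<exists>M. \<forall>m\<ge>M. dist (X m) (Abs_ell2 f) < e" by blast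
  qed
  then show "convergent X" by (auto simp: convergent_def)
qed

lift_definition scaleC :: "complex \<Rightarrow> 'a ell2 \<Rightarrow> 'a ell2" (infixr \<open>*\<^sub>C\<close> 75)
  is "\<lambda>c f x. c * f x"
  by (rule square_summable_scale)

lift_definition delta :: "'a \<Rightarrow> 'a ell2" is "\<lambda>\<gamma> x. if x = \<gamma> then 1 else 0"
  subgoal for \<gamma>
    using finite_nonzero_values_imp_summable_on[of UNIV "\<lambda>x. (cmod (if x = \<gamma> then 1 else 0))\<^sup>2"]
    by (auto simp: if_distrib)
  done

definition cinner :: "'a ell2 \<Rightarrow> 'a ell2 \<Rightarrow> complex" where
  "cinner \<xi> \<eta> = (\<Sum>\<^sub>\<infinity>x. ell2_fun \<xi> x * cnj (ell2_fun \<eta> x))"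

definition ell2_on :: "'a set \<Rightarrow> 'a ell2 set" where
  "ell2_on S = {\<xi>. \<forall>x. x \<notin> S \<longrightarrow> ell2_fun \<xi> x = 0}"

subsection \<open>Bounded operators\<close>

text \<open>
  The type \<open>'a ell2 \<Rightarrow>\<^sub>L 'a ell2\<close> consists of the real-linear bounded operators with the
  operator norm; the complex-linear ones are singled out by \<open>complex_linear\<close>.
\<close>

type_synonym 'a op = "'a ell2 \<Rightarrow>\<^sub>L 'a ell2"

definition complex_linear :: "'a op \<Rightarrow> bool" where
  "complex_linear T \<longleftrightarrow> (\<forall>c \<xi>. blinfun_apply T (c *\<^sub>C \<xi>) = c *\<^sub>C blinfun_apply T \<xi>)"

lemma bounded_linear_scaleC: "bounded_linear (scaleC c)"
proof (rule bounded_linear_intro[of _ "cmod c"])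
  fix x y :: "'a ell2" and r :: real
  show "c *\<^sub>C (x + y) = c *\<^sub>C x + c *\<^sub>C y" "c *\<^sub>C (r *\<^sub>R x) = r *\<^sub>R (c *\<^sub>C x)"
    by (transfer, simp add: algebra_simps)+
  have "(norm (c *\<^sub>C x))\<^sup>2 = (norm x * cmod c)\<^sup>2"
    by (simp add: norm_ell2_def scaleC.rep_eq norm_mult power_mult_distrib infsum_nonneg
        infsum_cmult_right ell2_square_summable mult.commute)
  then show "norm (c *\<^sub>C x) \<le> norm x * cmod c"
    by (simp add: power2_eq_iff_nonneg)
qed

definition scaleC_op :: "complex \<Rightarrow> 'a op \<Rightarrow> 'a op" where
  "scaleC_op c T = Blinfun (\<lambda>\<xi>. c *\<^sub>C blinfun_apply T \<xi>)"

lemma scaleC_op_apply [simp]: "blinfun_apply (scaleC_op c T) \<xi> = c *\<^sub>C blinfun_apply T \<xi>"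
  unfolding scaleC_op_def
  by (subst bounded_linear_Blinfun_apply)
     (rule bounded_linear_compose[OF bounded_linear_scaleC blinfun.bounded_linear_right], rule refl)

interpretation op: vector_space "scaleC_op :: complex \<Rightarrow> 'a op \<Rightarrow> 'a op"
proof
  fix a b :: complex and x y :: "'a op"
  show "scaleC_op a (x + y) = scaleC_op a x + scaleC_op a y"
    by (rule blinfun_eqI)
       (simp add: blinfun.add_left linear_add bounded_linear.linear[OF bounded_linear_scaleC])
  have *: "(a + b) *\<^sub>C \<xi> = a *\<^sub>C \<xi> + b *\<^sub>C \<xi>" "a *\<^sub>C b *\<^sub>C \<xi> = (a * b) *\<^sub>C \<xi>" "1 *\<^sub>C \<xi> = \<xi>"
    for \<xi> :: "'a ell2"
    by (transfer, simp add: algebra_simps)+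
  show "scaleC_op (a + b) x = scaleC_op a x + scaleC_op b x"
    "scaleC_op a (scaleC_op b x) = scaleC_op (a * b) x" "scaleC_op 1 x = x"
    by (rule blinfun_eqI, simp add: blinfun.add_left *)+
qed

definition adj :: "'a op \<Rightarrow> 'a op" where
  "adj T = (THE S. \<forall>\<xi> \<eta>. cinner (blinfun_apply T \<xi>) \<eta> = cinner \<xi> (blinfun_apply S \<eta>))"


section \<open>\<open>C\<^sup>*\<close>-algebras of operators and pure infiniteness\<close>

text \<open>
  Here \<open>A\<close> is a \<open>C\<^sup>*\<close>-algebra given as a norm-closed \<open>*\<close>-subalgebra of the complex-linear
  bounded operators; its positive elements are those of the form \<open>c\<^sup>* c\<close> with \<open>c \<in> A\<close>.
\<close>

definition positive_elements :: "'a op set \<Rightarrow> 'a op set" where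
  "positive_elements A = {adj c o\<^sub>L c | c. c \<in> A}"

definition star_hom_to_complex :: "'a op set \<Rightarrow> ('a op \<Rightarrow> complex) \<Rightarrow> bool" where
  "star_hom_to_complex A \<phi> \<longleftrightarrow>
     (\<forall>a\<in>A. \<forall>b\<in>A. \<phi> (a + b) = \<phi> a + \<phi> b \<and> \<phi> (a o\<^sub>L b) = \<phi> a * \<phi> b) \<and>
     (\<forall>c. \<forall>a\<in>A. \<phi> (scaleC_op c a) = c * \<phi> a) \<and>
     (\<forall>a\<in>A. \<phi> (adj a) = cnj (\<phi> a))"

definition Cstar_precsim :: "'a op set \<Rightarrow> 'a op \<Rightarrow> 'a op \<Rightarrow> bool" where
  "Cstar_precsim A b a \<longleftrightarrow>
     (\<exists>\<alpha>::nat \<Rightarrow> 'a op. (\<forall>i. \<alpha> i \<in> A) \<and> (\<lambda>i. \<alpha> i o\<^sub>L a o\<^sub>L adj (\<alpha> i)) \<longlonglongrightarrow> b)"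

definition Cstar_AaA :: "'a op set \<Rightarrow> 'a op \<Rightarrow> 'a op set" where
  "Cstar_AaA A a = op.span {c o\<^sub>L a o\<^sub>L d | c d. c \<in> A \<and> d \<in> A}"

definition Cstar_purely_infinite :: "'a op set \<Rightarrow> bool" where
  "Cstar_purely_infinite A \<longleftrightarrow>
     (\<forall>\<phi>. star_hom_to_complex A \<phi> \<longrightarrow> (\<forall>a\<in>A. \<phi> a = 0)) \<and>
     (\<forall>a\<in>positive_elements A. \<forall>b\<in>positive_elements A.
        Cstar_precsim A b a \<longleftrightarrow> b \<in> closure (Cstar_AaA A a))"


section \<open>The reduced \<open>C\<^sup>*\<close>-algebra of a groupoid\<close>

text \<open>
  The Hilbert space \<open>\<ell>\<^sup>2(G\<^sub>u)\<close> is regarded as the subspace of \<open>\<ell>\<^sup>2(G)\<close> of functions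
  supported in \<open>G\<^sub>u = src\<inverse>(u)\<close>, and \<open>R\<^sub>u(f)\<close> is extended by zero on its orthogonal complement.
  A bounded operator is determined by its values on the \<open>\<delta>\<^sub>\<gamma>\<close>, and the sum has only
  finitely many nonzero terms for \<open>f\<close> in \<open>C\<^sub>c(G)\<close> and \<open>G\<close> ample and Hausdorff.
\<close>

definition fibre :: "'g groupoid \<Rightarrow> 'g \<Rightarrow> 'g set" where
  "fibre G u = {\<gamma>. src G \<gamma> = u}"

definition regular_rep :: "'g groupoid \<Rightarrow> 'g \<Rightarrow> ('g \<Rightarrow> complex) \<Rightarrow> 'g op" where
  "regular_rep G u f = (THE T. complex_linear T \<and>
     (\<forall>\<gamma>. blinfun_apply T (delta \<gamma>) =
        (if \<gamma> \<in> fibre G u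
         then \<Sum>\<^sub>\<infinity>\<alpha>\<in>{\<alpha>. src G \<alpha> = rng G \<gamma>}. f \<alpha> *\<^sub>C delta (mul G \<alpha> \<gamma>)
         else 0)))"

text \<open>
  As \<open>G\<close> is the disjoint union of the \<open>G\<^sub>u\<close>, the direct sum of the \<open>\<ell>\<^sup>2(G\<^sub>u)\<close> is \<open>\<ell>\<^sup>2(G)\<close>.
\<close>

definition regular_rep_sum :: "'g groupoid \<Rightarrow> ('g \<Rightarrow> complex) \<Rightarrow> 'g op" where
  "regular_rep_sum G f = (THE T. complex_linear T \<and>
     (\<forall>u\<in>units G. \<forall>\<xi>\<in>ell2_on (fibre G u).
        blinfun_apply T \<xi> = blinfun_apply (regular_rep G u f) \<xi>))"

text \<open>The completion is the closure in the complete space of bounded operators on \<open>\<ell>\<^sup>2(G)\<close>.\<close>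

definition reduced_Cstar :: "'g::topological_space groupoid \<Rightarrow> 'g op set" where
  "reduced_Cstar G = closure (regular_rep_sum G ` Cc)"

end

theory Submission
  imports Defs
begin

text \<open>
  Write \<open>A\<close> for the reduced algebra and \<open>1\<^sub>K\<close> for the projection of a compact open set \<open>K\<close> of units.
  Let \<open>a = d\<^sup>* d\<close> be nonzero in \<open>A\<close>. Some diagonal entry \<open>t\<close> of \<open>a\<close> is positive; approximating \<open>a\<close>
  by a function in \<open>C\<^sub>c(G)\<close> and cutting down to a small set of units that effectiveness keeps away
  from the off-diagonal part gives a nonempty \<open>W\<close> with \<open>\<parallel>1\<^sub>W - t\<inverse> 1\<^sub>W a 1\<^sub>W\<parallel> < 1\<close>. By minimality every
  \<open>1\<^sub>K\<close> lies in the ideal of the Steinberg algebra generated by \<open>1\<^sub>W\<close>, so algebraic pure infiniteness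
  gives \<open>1\<^sub>K = y 1\<^sub>W z\<close>. The nonselfadjoint factorisations become selfadjoint ones: if \<open>Y a Z\<close> is within
  distance less than 1 of a projection \<open>q\<close>, then \<open>x a x\<^sup>*\<close> comes arbitrarily close to \<open>q\<close>. Hence every
  \<open>1\<^sub>K\<close> is a limit of elements \<open>x a x\<^sup>*\<close>, and so is every \<open>c\<^sup>* c\<close>, as the limit of the \<open>c\<^sup>* 1\<^sub>K c\<close>.

  A nonzero \<open>*\<close>-homomorphism to the complex numbers would not vanish on the Steinberg algebra, and the
  quotient of the latter by its kernel would be a field.
\<close>

section \<open>Adjoints and \<open>*\<close>-algebras of operators\<close>

lemma cinner_eq_Complex: "cinner \<xi> \<eta> = Complex (inner \<xi> \<eta>) (inner \<xi> (\<i> *\<^sub>C \<eta>))"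
proof -
  have s: "(\<lambda>x. ell2_fun \<xi> x * cnj (ell2_fun \<eta> x)) summable_on UNIV"
    by (rule abs_summable_summable)
       (simp add: norm_mult square_summable_prod[OF ell2_square_summable ell2_square_summable])
  have "Re (cinner \<xi> \<eta>) = inner \<xi> \<eta>"
    using infsum_Re[OF s] by (simp add: cinner_def inner_ell2_def inner_complex_def)
  moreover have "Im (cinner \<xi> \<eta>) = inner \<xi> (\<i> *\<^sub>C \<eta>)"
    using infsum_Im[OF s] by (simp add: cinner_def inner_ell2_def inner_complex_def scaleC.rep_eq algebra_simps)
  ultimately show ?thesis by (simp add: complex_eq_iff)
qed

lemma inner_scaleC_ii: "inner (\<i> *\<^sub>C \<xi>) \<eta> = - inner \<xi> (\<i> *\<^sub>C \<eta>)"
  unfolding inner_ell2_def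
  by (subst infsum_uminus[symmetric]) (simp add: scaleC.rep_eq inner_complex_def algebra_simps)

lemma scaleC_of_real: "(of_real r) *\<^sub>C \<xi> = r *\<^sub>R \<xi>"
  by transfer simp

lemma scaleR_scaleC_commute: "c *\<^sub>C r *\<^sub>R \<xi> = r *\<^sub>R c *\<^sub>C \<xi>"
  by transfer (simp add: algebra_simps)

lemma scaleC_add_right: "c *\<^sub>C (\<xi> + \<eta>) = c *\<^sub>C \<xi> + c *\<^sub>C \<eta>"
  by transfer (simp add: algebra_simps)

lemma scaleC_scaleC: "c *\<^sub>C d *\<^sub>C \<xi> = (c * d) *\<^sub>C \<xi>"
  by transfer (simp add: algebra_simps)

lemma scaleC_decomp: "c *\<^sub>C \<xi> = Re c *\<^sub>R \<xi> + Im c *\<^sub>R (\<i> *\<^sub>C \<xi>)"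
  by (transfer, rule ext, subst complex_eq, simp add: algebra_simps)

lemma norm_scaleC: "norm (c *\<^sub>C \<xi>) = cmod c * norm \<xi>"
proof -
  have "(norm (c *\<^sub>C \<xi>))\<^sup>2 = (cmod c * norm \<xi>)\<^sup>2"
    by (simp add: norm_ell2_def scaleC.rep_eq norm_mult power_mult_distrib infsum_nonneg
        infsum_cmult_right ell2_square_summable)
  then show ?thesis by (rule power2_eq_imp_eq) auto
qed

lemma blinfun_compose_assoc: "(S o\<^sub>L T) o\<^sub>L U = S o\<^sub>L (T o\<^sub>L U)"
  by (rule blinfun_eqI) simp

definition is_adjoint :: "'a op \<Rightarrow> 'a op \<Rightarrow> bool" where
  "is_adjoint T S \<longleftrightarrow> (\<forall>\<xi> \<eta>. cinner (blinfun_apply T \<xi>) \<eta> = cinner \<xi> (blinfun_apply S \<eta>))"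

lemma is_adjointI_inner:
  assumes "complex_linear S" "\<And>\<xi> \<eta>. inner (blinfun_apply T \<xi>) \<eta> = inner \<xi> (blinfun_apply S \<eta>)"
  shows "is_adjoint T S"
  using assms unfolding is_adjoint_def complex_linear_def by (metis cinner_eq_Complex)

lemma is_adjoint_inner:
  "is_adjoint T S \<Longrightarrow> inner (blinfun_apply T \<xi>) \<eta> = inner \<xi> (blinfun_apply S \<eta>)"
  unfolding is_adjoint_def by (metis cinner_eq_Complex complex.sel(1))

lemma is_adjoint_sym:
  assumes "is_adjoint T S" "complex_linear T"
  shows "is_adjoint S T"
  using is_adjoint_inner[OF assms(1)] assms(2) by (intro is_adjointI_inner) (metis inner_commute)+

lemma is_adjoint_unique:
  assumes "is_adjoint T S" "is_adjoint T S'"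
  shows "S = S'"
proof (rule blinfun_eqI)
  fix \<eta>
  have "inner \<xi> (blinfun_apply S \<eta> - blinfun_apply S' \<eta>) = 0" for \<xi>
    using is_adjoint_inner[OF assms(1)] is_adjoint_inner[OF assms(2)] by (simp add: inner_diff_right)
  from this[of "blinfun_apply S \<eta> - blinfun_apply S' \<eta>"] show "blinfun_apply S \<eta> = blinfun_apply S' \<eta>"
    by simp
qed

lemma adj_eqI: "is_adjoint T S \<Longrightarrow> adj T = S"
  unfolding adj_def by (rule the_equality) (auto simp: is_adjoint_def[symmetric] intro: is_adjoint_unique)

lemma norm_is_adjoint_le:
  assumes "is_adjoint T S"
  shows "norm S \<le> norm T"
proof (rule norm_blinfun_bound)
  fix \<eta>
  have "norm (blinfun_apply S \<eta>) * norm (blinfun_apply S \<eta>) = inner (blinfun_apply S \<eta>) (blinfun_apply S \<eta>)"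
    by (simp add: power2_norm_eq_inner[symmetric] power2_eq_square)
  also have "\<dots> = inner (blinfun_apply T (blinfun_apply S \<eta>)) \<eta>"
    using is_adjoint_inner[OF assms, of "blinfun_apply S \<eta>" \<eta>] by simp
  also have "\<dots> \<le> norm (blinfun_apply T (blinfun_apply S \<eta>)) * norm \<eta>"
    by (rule norm_cauchy_schwarz)
  also have "\<dots> \<le> (norm T * norm (blinfun_apply S \<eta>)) * norm \<eta>"
    by (intro mult_right_mono norm_blinfun) auto
  finally have "norm (blinfun_apply S \<eta>) * norm (blinfun_apply S \<eta>)
      \<le> (norm T * norm \<eta>) * norm (blinfun_apply S \<eta>)" by (simp add: mult_ac)
  then show "norm (blinfun_apply S \<eta>) \<le> norm T * norm \<eta>"
    by (cases "norm (blinfun_apply S \<eta>) = 0") auto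
qed simp

lemma complex_linear_add: "complex_linear S \<Longrightarrow> complex_linear T \<Longrightarrow> complex_linear (S + T)"
  by (simp add: complex_linear_def blinfun.bilinear_simps scaleC_add_right)

lemma complex_linear_compose: "complex_linear S \<Longrightarrow> complex_linear T \<Longrightarrow> complex_linear (S o\<^sub>L T)"
  by (simp add: complex_linear_def)

lemma complex_linear_scaleC_op: "complex_linear T \<Longrightarrow> complex_linear (scaleC_op c T)"
  by (simp add: complex_linear_def scaleC_scaleC mult_ac)

lemma is_adjoint_add:
  assumes "is_adjoint S S'" "is_adjoint T T'" "complex_linear S'" "complex_linear T'"
  shows "is_adjoint (S + T) (S' + T')"
  using assms by (intro is_adjointI_inner complex_linear_add)
    (auto simp: blinfun.bilinear_simps inner_add_left inner_add_right is_adjoint_inner)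

lemma is_adjoint_compose:
  assumes "is_adjoint S S'" "is_adjoint T T'"
  shows "is_adjoint (S o\<^sub>L T) (T' o\<^sub>L S')"
  using assms by (simp add: is_adjoint_def)

lemma is_adjoint_uminus:
  assumes "is_adjoint T T'" "complex_linear T'"
  shows "is_adjoint (- T) (- T')"
  using assms by (intro is_adjointI_inner)
    (auto simp: complex_linear_def blinfun.bilinear_simps linear_neg bounded_linear.linear[OF bounded_linear_scaleC] is_adjoint_inner)

lemma blinfun_apply_tendsto: "X \<longlonglongrightarrow> T \<Longrightarrow> (\<lambda>n. blinfun_apply (X n) \<xi>) \<longlonglongrightarrow> blinfun_apply T \<xi>"
  by (intro tendsto_intros)

lemma complex_linear_lim:
  assumes "\<And>n. complex_linear (X n)" "X \<longlonglongrightarrow> T"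
  shows "complex_linear T"
  unfolding complex_linear_def
proof (intro allI)
  fix c \<xi>
  have 1: "(\<lambda>n. blinfun_apply (X n) (c *\<^sub>C \<xi>)) \<longlonglongrightarrow> blinfun_apply T (c *\<^sub>C \<xi>)"
    by (rule blinfun_apply_tendsto[OF assms(2)])
  have 2: "(\<lambda>n. c *\<^sub>C blinfun_apply (X n) \<xi>) \<longlonglongrightarrow> c *\<^sub>C blinfun_apply T \<xi>"
    by (rule bounded_linear.tendsto[OF bounded_linear_scaleC blinfun_apply_tendsto[OF assms(2)]])
  have "(\<lambda>n. blinfun_apply (X n) (c *\<^sub>C \<xi>)) = (\<lambda>n. c *\<^sub>C blinfun_apply (X n) \<xi>)"
    using assms(1) by (simp add: complex_linear_def)
  with 1 2 show "blinfun_apply T (c *\<^sub>C \<xi>) = c *\<^sub>C blinfun_apply T \<xi>"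
    using LIMSEQ_unique by fastforce
qed

text \<open>Adjoints in the closure are limits of adjoints, so the Riesz representation is not needed.\<close>

lemma is_adjoint_lim:
  assumes lin: "\<And>n. complex_linear (X n)" "\<And>n. complex_linear (Y n)"
    and adj: "\<And>n. is_adjoint (X n) (Y n)" and lim: "X \<longlonglongrightarrow> T"
  obtains S where "Y \<longlonglongrightarrow> S" "is_adjoint T S"
proof -
  have d: "dist (Y m) (Y n) \<le> dist (X m) (X n)" for m n
  proof -
    have "complex_linear (- Y n)"
      using lin(2)[of n] by (simp add: complex_linear_def blinfun.bilinear_simps linear_neg bounded_linear.linear[OF bounded_linear_scaleC])
    then have "is_adjoint (X m + - X n) (Y m + - Y n)"
      using adj lin by (intro is_adjoint_add is_adjoint_uminus) auto
    from norm_is_adjoint_le[OF this] show ?thesis by (simp add: dist_norm)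
  qed
  have "Cauchy Y"
  proof (rule metric_CauchyI)
    fix e :: real assume "e > 0"
    then obtain M where "\<forall>m\<ge>M. \<forall>n\<ge>M. dist (X m) (X n) < e"
      using LIMSEQ_imp_Cauchy[OF lim] unfolding Cauchy_def by blast
    then show "\<exists>M. \<forall>m\<ge>M. \<forall>n\<ge>M. dist (Y m) (Y n) < e" using d by (meson le_less_trans)
  qed
  then obtain S where S: "Y \<longlonglongrightarrow> S" using Cauchy_convergent convergent_def by blast
  have "is_adjoint T S"
  proof (rule is_adjointI_inner)
    show "complex_linear S" using complex_linear_lim[OF lin(2) S] .
    fix \<xi> \<eta>
    have "(\<lambda>n. inner (blinfun_apply (X n) \<xi>) \<eta>) \<longlonglongrightarrow> inner (blinfun_apply T \<xi>) \<eta>"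
      by (intro tendsto_intros lim)
    moreover have "(\<lambda>n. inner \<xi> (blinfun_apply (Y n) \<eta>)) \<longlonglongrightarrow> inner \<xi> (blinfun_apply S \<eta>)"
      by (intro tendsto_intros S)
    moreover have "(\<lambda>n. inner (blinfun_apply (X n) \<xi>) \<eta>) = (\<lambda>n. inner \<xi> (blinfun_apply (Y n) \<eta>))"
      using is_adjoint_inner[OF adj] by simp
    ultimately show "inner (blinfun_apply T \<xi>) \<eta> = inner \<xi> (blinfun_apply S \<eta>)"
      using LIMSEQ_unique by fastforce
  qed
  with S that show thesis by blast
qed

lemma closureI_lim: "(\<And>n. X n \<in> B) \<Longrightarrow> X \<longlonglongrightarrow> T \<Longrightarrow> T \<in> closure B"
  for B :: "'b::first_countable_topology set"
  unfolding closure_sequential by auto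

locale star_algebra =
  fixes A :: "'a op set"
  assumes add_closed: "S \<in> A \<Longrightarrow> T \<in> A \<Longrightarrow> S + T \<in> A"
    and scaleC_closed: "T \<in> A \<Longrightarrow> scaleC_op c T \<in> A"
    and compose_closed: "S \<in> A \<Longrightarrow> T \<in> A \<Longrightarrow> S o\<^sub>L T \<in> A"
    and complex_linear: "T \<in> A \<Longrightarrow> complex_linear T"
    and ex_adjoint: "T \<in> A \<Longrightarrow> \<exists>S\<in>A. is_adjoint T S"
    and nonempty: "A \<noteq> {}"
begin

lemma scaleR_closed: "T \<in> A \<Longrightarrow> r *\<^sub>R T \<in> A"
  using scaleC_closed[of T "of_real r"] by (metis (no_types, lifting) blinfun.scaleR_left blinfun_eqI scaleC_of_real scaleC_op_apply)

lemma diff_closed: "S \<in> A \<Longrightarrow> T \<in> A \<Longrightarrow> S - T \<in> A"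
  using add_closed[of S "(-1) *\<^sub>R T"] scaleR_closed[of T "-1"] by simp

lemma zero_closed: "0 \<in> A"
  using nonempty diff_closed by fastforce

lemma is_adjoint_adj: "T \<in> A \<Longrightarrow> is_adjoint T (adj T)"
  using ex_adjoint adj_eqI by blast

lemma adj_closed: "T \<in> A \<Longrightarrow> adj T \<in> A"
  using ex_adjoint adj_eqI by blast

lemma is_adjoint_adj': "T \<in> A \<Longrightarrow> is_adjoint (adj T) T"
  by (simp add: complex_linear is_adjoint_adj is_adjoint_sym)

lemma inner_adj: "T \<in> A \<Longrightarrow> inner (blinfun_apply T \<xi>) \<eta> = inner \<xi> (blinfun_apply (adj T) \<eta>)"
  by (simp add: is_adjoint_adj is_adjoint_inner)

lemma adj_adj: "T \<in> A \<Longrightarrow> adj (adj T) = T"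
  by (simp add: adj_eqI is_adjoint_adj')

lemma adj_compose: "S \<in> A \<Longrightarrow> T \<in> A \<Longrightarrow> adj (S o\<^sub>L T) = adj T o\<^sub>L adj S"
  by (intro adj_eqI is_adjoint_compose is_adjoint_adj)

lemma adj_scaleR: "T \<in> A \<Longrightarrow> adj (r *\<^sub>R T) = r *\<^sub>R adj T"
  by (intro adj_eqI is_adjointI_inner)
     (auto simp: adj_closed complex_linear scaleR_closed blinfun.bilinear_simps inner_adj)

lemma adj_add: "S \<in> A \<Longrightarrow> T \<in> A \<Longrightarrow> adj (S + T) = adj S + adj T"
  by (intro adj_eqI is_adjoint_add is_adjoint_adj) (auto simp: adj_closed complex_linear)

lemma adj_diff: "S \<in> A \<Longrightarrow> T \<in> A \<Longrightarrow> adj (S - T) = adj S - adj T"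
  using adj_add[of S "(-1) *\<^sub>R T"] adj_scaleR[of T "-1"] scaleR_closed[of T "-1"] by simp

lemma norm_adj: "T \<in> A \<Longrightarrow> norm (adj T) = norm T"
  by (meson antisym is_adjoint_adj is_adjoint_adj' norm_is_adjoint_le)

lemma star_algebra_closure: "star_algebra (closure A)"
proof
  fix S T assume S: "S \<in> closure A" and T: "T \<in> closure A"
  obtain X where X: "\<And>n. X n \<in> A" "X \<longlonglongrightarrow> S" using S by (auto simp: closure_sequential)
  obtain Y where Y: "\<And>n. Y n \<in> A" "Y \<longlonglongrightarrow> T" using T by (auto simp: closure_sequential)
  show "S + T \<in> closure A"
    by (rule closureI_lim[OF _ tendsto_add[OF X(2) Y(2)]]) (rule add_closed[OF X(1) Y(1)])
  show "S o\<^sub>L T \<in> closure A"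
    by (rule closureI_lim[OF _ bounded_bilinear.tendsto[OF bounded_bilinear_blinfun_compose X(2) Y(2)]])
       (rule compose_closed[OF X(1) Y(1)])
next
  fix T assume "T \<in> closure A"
  then obtain X where X: "\<And>n. X n \<in> A" "X \<longlonglongrightarrow> T" by (auto simp: closure_sequential)
  show "complex_linear T" by (rule complex_linear_lim[OF complex_linear[OF X(1)] X(2)])
  obtain S where "(\<lambda>n. adj (X n)) \<longlonglongrightarrow> S" "is_adjoint T S"
    by (rule is_adjoint_lim[OF complex_linear[OF X(1)] complex_linear[OF adj_closed[OF X(1)]]
          is_adjoint_adj[OF X(1)] X(2)])
  then show "\<exists>S\<in>closure A. is_adjoint T S"
    using closureI_lim[OF adj_closed[OF X(1)]] by auto
  fix c
  have b: "bounded_linear (scaleC_op c :: 'a op \<Rightarrow> 'a op)"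
  proof (rule bounded_linear_intro[of _ "cmod c"])
    fix x y :: "'a op" and r
    show "scaleC_op c (x + y) = scaleC_op c x + scaleC_op c y" by (rule op.scale_right_distrib)
    show "scaleC_op c (r *\<^sub>R x) = r *\<^sub>R scaleC_op c x"
      by (rule blinfun_eqI) (simp add: blinfun.bilinear_simps scaleR_scaleC_commute)
    show "norm (scaleC_op c x) \<le> norm x * cmod c"
    proof (rule norm_blinfun_bound)
      show "norm (blinfun_apply (scaleC_op c x) \<xi>) \<le> norm x * cmod c * norm \<xi>" for \<xi>
        using mult_left_mono[OF norm_blinfun[of x \<xi>], of "cmod c"] by (simp add: norm_scaleC mult_ac)
    qed simp
  qed
  show "scaleC_op c T \<in> closure A"
    by (rule closureI_lim[OF _ bounded_linear.tendsto[OF b X(2)]]) (rule scaleC_closed[OF X(1)])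
next
  show "closure A \<noteq> {}" using nonempty by simp
qed

lemma norm_projection_le:
  assumes "q \<in> A" "q o\<^sub>L q = q" "adj q = q"
  shows "norm (blinfun_apply q \<xi>) \<le> norm \<xi>"
proof -
  have "blinfun_apply q (blinfun_apply q \<xi>) = blinfun_apply q \<xi>"
    by (metis assms(2) blinfun_apply_blinfun_compose)
  then have "norm (blinfun_apply q \<xi>) * norm (blinfun_apply q \<xi>) = inner \<xi> (blinfun_apply q \<xi>)"
    using inner_adj[OF assms(1), of \<xi> "blinfun_apply q \<xi>"] assms(3)
    by (simp add: power2_norm_eq_inner[symmetric] power2_eq_square)
  also have "\<dots> \<le> norm \<xi> * norm (blinfun_apply q \<xi>)"
    by (rule norm_cauchy_schwarz)
  finally show ?thesis
    by (cases "norm (blinfun_apply q \<xi>) = 0") auto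
qed

text \<open>
  Replacing \<open>x\<close> by \<open>(q + h/2) x\<close>, where \<open>h = q - x a x\<^sup>*\<close>, turns the error \<open>h\<close> into
  \<open>3/4 h\<^sup>2 + 1/4 h\<^sup>3\<close>; this replaces an inverse square root.
\<close>

lemma projection_from_approx:
  assumes q: "q \<in> A" "q o\<^sub>L q = q" "adj q = q" and a: "a \<in> A" "adj a = a"
    and x: "x \<in> A" "q o\<^sub>L x = x" and lt1: "norm (q - (x o\<^sub>L a o\<^sub>L adj x)) < 1" and "\<epsilon> > 0"
  shows "\<exists>y\<in>A. q o\<^sub>L y = y \<and> norm (q - (y o\<^sub>L a o\<^sub>L adj y)) < \<epsilon>"
proof -
  define \<delta> where "\<delta> = norm (q - (x o\<^sub>L a o\<^sub>L adj x))"
  have step: "\<exists>y\<in>A. q o\<^sub>L y = y \<and> norm (q - (y o\<^sub>L a o\<^sub>L adj y)) \<le> \<delta> ^ Suc n" for n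
  proof (induction n)
    case 0
    then show ?case using x \<delta>_def by auto
  next
    case (Suc n)
    then obtain y where y: "y \<in> A" "q o\<^sub>L y = y" "norm (q - (y o\<^sub>L a o\<^sub>L adj y)) \<le> \<delta> ^ Suc n" by blast
    define h where "h = q - (y o\<^sub>L a o\<^sub>L adj y)"
    define w where "w = q + (1/2) *\<^sub>R h"
    define b where "b = y o\<^sub>L a o\<^sub>L adj y"
    have hA: "h \<in> A" "w \<in> A" "b \<in> A"
      unfolding h_def w_def b_def using y q a by (auto intro!: add_closed diff_closed compose_closed scaleR_closed adj_closed)
    have yq: "adj y o\<^sub>L q = adj y" using adj_compose[OF q(1) y(1)] y(2) q(3) by simp
    have adjb: "adj b = b"
      unfolding b_def using y(1) a by (simp add: adj_compose compose_closed adj_closed adj_adj blinfun_compose_assoc)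
    have adjh: "adj h = h" using adj_diff[OF q(1) hA(3)] adjb q(3) by (simp add: h_def b_def)
    have adjw: "adj w = w" using adj_add[OF q(1) scaleR_closed[OF hA(1)]] adj_scaleR[OF hA(1)] adjh q(3) by (simp add: w_def)
    have qh: "blinfun_apply q (blinfun_apply h \<xi>) = blinfun_apply h \<xi>" for \<xi>
      using q(2) y(2) unfolding h_def
      by (metis (no_types, lifting) blinfun.diff_left blinfun.diff_right blinfun_apply_blinfun_compose)
    have hq: "blinfun_apply h (blinfun_apply q \<xi>) = blinfun_apply h \<xi>" for \<xi>
      using q(2) yq unfolding h_def
      by (metis (no_types, lifting) blinfun.diff_left blinfun_apply_blinfun_compose)
    have qq: "blinfun_apply q (blinfun_apply q \<xi>) = blinfun_apply q \<xi>" for \<xi>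
      by (metis q(2) blinfun_apply_blinfun_compose)
    have "q - (w o\<^sub>L (q - h) o\<^sub>L w) = (3/4) *\<^sub>R (h o\<^sub>L h) + (1/4) *\<^sub>R (h o\<^sub>L h o\<^sub>L h)"
      unfolding w_def
      by (rule blinfun_eqI) (simp add: blinfun.bilinear_simps qh hq qq algebra_simps scaleR_left.add[symmetric]
          scaleR_add_left[symmetric])
    moreover have "(w o\<^sub>L y) o\<^sub>L a o\<^sub>L adj (w o\<^sub>L y) = w o\<^sub>L (q - h) o\<^sub>L w"
      using adj_compose[OF hA(2) y(1)] adjw by (simp add: h_def blinfun_compose_assoc)
    ultimately have eq: "q - ((w o\<^sub>L y) o\<^sub>L a o\<^sub>L adj (w o\<^sub>L y)) = (3/4) *\<^sub>R (h o\<^sub>L h) + (1/4) *\<^sub>R (h o\<^sub>L h o\<^sub>L h)"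
      by simp
    have d0: "0 \<le> \<delta>" "\<delta> < 1" using lt1 by (auto simp: \<delta>_def)
    have h1: "norm h \<le> \<delta> ^ Suc n" using y(3) by (simp add: h_def)
    also have d1: "\<delta> ^ Suc n \<le> 1" using d0 by (intro power_le_one) auto
    finally have hle1: "norm h \<le> 1" .
    have n2: "norm (h o\<^sub>L h) \<le> norm h * norm h" by (rule norm_blinfun_compose)
    have "norm (h o\<^sub>L h o\<^sub>L h) \<le> norm (h o\<^sub>L h) * norm h" by (rule norm_blinfun_compose)
    also have "\<dots> \<le> norm (h o\<^sub>L h) * 1" using hle1 by (intro mult_left_mono) auto
    finally have n3: "norm (h o\<^sub>L h o\<^sub>L h) \<le> norm h * norm h" using n2 by simp
    have "norm ((3/4) *\<^sub>R (h o\<^sub>L h) + (1/4) *\<^sub>R (h o\<^sub>L h o\<^sub>L h)) \<le> 3/4 * norm (h o\<^sub>L h) + 1/4 * norm (h o\<^sub>L h o\<^sub>L h)"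
      by (rule order_trans[OF norm_triangle_ineq]) simp
    also have "\<dots> \<le> norm h * norm h" using n2 n3 by simp
    also have "\<dots> \<le> \<delta> ^ Suc n * \<delta> ^ Suc n" using h1 d0 by (intro mult_mono) auto
    also have "\<dots> \<le> \<delta> ^ Suc n * \<delta>"
      using d0 d1 power_decreasing[of 1 "Suc n" \<delta>] by (intro mult_left_mono) auto
    finally have "norm (q - ((w o\<^sub>L y) o\<^sub>L a o\<^sub>L adj (w o\<^sub>L y))) \<le> \<delta> ^ Suc (Suc n)"
      using eq by (simp add: mult_ac)
    moreover have "q o\<^sub>L (w o\<^sub>L y) = w o\<^sub>L y"
      unfolding w_def by (rule blinfun_eqI) (simp add: blinfun.bilinear_simps qh qq)
    ultimately show ?case using compose_closed[OF hA(2) y(1)] by blast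
  qed
  have "(\<lambda>n. \<delta> ^ Suc n) \<longlonglongrightarrow> 0"
    using LIMSEQ_Suc[OF LIMSEQ_realpow_zero[of \<delta>]] lt1 \<delta>_def by auto
  then obtain n where "\<delta> ^ Suc n < \<epsilon>"
    using \<open>\<epsilon> > 0\<close> by (metis (no_types, lifting) LIMSEQ_iff abs_less_iff diff_zero le_refl real_norm_def)
  then show ?thesis using step[of n] by (meson le_less_trans)
qed

text \<open>
  If \<open>Y a Z\<close> is within distance less than 1 of \<open>q\<close>, then \<open>T = q Y d\<^sup>*\<close> has \<open>T T\<^sup>*\<close> bounded below
  on the range of \<open>q\<close>, so \<open>\<parallel>q - s T T\<^sup>*\<parallel> < 1\<close> for small \<open>s > 0\<close>.
\<close>

lemma projection_precsim:
  assumes q: "q \<in> A" "q o\<^sub>L q = q" "adj q = q" and d: "d \<in> A" and YZ: "Y \<in> A" "Z \<in> A"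
    and lt1: "norm (q - (Y o\<^sub>L (adj d o\<^sub>L d) o\<^sub>L Z)) < 1" and "\<epsilon> > 0"
  shows "\<exists>x\<in>A. norm (q - (x o\<^sub>L (adj d o\<^sub>L d) o\<^sub>L adj x)) < \<epsilon>"
proof -
  define T where "T = q o\<^sub>L Y o\<^sub>L adj d"
  define S where "S = d o\<^sub>L Z"
  define T' where "T' = adj T"
  define S' where "S' = adj S"
  define E where "E = q - (Y o\<^sub>L (adj d o\<^sub>L d) o\<^sub>L Z)"
  define r where "r = norm E"
  have mem: "T \<in> A" "S \<in> A" "T' \<in> A" "S' \<in> A" "E \<in> A" "adj d \<in> A"
    unfolding T_def S_def T'_def S'_def E_def using q d YZ by (auto intro!: compose_closed adj_closed diff_closed)
  have qq: "blinfun_apply q (blinfun_apply q \<xi>) = blinfun_apply q \<xi>" for \<xi>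
    by (metis q(2) blinfun_apply_blinfun_compose)
  have qT: "blinfun_apply q (blinfun_apply T \<xi>) = blinfun_apply T \<xi>" for \<xi>
    by (simp add: T_def qq)
  have T'q: "blinfun_apply T' (blinfun_apply q \<xi>) = blinfun_apply T' \<xi>" for \<xi>
  proof -
    have "q o\<^sub>L T = T" by (rule blinfun_eqI) (simp add: qT)
    then have "T' o\<^sub>L q = T'" using adj_compose[OF q(1) mem(1)] q(3) by (simp add: T'_def)
    then show ?thesis by (metis blinfun_apply_blinfun_compose)
  qed
  have qE: "q o\<^sub>L E = q - (T o\<^sub>L S)"
    by (rule blinfun_eqI) (simp add: E_def T_def S_def blinfun.bilinear_simps qq)
  have "adj E o\<^sub>L q = q - (S' o\<^sub>L T')"
    using arg_cong[OF qE, of adj] q mem by (simp add: adj_compose adj_diff compose_closed S'_def T'_def)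
  then have E': "blinfun_apply (adj E) (blinfun_apply q \<xi>) = blinfun_apply q \<xi> - blinfun_apply S' (blinfun_apply T' \<xi>)" for \<xi>
    by (metis blinfun.diff_left blinfun_apply_blinfun_compose)
  define k where "k = (1 - r) / (norm S + 1)"
  have r: "0 \<le> r" "r < 1" using lt1 by (auto simp: r_def E_def)
  have k: "k > 0" using r by (auto simp: k_def intro!: divide_pos_pos add_nonneg_pos)
  have below: "k * norm (blinfun_apply q \<xi>) \<le> norm (blinfun_apply T' \<xi>)" for \<xi>
  proof -
    have "norm (blinfun_apply q \<xi>) - norm (blinfun_apply S' (blinfun_apply T' \<xi>))
        \<le> norm (blinfun_apply (adj E) (blinfun_apply q \<xi>))"
      unfolding E' by (rule norm_triangle_ineq2)
    also have "\<dots> \<le> r * norm (blinfun_apply q \<xi>)"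
      using norm_blinfun[of "adj E"] norm_adj[OF mem(5)] by (simp add: r_def)
    finally have "(1 - r) * norm (blinfun_apply q \<xi>) \<le> norm (blinfun_apply S' (blinfun_apply T' \<xi>))"
      by (simp add: algebra_simps)
    also have "\<dots> \<le> norm S * norm (blinfun_apply T' \<xi>)"
      using norm_blinfun[of S'] norm_adj[OF mem(2)] by (simp add: S'_def)
    also have "\<dots> \<le> (norm S + 1) * norm (blinfun_apply T' \<xi>)" by (simp add: algebra_simps)
    finally show ?thesis
      by (simp add: k_def pos_divide_le_eq add_nonneg_pos mult.commute)
  qed
  define s where "s = 1 / ((norm T)\<^sup>2 + 1)"
  have s: "s > 0" "s * (norm T)\<^sup>2 \<le> 1"
    by (auto simp: s_def add_nonneg_pos divide_le_eq)
  define h where "h = q - s *\<^sub>R (T o\<^sub>L T')"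
  define D where "D = max 0 (1 - s * k\<^sup>2)"
  have "(norm (blinfun_apply h \<xi>))\<^sup>2 \<le> D * (norm \<xi>)\<^sup>2" for \<xi>
  proof -
    have i: "inner (blinfun_apply q \<xi>) (blinfun_apply T (blinfun_apply T' \<xi>)) = (norm (blinfun_apply T' \<xi>))\<^sup>2"
      using inner_adj[OF mem(3), of "blinfun_apply q \<xi>" "blinfun_apply T' \<xi>"] adj_adj[OF mem(1)] T'q[of \<xi>]
      by (simp add: T'_def power2_norm_eq_inner)
    have "(norm (blinfun_apply h \<xi>))\<^sup>2
        = (norm (blinfun_apply q \<xi>))\<^sup>2 - 2 * s * inner (blinfun_apply q \<xi>) (blinfun_apply T (blinfun_apply T' \<xi>))
          + s\<^sup>2 * (norm (blinfun_apply T (blinfun_apply T' \<xi>)))\<^sup>2"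
      unfolding power2_norm_eq_inner
      by (simp add: h_def blinfun.bilinear_simps inner_diff_left inner_diff_right
          inner_commute power2_eq_square algebra_simps)
    also have "\<dots> \<le> (norm (blinfun_apply q \<xi>))\<^sup>2 - 2 * s * (norm (blinfun_apply T' \<xi>))\<^sup>2
          + s\<^sup>2 * (norm T * norm (blinfun_apply T' \<xi>))\<^sup>2"
      unfolding i by (intro add_left_mono mult_left_mono power_mono norm_blinfun) auto
    also have "s\<^sup>2 * (norm T * norm (blinfun_apply T' \<xi>))\<^sup>2 = (s * (norm T)\<^sup>2) * (s * (norm (blinfun_apply T' \<xi>))\<^sup>2)"
      by (simp add: power2_eq_square algebra_simps)
    also have "\<dots> \<le> 1 * (s * (norm (blinfun_apply T' \<xi>))\<^sup>2)"
      using s by (intro mult_right_mono) auto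
    finally have "(norm (blinfun_apply h \<xi>))\<^sup>2 \<le> (norm (blinfun_apply q \<xi>))\<^sup>2 - s * (norm (blinfun_apply T' \<xi>))\<^sup>2"
      by simp
    also have "\<dots> \<le> (norm (blinfun_apply q \<xi>))\<^sup>2 - s * (k * norm (blinfun_apply q \<xi>))\<^sup>2"
      using s below k by (intro diff_left_mono mult_left_mono power_mono) auto
    also have "\<dots> = (1 - s * k\<^sup>2) * (norm (blinfun_apply q \<xi>))\<^sup>2"
      by (simp add: power_mult_distrib algebra_simps)
    also have "\<dots> \<le> D * (norm (blinfun_apply q \<xi>))\<^sup>2"
      by (intro mult_right_mono) (auto simp: D_def)
    also have "\<dots> \<le> D * (norm \<xi>)\<^sup>2"
      using norm_projection_le[OF q] by (intro mult_left_mono power_mono) (auto simp: D_def)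
    finally show ?thesis .
  qed
  then have "(norm (blinfun_apply h \<xi>))\<^sup>2 \<le> (sqrt D * norm \<xi>)\<^sup>2" for \<xi>
    by (simp add: power_mult_distrib D_def)
  then have "norm (blinfun_apply h \<xi>) \<le> sqrt D * norm \<xi>" for \<xi>
    by (rule power2_le_imp_le) (simp add: D_def)
  then have "norm h \<le> sqrt D" by (intro norm_blinfun_bound) (simp_all add: D_def)
  also have "sqrt D < 1" using s(1) k by (auto simp: D_def)
  finally have "norm h < 1" .
  define x where "x = sqrt s *\<^sub>R (q o\<^sub>L Y)"
  define a where "a = adj d o\<^sub>L d"
  have aA: "a \<in> A" "adj a = a"
    using d mem by (auto simp: a_def compose_closed adj_compose adj_adj)
  have xA: "x \<in> A" "q o\<^sub>L x = x"
    using q YZ by (auto simp: x_def compose_closed scaleR_closed blinfun.bilinear_simps qq intro!: blinfun_eqI)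
  have "adj x = sqrt s *\<^sub>R adj (q o\<^sub>L Y)"
    unfolding x_def using q YZ by (intro adj_scaleR compose_closed)
  moreover have "T' = d o\<^sub>L adj (q o\<^sub>L Y)"
    unfolding T'_def T_def using q YZ d mem(6) by (simp add: adj_compose compose_closed adj_adj)
  ultimately have "x o\<^sub>L a o\<^sub>L adj x = s *\<^sub>R (T o\<^sub>L T')"
    using s by (intro blinfun_eqI) (simp add: x_def a_def T_def blinfun.bilinear_simps)
  then have "norm (q - (x o\<^sub>L a o\<^sub>L adj x)) < 1" using \<open>norm h < 1\<close> h_def by simp
  from projection_from_approx[OF q aA xA this \<open>\<epsilon> > 0\<close>] show ?thesis unfolding a_def by blast
qed

end

section \<open>Coordinates of square-summable functions\<close>

lemma ell2_fun_sum: "ell2_fun (\<Sum>i\<in>F. \<xi> i) x = (\<Sum>i\<in>F. ell2_fun (\<xi> i) x)"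
  by (induction F rule: infinite_finite_induct) (simp_all add: zero_ell2.rep_eq plus_ell2.rep_eq)

lemma ell2_eqI: "(\<And>x. ell2_fun \<xi> x = ell2_fun \<eta> x) \<Longrightarrow> \<xi> = \<eta>"
  by (metis ell2_fun_inject ext)

lemma ell2_fun_delta: "ell2_fun (delta \<gamma>) x = (if x = \<gamma> then 1 else 0)"
  by transfer simp

lemma norm_ell2_sq: "(norm \<xi>)\<^sup>2 = (\<Sum>\<^sub>\<infinity>x. (cmod (ell2_fun \<xi> x))\<^sup>2)"
  by (simp add: norm_ell2_def infsum_nonneg)

lemma norm_delta: "norm (delta \<gamma>) = 1"
proof -
  have "(norm (delta \<gamma>))\<^sup>2 = (\<Sum>\<^sub>\<infinity>x\<in>{\<gamma>}. 1)"
    unfolding norm_ell2_sq by (rule infsum_cong_neutral) (auto simp: ell2_fun_delta)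
  then show ?thesis using norm_ge_zero[of "delta \<gamma>"] by (auto simp: power2_eq_1_iff simp del: norm_ge_zero)
qed

lemma has_sum_delta: "((\<lambda>x. ell2_fun \<xi> x *\<^sub>C delta x) has_sum \<xi>) UNIV"
proof -
  define t where "t = (\<lambda>F. \<Sum>x\<in>F. ell2_fun \<xi> x *\<^sub>C delta x)"
  let ?g = "\<lambda>x. (cmod (ell2_fun \<xi> x))\<^sup>2"
  have t: "ell2_fun (t F) x = (if x \<in> F then ell2_fun \<xi> x else 0)" if "finite F" for F x
    using that by (simp add: t_def ell2_fun_sum scaleC.rep_eq ell2_fun_delta if_distrib cong: if_cong)
  have n: "norm (t F - \<xi>) = sqrt ((\<Sum>\<^sub>\<infinity>x. ?g x) - sum ?g F)" if "finite F" for F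
  proof -
    have "(norm (t F - \<xi>))\<^sup>2 = (\<Sum>\<^sub>\<infinity>x\<in>UNIV - F. ?g x)"
      unfolding norm_ell2_sq by (rule infsum_cong_neutral) (auto simp: minus_ell2.rep_eq t[OF that])
    also have "\<dots> = (\<Sum>\<^sub>\<infinity>x. ?g x) - (\<Sum>\<^sub>\<infinity>x\<in>F. ?g x)"
      using that by (intro infsum_Diff ell2_square_summable) auto
    finally have "(norm (t F - \<xi>))\<^sup>2 = (\<Sum>\<^sub>\<infinity>x. ?g x) - sum ?g F"
      using that by simp
    then show ?thesis by (metis norm_ge_zero real_sqrt_unique)
  qed
  have "(sum ?g \<longlongrightarrow> (\<Sum>\<^sub>\<infinity>x. ?g x)) (finite_subsets_at_top UNIV)"
    using has_sum_infsum[OF ell2_square_summable[of \<xi>]] by (simp add: has_sum_def)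
  then have "((\<lambda>F. sqrt ((\<Sum>\<^sub>\<infinity>x. ?g x) - sum ?g F)) \<longlongrightarrow> sqrt ((\<Sum>\<^sub>\<infinity>x. ?g x) - (\<Sum>\<^sub>\<infinity>x. ?g x)))
     (finite_subsets_at_top UNIV)"
    by (intro tendsto_intros)
  then have "((\<lambda>F. sqrt ((\<Sum>\<^sub>\<infinity>x. ?g x) - sum ?g F)) \<longlongrightarrow> 0) (finite_subsets_at_top UNIV)"
    by simp
  then have "((\<lambda>F. norm (t F - \<xi>)) \<longlongrightarrow> 0) (finite_subsets_at_top UNIV)"
    by (rule Lim_transform_eventually)
       (auto intro!: eventually_finite_subsets_at_top_weakI simp: n)
  then have "((\<lambda>F. t F - \<xi>) \<longlongrightarrow> 0) (finite_subsets_at_top UNIV)"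
    by (rule tendsto_norm_zero_cancel)
  then have "(t \<longlongrightarrow> \<xi>) (finite_subsets_at_top UNIV)"
    by (rule LIM_zero_cancel)
  then show ?thesis by (simp add: has_sum_def t_def[symmetric])
qed

lemma op_eq_on:
  assumes "complex_linear S" "complex_linear T"
    and "\<And>\<gamma>. ell2_fun \<xi> \<gamma> \<noteq> 0 \<Longrightarrow> blinfun_apply S (delta \<gamma>) = blinfun_apply T (delta \<gamma>)"
  shows "blinfun_apply S \<xi> = blinfun_apply T \<xi>"
proof -
  have 1: "((\<lambda>x. blinfun_apply S (ell2_fun \<xi> x *\<^sub>C delta x)) has_sum blinfun_apply S \<xi>) UNIV"
    by (rule has_sum_bounded_linear[OF blinfun.bounded_linear_right has_sum_delta])
  have 2: "((\<lambda>x. blinfun_apply T (ell2_fun \<xi> x *\<^sub>C delta x)) has_sum blinfun_apply T \<xi>) UNIV"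
    by (rule has_sum_bounded_linear[OF blinfun.bounded_linear_right has_sum_delta])
  have "blinfun_apply S (ell2_fun \<xi> x *\<^sub>C delta x) = blinfun_apply T (ell2_fun \<xi> x *\<^sub>C delta x)" for x
  proof (cases "ell2_fun \<xi> x = 0")
    case True
    then have "ell2_fun \<xi> x *\<^sub>C delta x = 0" by (intro ell2_eqI) (simp add: scaleC.rep_eq zero_ell2.rep_eq)
    then show ?thesis by simp
  next
    case False
    then show ?thesis using assms by (simp add: complex_linear_def)
  qed
  with 1 2 show ?thesis using has_sum_unique by fastforce
qed

lemma op_eqI_delta:
  assumes "complex_linear S" "complex_linear T"
    and "\<And>\<gamma>. blinfun_apply S (delta \<gamma>) = blinfun_apply T (delta \<gamma>)"
  shows "S = T"
  by (rule blinfun_eqI) (rule op_eq_on[OF assms])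

section \<open>Operators with finitely many entries in each row and column\<close>

definition band_kernel :: "nat \<Rightarrow> real \<Rightarrow> ('a \<Rightarrow> 'a \<Rightarrow> complex) \<Rightarrow> bool" where
  "band_kernel N M k \<longleftrightarrow>
     (\<forall>\<eta>. finite {\<gamma>. k \<eta> \<gamma> \<noteq> 0} \<and> card {\<gamma>. k \<eta> \<gamma> \<noteq> 0} \<le> N) \<and>
     (\<forall>\<gamma>. finite {\<eta>. k \<eta> \<gamma> \<noteq> 0} \<and> card {\<eta>. k \<eta> \<gamma> \<noteq> 0} \<le> N) \<and>
     (\<forall>\<eta> \<gamma>. cmod (k \<eta> \<gamma>) \<le> M)"

definition kernel_apply :: "('a \<Rightarrow> 'a \<Rightarrow> complex) \<Rightarrow> ('a \<Rightarrow> complex) \<Rightarrow> 'a \<Rightarrow> complex" where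
  "kernel_apply k \<xi> \<eta> = (\<Sum>\<gamma> | k \<eta> \<gamma> \<noteq> 0. k \<eta> \<gamma> * \<xi> \<gamma>)"

definition kernel_op :: "('a \<Rightarrow> 'a \<Rightarrow> complex) \<Rightarrow> 'a op" where
  "kernel_op k = Blinfun (\<lambda>\<xi>. Abs_ell2 (kernel_apply k (ell2_fun \<xi>)))"

text \<open>Schur's test.\<close>

lemma kernel_apply_bound:
  assumes k: "band_kernel N M k" and F: "finite F"
  shows "(\<Sum>\<eta>\<in>F. (cmod (kernel_apply k (ell2_fun \<xi>) \<eta>))\<^sup>2) \<le> (real N * M * norm \<xi>)\<^sup>2"
proof -
  let ?row = "\<lambda>\<eta>. {\<gamma>. k \<eta> \<gamma> \<noteq> 0}" and ?g = "\<lambda>\<gamma>. (cmod (ell2_fun \<xi> \<gamma>))\<^sup>2"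
  have fin: "finite (?row \<eta>)" and cr: "card (?row \<eta>) \<le> N" and b: "cmod (k \<eta> \<gamma>) \<le> M"
    and fc: "finite {\<eta>. k \<eta> \<gamma> \<noteq> 0}" and cc: "card {\<eta>. k \<eta> \<gamma> \<noteq> 0} \<le> N" for \<eta> \<gamma>
    using k by (auto simp: band_kernel_def)
  have M: "0 \<le> M" using b norm_ge_zero order_trans by blast
  have one: "(cmod (kernel_apply k (ell2_fun \<xi>) \<eta>))\<^sup>2 \<le> M\<^sup>2 * real N * sum ?g (?row \<eta>)" for \<eta>
  proof -
    have "cmod (kernel_apply k (ell2_fun \<xi>) \<eta>) \<le> (\<Sum>\<gamma>\<in>?row \<eta>. M * cmod (ell2_fun \<xi> \<gamma>))"
      unfolding kernel_apply_def by (rule order_trans[OF norm_sum])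
        (auto simp: norm_mult intro!: sum_mono mult_right_mono b)
    then have "(cmod (kernel_apply k (ell2_fun \<xi>) \<eta>))\<^sup>2 \<le> (M * (\<Sum>\<gamma>\<in>?row \<eta>. cmod (ell2_fun \<xi> \<gamma>)))\<^sup>2"
      by (intro power_mono) (auto simp: sum_distrib_left)
    also have "\<dots> \<le> M\<^sup>2 * (sum ?g (?row \<eta>) * card (?row \<eta>))"
      unfolding power_mult_distrib by (intro mult_left_mono sum_squared_le_sum_of_squares) auto
    also have "\<dots> \<le> M\<^sup>2 * (sum ?g (?row \<eta>) * real N)"
      using cr by (intro mult_left_mono) (auto simp: sum_nonneg)
    finally show ?thesis by (simp add: mult_ac)
  qed
  define U where "U = (\<Union>\<eta>\<in>F. ?row \<eta>)"
  have U: "finite U" using F fin by (auto simp: U_def)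
  have "(\<Sum>\<eta>\<in>F. sum ?g (?row \<eta>)) = (\<Sum>\<eta>\<in>F. \<Sum>\<gamma> | \<gamma> \<in> U \<and> k \<eta> \<gamma> \<noteq> 0. ?g \<gamma>)"
    by (intro sum.cong) (auto simp: U_def)
  also have "\<dots> = (\<Sum>\<gamma>\<in>U. \<Sum>\<eta> | \<eta> \<in> F \<and> k \<eta> \<gamma> \<noteq> 0. ?g \<gamma>)"
    by (rule sum.swap_restrict[OF F U])
  also have "\<dots> \<le> (\<Sum>\<gamma>\<in>U. real N * ?g \<gamma>)"
  proof (intro sum_mono)
    fix \<gamma>
    have "card {\<eta> \<in> F. k \<eta> \<gamma> \<noteq> 0} \<le> card {\<eta>. k \<eta> \<gamma> \<noteq> 0}" by (intro card_mono fc) auto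
    then have "card {\<eta> \<in> F. k \<eta> \<gamma> \<noteq> 0} \<le> N" using cc order_trans by blast
    then show "(\<Sum>\<eta> | \<eta> \<in> F \<and> k \<eta> \<gamma> \<noteq> 0. ?g \<gamma>) \<le> real N * ?g \<gamma>"
      by (simp add: mult_right_mono)
  qed
  also have "\<dots> \<le> real N * (norm \<xi>)\<^sup>2"
    unfolding sum_distrib_left[symmetric] by (intro mult_left_mono ell2_norm_bound_finite) auto
  finally have two: "(\<Sum>\<eta>\<in>F. sum ?g (?row \<eta>)) \<le> real N * (norm \<xi>)\<^sup>2" .
  have "(\<Sum>\<eta>\<in>F. (cmod (kernel_apply k (ell2_fun \<xi>) \<eta>))\<^sup>2) \<le> (\<Sum>\<eta>\<in>F. M\<^sup>2 * real N * sum ?g (?row \<eta>))"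
    by (intro sum_mono one)
  also have "\<dots> \<le> M\<^sup>2 * real N * (real N * (norm \<xi>)\<^sup>2)"
    unfolding sum_distrib_left[symmetric] using two by (intro mult_left_mono) auto
  finally show ?thesis by (simp add: power2_eq_square mult_ac)
qed

lemma
  assumes k: "band_kernel N M k"
  shows ell2_fun_kernel_op: "ell2_fun (blinfun_apply (kernel_op k) \<xi>) = kernel_apply k (ell2_fun \<xi>)"
    and norm_kernel_op_le: "norm (kernel_op k) \<le> real N * M"
    and complex_linear_kernel_op: "complex_linear (kernel_op k)"
proof -
  let ?K = "\<lambda>\<xi>. Abs_ell2 (kernel_apply k (ell2_fun \<xi>))"
  have M: "0 \<le> M" using k unfolding band_kernel_def using norm_ge_zero order_trans by blast
  have S: "(\<lambda>\<eta>. (cmod (kernel_apply k (ell2_fun \<xi>) \<eta>))\<^sup>2) summable_on UNIV" for \<xi>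
    by (rule nonneg_bdd_above_summable_on)
       (auto intro!: bdd_aboveI[of _ "(real N * M * norm \<xi>)\<^sup>2"] kernel_apply_bound[OF k])
  have K: "ell2_fun (?K \<xi>) = kernel_apply k (ell2_fun \<xi>)" for \<xi>
    using S by (simp add: Abs_ell2_inverse)
  have nK: "norm (?K \<xi>) \<le> norm \<xi> * (real N * M)" for \<xi>
  proof (rule power2_le_imp_le)
    have "(norm (?K \<xi>))\<^sup>2 \<le> (real N * M * norm \<xi>)\<^sup>2"
      unfolding norm_ell2_sq K by (rule infsum_le_finite_sums[OF S]) (rule kernel_apply_bound[OF k])
    then show "(norm (?K \<xi>))\<^sup>2 \<le> (norm \<xi> * (real N * M))\<^sup>2" by (simp add: mult_ac)
  qed (use M in auto)
  have bl: "bounded_linear ?K"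
  proof (rule bounded_linear_intro[OF _ _ nK])
    fix x y :: "'a ell2" and r :: real
    show "?K (x + y) = ?K x + ?K y"
      by (rule ell2_eqI, unfold K)
         (simp add: K kernel_apply_def distrib_left sum.distrib plus_ell2.rep_eq)
    show "?K (r *\<^sub>R x) = r *\<^sub>R ?K x"
      by (rule ell2_eqI, unfold K)
         (simp add: K kernel_apply_def scaleR_ell2.rep_eq sum_distrib_left mult_ac)
  qed
  have app: "blinfun_apply (kernel_op k) \<xi> = ?K \<xi>" for \<xi>
    unfolding kernel_op_def by (simp add: bounded_linear_Blinfun_apply[OF bl])
  show "ell2_fun (blinfun_apply (kernel_op k) \<xi>) = kernel_apply k (ell2_fun \<xi>)"
    by (simp add: app K)
  show "norm (kernel_op k) \<le> real N * M"
    by (rule norm_blinfun_bound) (use nK M in \<open>auto simp: app mult_ac\<close>)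
  show "complex_linear (kernel_op k)"
    unfolding complex_linear_def app
    by (intro allI ell2_eqI, unfold K)
       (simp add: K kernel_apply_def scaleC.rep_eq sum_distrib_left mult_ac)
qed

lemma kernel_apply_superset:
  assumes "finite F" "\<And>\<gamma>. k \<eta> \<gamma> * \<xi> \<gamma> \<noteq> 0 \<Longrightarrow> \<gamma> \<in> F" "finite {\<gamma>. k \<eta> \<gamma> \<noteq> 0}"
  shows "kernel_apply k \<xi> \<eta> = (\<Sum>\<gamma>\<in>F. k \<eta> \<gamma> * \<xi> \<gamma>)"
proof -
  have "kernel_apply k \<xi> \<eta> = (\<Sum>\<gamma> | k \<eta> \<gamma> * \<xi> \<gamma> \<noteq> 0. k \<eta> \<gamma> * \<xi> \<gamma>)"
    unfolding kernel_apply_def by (rule sum.mono_neutral_right) (use assms in auto)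
  also have "\<dots> = (\<Sum>\<gamma>\<in>F. k \<eta> \<gamma> * \<xi> \<gamma>)"
    by (rule sum.mono_neutral_left) (use assms in auto)
  finally show ?thesis .
qed

lemma ell2_fun_kernel_op_delta:
  assumes "band_kernel N M k"
  shows "ell2_fun (blinfun_apply (kernel_op k) (delta \<gamma>)) \<eta> = k \<eta> \<gamma>"
proof -
  have "kernel_apply k (ell2_fun (delta \<gamma>)) \<eta> = (\<Sum>\<gamma>'\<in>{\<gamma>}. k \<eta> \<gamma>' * ell2_fun (delta \<gamma>) \<gamma>')"
    using assms by (intro kernel_apply_superset)
      (auto simp: band_kernel_def ell2_fun_delta split: if_splits)
  then show ?thesis by (simp add: ell2_fun_kernel_op[OF assms] ell2_fun_delta)
qed

lemma band_kernel_conj_transpose: "band_kernel N M k \<Longrightarrow> band_kernel N M (\<lambda>\<eta> \<gamma>. cnj (k \<gamma> \<eta>))"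
  by (simp add: band_kernel_def)

lemma cinner_delta_right: "cinner \<xi> (delta \<gamma>) = ell2_fun \<xi> \<gamma>"
proof -
  have "cinner \<xi> (delta \<gamma>) = (\<Sum>\<^sub>\<infinity>x\<in>{\<gamma>}. ell2_fun \<xi> x)"
    unfolding cinner_def by (rule infsum_cong_neutral) (auto simp: ell2_fun_delta)
  then show ?thesis by simp
qed

lemma is_adjoint_kernel_op:
  assumes k: "band_kernel N M k"
  shows "is_adjoint (kernel_op k) (kernel_op (\<lambda>\<eta> \<gamma>. cnj (k \<gamma> \<eta>)))"
proof (rule is_adjointI_inner)
  let ?k' = "\<lambda>\<eta> \<gamma>. cnj (k \<gamma> \<eta>)"
  note k' = band_kernel_conj_transpose[OF k]
  show "complex_linear (kernel_op ?k')" by (rule complex_linear_kernel_op[OF k'])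
  let ?L = "blinfun_apply (kernel_op k)" and ?L' = "blinfun_apply (kernel_op ?k')"
  have scl: "?L (c *\<^sub>C x) = c *\<^sub>C ?L x" "?L' (c *\<^sub>C x) = c *\<^sub>C ?L' x" for c x
    using complex_linear_kernel_op[OF k] complex_linear_kernel_op[OF k'] by (auto simp: complex_linear_def)
  have e: "inner (?L (c *\<^sub>C delta \<gamma>)) (d *\<^sub>C delta \<eta>) = inner (c *\<^sub>C delta \<gamma>) (?L' (d *\<^sub>C delta \<eta>))" for c d \<gamma> \<eta>
  proof -
    have r: "inner x (d *\<^sub>C delta \<eta>) = Re (ell2_fun x \<eta> * cnj d)" for x d and \<eta> :: 'a
    proof -
      have "inner x (d *\<^sub>C delta \<eta>) = (\<Sum>\<^sub>\<infinity>y\<in>{\<eta>}. Re (ell2_fun x y * cnj d))"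
        unfolding inner_ell2_def by (rule infsum_cong_neutral) (auto simp: ell2_fun_delta inner_complex_def scaleC.rep_eq)
      then show ?thesis by simp
    qed
    have "inner (?L (c *\<^sub>C delta \<gamma>)) (d *\<^sub>C delta \<eta>) = Re (c * k \<eta> \<gamma> * cnj d)"
      by (simp add: r scl scaleC.rep_eq ell2_fun_kernel_op_delta[OF k])
    also have "\<dots> = Re (d * cnj (k \<eta> \<gamma>) * cnj c)"
      by (simp add: algebra_simps)
    also have "\<dots> = inner (?L' (d *\<^sub>C delta \<eta>)) (c *\<^sub>C delta \<gamma>)"
      by (simp add: r scl scaleC.rep_eq ell2_fun_kernel_op_delta[OF k'])
    finally show ?thesis by (simp add: inner_commute)
  qed
  fix \<xi> \<eta>
  have "inner (?L (c *\<^sub>C delta \<gamma>)) \<eta> = inner (c *\<^sub>C delta \<gamma>) (?L' \<eta>)" for c \<gamma>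
  proof -
    have "((\<lambda>x. inner (?L (c *\<^sub>C delta \<gamma>)) (ell2_fun \<eta> x *\<^sub>C delta x)) has_sum inner (?L (c *\<^sub>C delta \<gamma>)) \<eta>) UNIV"
      by (rule has_sum_bounded_linear[OF bounded_linear_inner_right has_sum_delta])
    moreover have "((\<lambda>x. inner (c *\<^sub>C delta \<gamma>) (?L' (ell2_fun \<eta> x *\<^sub>C delta x))) has_sum inner (c *\<^sub>C delta \<gamma>) (?L' \<eta>)) UNIV"
      by (rule has_sum_bounded_linear[OF bounded_linear_inner_right
            has_sum_bounded_linear[OF blinfun.bounded_linear_right has_sum_delta]])
    ultimately show ?thesis unfolding e by (rule has_sum_unique)
  qed
  moreover have "((\<lambda>x. inner (?L (ell2_fun \<xi> x *\<^sub>C delta x)) \<eta>) has_sum inner (?L \<xi>) \<eta>) UNIV"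
    by (rule has_sum_bounded_linear[OF bounded_linear_inner_left
          has_sum_bounded_linear[OF blinfun.bounded_linear_right has_sum_delta]])
  moreover have "((\<lambda>x. inner (ell2_fun \<xi> x *\<^sub>C delta x) (?L' \<eta>)) has_sum inner \<xi> (?L' \<eta>)) UNIV"
    by (rule has_sum_bounded_linear[OF bounded_linear_inner_left has_sum_delta])
  ultimately show "inner (?L \<xi>) \<eta> = inner \<xi> (?L' \<eta>)"
    using has_sum_unique by fastforce
qed

section \<open>Ample groupoids\<close>

lemma compactly_supportedI:
  fixes f :: "'g::t2_space \<Rightarrow> complex"
  assumes "compact K" "\<And>x. f x \<noteq> 0 \<Longrightarrow> x \<in> K"
  shows "compactly_supported f"
proof -
  have "closure {x. f x \<noteq> 0} \<subseteq> K"
    using assms by (intro closure_minimal compact_imp_closed) auto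
  then show ?thesis
    unfolding compactly_supported_def using assms(1) compact_Int_closed[of K "closure {x. f x \<noteq> 0}"] by (simp add: inf.absorb2)
qed

lemma compactly_supportedE:
  fixes f :: "'g::t2_space \<Rightarrow> complex"
  assumes "compactly_supported f"
  obtains K where "compact K" "\<And>x. f x \<noteq> 0 \<Longrightarrow> x \<in> K"
proof (rule that)
  show "compact (closure {x. f x \<noteq> 0})" using assms by (simp add: compactly_supported_def)
  show "f x \<noteq> 0 \<Longrightarrow> x \<in> closure {x. f x \<noteq> 0}" for x using closure_subset[of "{x. f x \<noteq> 0}"] by auto
qed

lemma open_vimage_locally_constant:
  assumes "locally_constant f"
  shows "open (f -` S)"
proof (subst open_subopen, intro ballI)
  fix x assume "x \<in> f -` S"
  moreover obtain U where "open U" "x \<in> U" "f constant_on U"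
    using assms by (auto simp: locally_constant_def)
  ultimately show "\<exists>T. open T \<and> x \<in> T \<and> T \<subseteq> f -` S"
    unfolding constant_on_def by (intro exI[of _ U]) auto
qed

lemma locally_constantI:
  assumes "\<And>x. \<exists>U. open U \<and> x \<in> U \<and> (\<forall>y\<in>U. f y = f x)"
  shows "locally_constant f"
  unfolding locally_constant_def
proof
  fix x
  obtain U where "open U" "x \<in> U" "\<forall>y\<in>U. f y = f x" using assms by blast
  then show "\<exists>U. open U \<and> x \<in> U \<and> f constant_on U"
    unfolding constant_on_def by (intro exI[of _ U] conjI exI[of _ "f x"])
qed

lemma locally_constant_continuous: "locally_constant f \<Longrightarrow> continuous_on UNIV f"
  by (simp add: continuous_on_open_vimage open_vimage_locally_constant)

lemma locally_constant_indicator: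
  fixes B :: "'g::t2_space set"
  assumes "compact B" "open B"
  shows "locally_constant (indicator B)"
proof (rule locally_constantI)
  fix x
  have "open (- B)" using compact_imp_closed[OF assms(1)] by (rule open_Compl)
  then show "\<exists>U. open U \<and> x \<in> U \<and> (\<forall>y\<in>U. (indicator B y :: complex) = indicator B x)"
    using assms(2) by (intro exI[of _ "if x \<in> B then B else - B"]) simp
qed

lemma locally_constant_vimage:
  assumes "continuous_on U a" "open U" "locally_constant f"
  shows "open {x \<in> U. f (a x) = c}"
proof -
  have "open (a -` (f -` {c}) \<inter> U)"
    using assms open_vimage_locally_constant[OF assms(3), of "{c}"]
    by (simp add: continuous_on_open_vimage[OF assms(2)])
  moreover have "a -` (f -` {c}) \<inter> U = {x \<in> U. f (a x) = c}" by auto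
  ultimately show ?thesis by simp
qed

locale ample_groupoid =
  fixes G :: "'g::t2_space groupoid"
  assumes ample: "ample G"
begin

lemma groupoid_axioms:
  shows src_src [simp]: "src G (src G x) = src G x" and rng_src [simp]: "rng G (src G x) = src G x"
    and src_rng [simp]: "src G (rng G x) = rng G x" and rng_rng [simp]: "rng G (rng G x) = rng G x"
    and src_mul [simp]: "src G x = rng G y \<Longrightarrow> src G (mul G x y) = src G y"
    and rng_mul [simp]: "src G x = rng G y \<Longrightarrow> rng G (mul G x y) = rng G x"
    and mul_assoc: "src G x = rng G y \<Longrightarrow> src G y = rng G z \<Longrightarrow> mul G (mul G x y) z = mul G x (mul G y z)"
    and mul_rng [simp]: "mul G (rng G x) x = x" and mul_src [simp]: "mul G x (src G x) = x"
    and src_ginv [simp]: "src G (ginv G x) = rng G x" and rng_ginv [simp]: "rng G (ginv G x) = src G x"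
    and ginv_mul_self [simp]: "mul G (ginv G x) x = src G x" and mul_ginv_self [simp]: "mul G x (ginv G x) = rng G x"
proof -
  have "is_groupoid G" using ample by (simp add: ample_def topological_groupoid_def)
  note ax = this[unfolded is_groupoid_def]
  note a1 = conjunct1[OF ax] and a2 = conjunct1[OF conjunct2[OF ax]]
    and a3 = conjunct1[OF conjunct2[OF conjunct2[OF ax]]]
    and a4 = conjunct1[OF conjunct2[OF conjunct2[OF conjunct2[OF ax]]]]
    and a5 = conjunct2[OF conjunct2[OF conjunct2[OF conjunct2[OF ax]]]]
  show "src G (src G x) = src G x" "rng G (src G x) = src G x"
    "src G (rng G x) = rng G x" "rng G (rng G x) = rng G x" using spec[OF a1, of x] by blast+
  show "src G x = rng G y \<Longrightarrow> src G (mul G x y) = src G y"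
    "src G x = rng G y \<Longrightarrow> rng G (mul G x y) = rng G x"
    using spec[OF spec[OF a2, of x], of y] by blast+
  show "src G x = rng G y \<Longrightarrow> src G y = rng G z \<Longrightarrow> mul G (mul G x y) z = mul G x (mul G y z)"
    using spec[OF spec[OF spec[OF a3, of x], of y], of z] by blast
  show "mul G (rng G x) x = x" "mul G x (src G x) = x" using spec[OF a4, of x] by blast+
  show "src G (ginv G x) = rng G x" "rng G (ginv G x) = src G x"
    "mul G (ginv G x) x = src G x" "mul G x (ginv G x) = rng G x" using spec[OF a5, of x] by blast+
qed

lemma ginv_unique:
  assumes "src G x = rng G y" "mul G x y = rng G x"
  shows "y = ginv G x"
proof -
  have "y = mul G (mul G (ginv G x) x) y" using assms(1) by simp
  also have "\<dots> = mul G (ginv G x) (mul G x y)" by (rule mul_assoc) (use assms(1) in simp_all)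
  also have "\<dots> = ginv G x" using mul_src[of "ginv G x"] by (simp add: assms(2))
  finally show ?thesis .
qed

lemma ginv_ginv [simp]: "ginv G (ginv G x) = x"
  using ginv_unique[of "ginv G x" x] by simp

lemma mul_ginv_cancel: "rng G a = rng G c \<Longrightarrow> mul G a (mul G (ginv G a) c) = c"
  using mul_assoc[of a "ginv G a" c] by simp

lemma ginv_mul_cancel: "src G a = rng G c \<Longrightarrow> mul G (ginv G a) (mul G a c) = c"
  using mul_assoc[of "ginv G a" a c] by simp

lemma mul_cancel_ginv: "src G c = src G b \<Longrightarrow> mul G (mul G c (ginv G b)) b = c"
  using mul_assoc[of c "ginv G b" b] mul_src[of c] by simp

lemma mul_ginv_right_cancel: "src G c = rng G b \<Longrightarrow> mul G (mul G c b) (ginv G b) = c"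
  using mul_assoc[of c b "ginv G b"] mul_src[of c] by simp

lemma ginv_mul: "src G a = rng G b \<Longrightarrow> ginv G (mul G a b) = mul G (ginv G b) (ginv G a)"
  using mul_ginv_right_cancel[of a b] mul_assoc[of "mul G a b" "ginv G b" "ginv G a"]
  by (intro ginv_unique[symmetric]) simp_all

lemma units_iff_src: "x \<in> units G \<longleftrightarrow> src G x = x"
  unfolding units_def using src_src by (auto intro: range_eqI[OF sym])

lemma units_iff_rng: "x \<in> units G \<longleftrightarrow> rng G x = x"
  unfolding units_iff_src using rng_src[of x] src_rng[of x] by metis

lemma src_in_units [simp]: "src G x \<in> units G" and rng_in_units [simp]: "rng G x \<in> units G"
  by (simp_all add: units_iff_src)

lemma ginv_unit: "u \<in> units G \<Longrightarrow> ginv G u = u"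
  using ginv_unique[of u u] mul_src[of u] by (simp add: units_iff_src[THEN iffD1] units_iff_rng[THEN iffD1])

lemma continuous_ginv: "continuous_on S (ginv G)"
  using ample unfolding ample_def topological_groupoid_def by (meson continuous_on_subset top_greatest)

lemma continuous_mul:
  assumes "continuous_on S a" "continuous_on S b" "\<And>x. x \<in> S \<Longrightarrow> src G (a x) = rng G (b x)"
  shows "continuous_on S (\<lambda>x. mul G (a x) (b x))"
proof -
  have "continuous_on (composable G) (\<lambda>(x, y). mul G x y)"
    using ample unfolding ample_def topological_groupoid_def by simp
  from continuous_on_compose2[OF this continuous_on_Pair[OF assms(1,2)]] assms(3)
  show ?thesis by (auto simp: composable_def)
qed

lemma continuous_src: "continuous_on S (src G)"
proof -
  have "continuous_on S (\<lambda>x. mul G (ginv G x) x)"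
    by (intro continuous_mul continuous_ginv continuous_on_id) auto
  then show ?thesis by simp
qed

lemma continuous_rng: "continuous_on S (rng G)"
proof -
  have "continuous_on S (\<lambda>x. mul G x (ginv G x))"
    by (intro continuous_mul continuous_ginv continuous_on_id) auto
  then show ?thesis by simp
qed

lemma bisection_nhd:
  assumes "open U" "x \<in> U"
  obtains B where "compact B" "open_bisection G B" "x \<in> B" "B \<subseteq> U"
proof -
  have "topological_basis {B. compact B \<and> open_bisection G B}"
    using ample unfolding ample_def by simp
  from topological_basisE[OF this assms] show thesis using that by blast
qed

text \<open>Compact open bisections, without the topological conditions that are automatic for them.\<close>

definition cobis :: "'g set \<Rightarrow> bool" where
  "cobis B \<longleftrightarrow> compact B \<and> open B \<and> inj_on (src G) B \<and> inj_on (rng G) B"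

lemma cobis_open_bisection:
  assumes "compact B" "open_bisection G B"
  shows "cobis B"
proof -
  have "inj_on (src G) B" "inj_on (rng G) B" "open B"
    using assms(2) unfolding open_bisection_def homeomorphism_def by (metis inj_onI)+
  then show ?thesis using assms(1) by (simp add: cobis_def)
qed

lemma cobis_nhd:
  assumes "open U" "x \<in> U"
  obtains B where "cobis B" "x \<in> B" "B \<subseteq> U"
  using bisection_nhd[OF assms] cobis_open_bisection by metis

lemma cobis_subset: "cobis B \<Longrightarrow> C \<subseteq> B \<Longrightarrow> compact C \<Longrightarrow> open C \<Longrightarrow> cobis C"
  unfolding cobis_def using inj_on_subset by blast

lemma open_units: "open (units G)"
proof (subst open_subopen, intro ballI)
  fix u assume u: "u \<in> units G"
  obtain B where B: "cobis B" "u \<in> B" by (rule cobis_nhd[of UNIV u]) auto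
  have "open (src G -` B \<inter> UNIV)"
    using B continuous_src by (metis cobis_def continuous_on_open_vimage open_UNIV)
  then have "open (B \<inter> src G -` B)" using B by (auto simp: cobis_def)
  moreover have "u \<in> B \<inter> src G -` B" using u B by (simp add: units_iff_src)
  moreover have "B \<inter> src G -` B \<subseteq> units G"
  proof
    fix x assume "x \<in> B \<inter> src G -` B"
    then show "x \<in> units G"
      using B(1) inj_onD[of "src G" B "src G x" x] by (auto simp: units_iff_src cobis_def)
  qed
  ultimately show "\<exists>T. open T \<and> u \<in> T \<and> T \<subseteq> units G" by blast
qed

lemma closed_units: "closed (units G)"
proof -
  have "units G = {x. src G x = x}" by (auto simp: units_iff_src)
  then show ?thesis by (simp add: closed_Collect_eq continuous_src)
qed

lemma open_image_rng: "open U \<Longrightarrow> open (rng G ` U)" and open_image_src: "open U \<Longrightarrow> open (src G ` U)"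
proof -
  assume U: "open U"
  have *: "\<exists>T. open T \<and> y \<in> T \<and> T \<subseteq> f ` U"
    if f: "f = rng G \<or> f = src G" and y: "y \<in> f ` U" for f y
  proof -
    obtain x where x: "x \<in> U" "y = f x" using y by blast
    obtain B where B: "open_bisection G B" "x \<in> B" "B \<subseteq> U" by (rule bisection_nhd[OF U x(1)])
    have "openin (top_of_set (units G)) (f ` B)" using B(1) f unfolding open_bisection_def by auto
    then have "open (f ` B)" using open_units openin_open_eq by blast
    then show ?thesis using B x by (intro exI[of _ "f ` B"]) auto
  qed
  show "open (rng G ` U)" "open (src G ` U)"
    by (subst open_subopen, use * in blast)+
qed

lemma cobis_image_units: "cobis B \<Longrightarrow> compact (rng G ` B) \<and> open (rng G ` B)"
  unfolding cobis_def using open_image_rng continuous_rng compact_continuous_image by blast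

lemma cobis_ginv: "cobis B \<Longrightarrow> cobis (ginv G ` B)"
proof -
  assume B: "cobis B"
  have "ginv G ` B = ginv G -` B \<inter> UNIV" by (auto intro: image_eqI[of _ _ "ginv G _"])
  moreover have "open (ginv G -` B \<inter> UNIV)"
    using B continuous_ginv by (metis cobis_def continuous_on_open_vimage open_UNIV)
  moreover have "compact (ginv G ` B)" using B continuous_ginv compact_continuous_image by (auto simp: cobis_def)
  moreover have "inj_on (src G) (ginv G ` B)" "inj_on (rng G) (ginv G ` B)"
    using B by (auto simp: cobis_def inj_on_def)
  ultimately show ?thesis by (simp add: cobis_def)
qed

lemma finite_cobis_cover:
  assumes "compact S" "open U" "S \<subseteq> U"
  obtains \<B> where "finite \<B>" "\<And>B. B \<in> \<B> \<Longrightarrow> compact B \<and> open_bisection G B \<and> B \<subseteq> U" "S \<subseteq> \<Union>\<B>"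
proof -
  define \<C> where "\<C> = {B. compact B \<and> open_bisection G B \<and> B \<subseteq> U}"
  have "S \<subseteq> \<Union>\<C>"
  proof
    fix x assume "x \<in> S"
    then have "x \<in> U" using assms(3) by auto
    then obtain B where "compact B" "open_bisection G B" "x \<in> B" "B \<subseteq> U"
      by (rule bisection_nhd[OF assms(2)])
    then show "x \<in> \<Union>\<C>" by (auto simp: \<C>_def)
  qed
  moreover have "open B" if "B \<in> \<C>" for B using that by (simp add: \<C>_def open_bisection_def)
  ultimately obtain \<D> where "\<D> \<subseteq> \<C>" "finite \<D>" "S \<subseteq> \<Union>\<D>"
    by (rule compactE[OF assms(1)])
  then show thesis using that[of \<D>] by (auto simp: \<C>_def)
qed

lemma disjoint_cobis_cover:
  assumes "compact S"
  obtains \<D> where "finite \<D>" "disjoint \<D>" "\<And>D. D \<in> \<D> \<Longrightarrow> cobis D" "S \<subseteq> \<Union>\<D>"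
proof -
  obtain \<B> where \<B>: "finite \<B>" "\<And>B. B \<in> \<B> \<Longrightarrow> compact B \<and> open_bisection G B \<and> B \<subseteq> UNIV" "S \<subseteq> \<Union>\<B>"
    by (rule finite_cobis_cover[OF assms open_UNIV]) blast+
  have "\<exists>\<D>. finite \<D> \<and> disjoint \<D> \<and> (\<forall>D\<in>\<D>. cobis D) \<and> \<Union>\<D> = \<Union>\<B>"
    using \<B>(1,2)
  proof (induction \<B> rule: finite_induct)
    case empty
    then show ?case by (intro exI[of _ "{}"]) (auto simp: disjoint_def)
  next
    case (insert B \<B>)
    then obtain \<D> where \<D>: "finite \<D>" "disjoint \<D>" "\<forall>D\<in>\<D>. cobis D" "\<Union>\<D> = \<Union>\<B>" by auto
    have B: "cobis B" using insert.prems[of B] cobis_open_bisection by auto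
    have "closed (\<Union>\<D>)"
      using \<D>(3) by (intro closed_Union[OF \<D>(1)]) (simp add: cobis_def compact_imp_closed)
    moreover have "open (\<Union>\<D>)"
      using \<D>(3) by (intro open_Union) (simp add: cobis_def)
    ultimately have "cobis (B - \<Union>\<D>)"
      using B by (intro cobis_subset[OF B])
        (auto simp: cobis_def Diff_eq intro: compact_Int_closed closed_Compl)
    moreover have "disjoint (insert (B - \<Union>\<D>) \<D>)"
      using \<D>(2) by (auto simp: disjoint_def)
    ultimately show ?case
      using \<D> by (intro exI[of _ "insert (B - \<Union>\<D>) \<D>"]) auto
  qed
  then show thesis using that \<B>(3) by auto
qed

lemma fibre_bound:
  assumes "compact S"
  obtains N where "\<And>u. finite {x \<in> S. rng G x = u} \<and> card {x \<in> S. rng G x = u} \<le> N"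
    "\<And>u. finite {x \<in> S. src G x = u} \<and> card {x \<in> S. src G x = u} \<le> N"
proof -
  obtain \<D> where \<D>: "finite \<D>" "disjoint \<D>" "\<And>D. D \<in> \<D> \<Longrightarrow> cobis D" "S \<subseteq> \<Union>\<D>"
    by (rule disjoint_cobis_cover[OF assms]) blast
  have "finite {x \<in> S. f x = u} \<and> card {x \<in> S. f x = u} \<le> card \<D>"
    if inj: "\<And>D. D \<in> \<D> \<Longrightarrow> inj_on f D" for f and u :: 'g
  proof -
    have one: "finite {x \<in> D. f x = u} \<and> card {x \<in> D. f x = u} \<le> 1" if "D \<in> \<D>" for D
    proof -
      have "\<And>x y. x \<in> {x \<in> D. f x = u} \<Longrightarrow> y \<in> {x \<in> D. f x = u} \<Longrightarrow> x = y"
        using inj[OF that] by (auto dest: inj_onD)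
      then have "{x \<in> D. f x = u} = {} \<or> (\<exists>x. {x \<in> D. f x = u} = {x})" by blast
      then show ?thesis
      proof (elim disjE exE)
        fix x assume x: "{x \<in> D. f x = u} = {x}"
        show ?thesis unfolding x by simp
      next
        assume e: "{x \<in> D. f x = u} = {}"
        show ?thesis unfolding e by simp
      qed
    qed
    have sub: "{x \<in> S. f x = u} \<subseteq> (\<Union>D\<in>\<D>. {x \<in> D. f x = u})" using \<D>(4) by auto
    have fin: "finite (\<Union>D\<in>\<D>. {x \<in> D. f x = u})" using \<D>(1) one by auto
    have "card {x \<in> S. f x = u} \<le> card (\<Union>D\<in>\<D>. {x \<in> D. f x = u})" by (rule card_mono[OF fin sub])
    also have "\<dots> \<le> (\<Sum>D\<in>\<D>. card {x \<in> D. f x = u})" by (rule card_UN_le[OF \<D>(1)])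
    also have "\<dots> \<le> (\<Sum>D\<in>\<D>. 1)" by (rule sum_mono) (use one in auto)
    finally show ?thesis using finite_subset[OF sub fin] by simp
  qed
  from this[of "rng G"] this[of "src G"] show thesis
    using \<D>(3) by (intro that) (auto simp: cobis_def)
qed

section \<open>Convolution\<close>

lemma convolution_eq_sum:
  assumes "finite F" "\<And>\<alpha>. \<alpha> \<in> F \<Longrightarrow> rng G \<alpha> = rng G \<gamma>"
    and "\<And>\<alpha>. rng G \<alpha> = rng G \<gamma> \<Longrightarrow> f \<alpha> * g (mul G (ginv G \<alpha>) \<gamma>) \<noteq> 0 \<Longrightarrow> \<alpha> \<in> F"
  shows "convolution G f g \<gamma> = (\<Sum>\<alpha>\<in>F. f \<alpha> * g (mul G (ginv G \<alpha>) \<gamma>))"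
proof -
  let ?h = "\<lambda>\<alpha>. (\<alpha>, mul G (ginv G \<alpha>) \<gamma>)"
  have im: "{(\<alpha>, \<beta>) \<in> composable G. mul G \<alpha> \<beta> = \<gamma>} = ?h ` {\<alpha>. rng G \<alpha> = rng G \<gamma>}"
    by (auto simp: composable_def mul_ginv_cancel ginv_mul_cancel image_iff)
  have "convolution G f g \<gamma> = infsum (\<lambda>\<alpha>. f \<alpha> * g (mul G (ginv G \<alpha>) \<gamma>)) {\<alpha>. rng G \<alpha> = rng G \<gamma>}"
    unfolding convolution_def im by (subst infsum_reindex) (auto simp: inj_on_def o_def)
  also have "\<dots> = infsum (\<lambda>\<alpha>. f \<alpha> * g (mul G (ginv G \<alpha>) \<gamma>)) F"
  proof (rule infsum_cong_neutral)
    show "f x * g (mul G (ginv G x) \<gamma>) = 0" if "x \<in> F - {\<alpha>. rng G \<alpha> = rng G \<gamma>}" for x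
      using that assms(2) by blast
    show "f x * g (mul G (ginv G x) \<gamma>) = 0" if "x \<in> {\<alpha>. rng G \<alpha> = rng G \<gamma>} - F" for x
      using that assms(3)[of x] by blast
  qed simp
  finally show ?thesis using assms(1) by simp
qed

text \<open>
  Near a given arrow, a convolution is a finite sum of products of \<open>f\<close> and \<open>g\<close> along continuous
  maps: \<open>a D \<gamma>\<close> is the arrow of the bisection \<open>D\<close> with the range of \<open>\<gamma>\<close>.
\<close>

lemma convolution_local:
  assumes "compactly_supported f"
  obtains U and J :: "'g set set" and a where "open U" "\<gamma>0 \<in> U" "finite J"
    "\<And>D. D \<in> J \<Longrightarrow> continuous_on U (a D)"
    "\<And>D \<gamma>. D \<in> J \<Longrightarrow> \<gamma> \<in> U \<Longrightarrow> rng G (a D \<gamma>) = rng G \<gamma>"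
    "\<And>g \<gamma>. \<gamma> \<in> U \<Longrightarrow> convolution G f g \<gamma> = (\<Sum>D\<in>J. f (a D \<gamma>) * g (mul G (ginv G (a D \<gamma>)) \<gamma>))"
proof -
  obtain S where S: "compact S" "\<And>x. f x \<noteq> 0 \<Longrightarrow> x \<in> S" by (rule compactly_supportedE[OF assms]) blast
  obtain \<D> where \<D>: "finite \<D>" "disjoint \<D>" "\<And>D. D \<in> \<D> \<Longrightarrow> cobis D" "S \<subseteq> \<Union>\<D>"
    by (rule disjoint_cobis_cover[OF S(1)]) blast
  define J where "J = {D \<in> \<D>. rng G \<gamma>0 \<in> rng G ` D}"
  define V where "V = (\<Inter>D\<in>J. rng G ` D) - (\<Union>D\<in>\<D> - J. rng G ` D)"
  define U where "U = rng G -` V \<inter> UNIV"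
  define a where "a = (\<lambda>D \<gamma>. inv_into D (rng G) (rng G \<gamma>))"
  have clopen: "compact (rng G ` D) \<and> open (rng G ` D)" if "D \<in> \<D>" for D
    using cobis_image_units \<D>(3) that by blast
  have "open V"
    unfolding V_def using \<D>(1) clopen
    by (intro open_Diff open_INT closed_UN) (auto simp: J_def intro: compact_imp_closed)
  then have oU: "open U"
    unfolding U_def using continuous_rng by (metis continuous_on_open_vimage open_UNIV)
  have u0: "\<gamma>0 \<in> U" by (auto simp: U_def V_def J_def)
  have fJ: "finite J" using \<D>(1) by (simp add: J_def)
  have aD: "a D \<gamma> \<in> D \<and> rng G (a D \<gamma>) = rng G \<gamma>" if "D \<in> J" "\<gamma> \<in> U" for D \<gamma>
  proof -
    have "rng G \<gamma> \<in> rng G ` D" using that by (auto simp: U_def V_def)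
    then show ?thesis unfolding a_def by (simp add: f_inv_into_f inv_into_into)
  qed
  have ca: "continuous_on U (a D)" if "D \<in> J" for D
  proof -
    have D: "cobis D" using that \<D>(3) by (simp add: J_def)
    have "continuous_on (rng G ` D) (inv_into D (rng G))"
      by (rule continuous_on_inv[OF continuous_rng]) (use D in \<open>auto simp: cobis_def\<close>)
    then show ?thesis unfolding a_def
      by (rule continuous_on_compose2[OF _ continuous_rng]) (use that in \<open>auto simp: U_def V_def\<close>)
  qed
  have cv: "convolution G f g \<gamma> = (\<Sum>D\<in>J. f (a D \<gamma>) * g (mul G (ginv G (a D \<gamma>)) \<gamma>))"
    if \<gamma>: "\<gamma> \<in> U" for g \<gamma>
  proof -
    have inj: "inj_on (\<lambda>D. a D \<gamma>) J"
    proof (rule inj_onI)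
      fix D D' assume "D \<in> J" "D' \<in> J" "a D \<gamma> = a D' \<gamma>"
      then have "a D \<gamma> \<in> D \<inter> D'" "D \<in> \<D>" "D' \<in> \<D>" using aD[of D \<gamma>] aD[of D' \<gamma>] \<gamma> by (auto simp: J_def)
      then show "D = D'" using \<D>(2) by (auto simp: disjoint_def)
    qed
    have "convolution G f g \<gamma> = (\<Sum>\<alpha>\<in>(\<lambda>D. a D \<gamma>) ` J. f \<alpha> * g (mul G (ginv G \<alpha>) \<gamma>))"
    proof (rule convolution_eq_sum)
      fix \<alpha> assume \<alpha>: "rng G \<alpha> = rng G \<gamma>" "f \<alpha> * g (mul G (ginv G \<alpha>) \<gamma>) \<noteq> 0"
      then have "\<alpha> \<in> S" using S(2) by auto
      then obtain D where D: "D \<in> \<D>" "\<alpha> \<in> D" using \<D>(4) by auto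
      then have "rng G \<gamma> \<in> rng G ` D" using \<alpha>(1) by (metis imageI)
      then have DJ: "D \<in> J" using D \<gamma> by (auto simp: U_def V_def)
      have "a D \<gamma> = \<alpha>"
        using aD[OF DJ \<gamma>] \<alpha>(1) D \<D>(3)[OF D(1)] inj_onD[of "rng G" D "a D \<gamma>" \<alpha>]
        by (simp add: cobis_def)
      then show "\<alpha> \<in> (\<lambda>D. a D \<gamma>) ` J" using DJ by blast
    qed (use fJ aD \<gamma> in auto)
    also have "\<dots> = (\<Sum>D\<in>J. f (a D \<gamma>) * g (mul G (ginv G (a D \<gamma>)) \<gamma>))"
      by (simp add: sum.reindex[OF inj])
    finally show ?thesis .
  qed
  show thesis by (rule that[OF oU u0 fJ ca _ cv]) (use aD in blast)+
qed

lemma compactly_supported_convolution: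
  assumes f: "compactly_supported f" and g: "compactly_supported g"
  shows "compactly_supported (convolution G f g)"
proof -
  obtain K where K: "compact K" "\<And>x. f x \<noteq> 0 \<Longrightarrow> x \<in> K" by (rule compactly_supportedE[OF f]) blast
  obtain L where L: "compact L" "\<And>x. g x \<noteq> 0 \<Longrightarrow> x \<in> L" by (rule compactly_supportedE[OF g]) blast
  have "closed {p :: 'g \<times> 'g. src G (fst p) = rng G (snd p)}"
    by (intro closed_Collect_eq continuous_on_compose2[OF continuous_src] continuous_on_compose2[OF continuous_rng]
        continuous_intros) auto
  then have "compact ((K \<times> L) \<inter> {p. src G (fst p) = rng G (snd p)})"
    by (intro compact_Int_closed compact_Times K L)
  then have c: "compact ((\<lambda>p. mul G (fst p) (snd p)) ` ((K \<times> L) \<inter> {p. src G (fst p) = rng G (snd p)}))"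
    by (intro compact_continuous_image continuous_mul continuous_intros) auto
  show ?thesis
  proof (rule compactly_supportedI[OF c])
    fix \<gamma> assume nz: "convolution G f g \<gamma> \<noteq> 0"
    have "\<exists>\<alpha>. rng G \<alpha> = rng G \<gamma> \<and> f \<alpha> * g (mul G (ginv G \<alpha>) \<gamma>) \<noteq> 0"
      using nz convolution_eq_sum[of "{}" \<gamma> f g] by auto
    then obtain \<alpha> where \<alpha>: "rng G \<alpha> = rng G \<gamma>" "\<alpha> \<in> K" "mul G (ginv G \<alpha>) \<gamma> \<in> L"
      using K L by auto
    then show "\<gamma> \<in> (\<lambda>p. mul G (fst p) (snd p)) ` ((K \<times> L) \<inter> {p. src G (fst p) = rng G (snd p)})"
      by (intro image_eqI[of _ _ "(\<alpha>, mul G (ginv G \<alpha>) \<gamma>)"]) (auto simp: mul_ginv_cancel)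
  qed
qed

lemma continuous_convolution:
  assumes f: "continuous_on UNIV f" "compactly_supported f" and g: "continuous_on UNIV g"
  shows "continuous_on UNIV (convolution G f g)"
proof (rule continuous_at_imp_continuous_on, intro ballI)
  fix \<gamma>0
  obtain U and J :: "'g set set" and a where U: "open U" "\<gamma>0 \<in> U" "finite J"
    "\<And>D. D \<in> J \<Longrightarrow> continuous_on U (a D)"
    "\<And>D \<gamma>. D \<in> J \<Longrightarrow> \<gamma> \<in> U \<Longrightarrow> rng G (a D \<gamma>) = rng G \<gamma>"
    "\<And>g \<gamma>. \<gamma> \<in> U \<Longrightarrow> convolution G f g \<gamma> = (\<Sum>D\<in>J. f (a D \<gamma>) * g (mul G (ginv G (a D \<gamma>)) \<gamma>))"
    by (rule convolution_local[OF f(2), of \<gamma>0]) blast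
  have "continuous_on U (\<lambda>\<gamma>. \<Sum>D\<in>J. f (a D \<gamma>) * g (mul G (ginv G (a D \<gamma>)) \<gamma>))"
    by (intro continuous_on_sum continuous_on_mult continuous_on_compose2[OF f(1)] continuous_on_compose2[OF g]
        continuous_mul continuous_on_compose2[OF continuous_ginv] U continuous_on_id) (auto simp: U)
  then have "continuous_on U (convolution G f g)"
    by (rule continuous_on_cong[THEN iffD1, rotated 2]) (auto simp: U)
  then show "isCont (convolution G f g) \<gamma>0"
    using U(2) continuous_on_eq_continuous_at[OF U(1)] by blast
qed

lemma locally_constant_convolution:
  assumes f: "locally_constant f" "compactly_supported f" and g: "locally_constant g"
  shows "locally_constant (convolution G f g)"
proof (rule locally_constantI)
  fix \<gamma>0
  obtain U and J :: "'g set set" and a where U: "open U" "\<gamma>0 \<in> U" "finite J"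
    "\<And>D. D \<in> J \<Longrightarrow> continuous_on U (a D)"
    "\<And>D \<gamma>. D \<in> J \<Longrightarrow> \<gamma> \<in> U \<Longrightarrow> rng G (a D \<gamma>) = rng G \<gamma>"
    "\<And>g \<gamma>. \<gamma> \<in> U \<Longrightarrow> convolution G f g \<gamma> = (\<Sum>D\<in>J. f (a D \<gamma>) * g (mul G (ginv G (a D \<gamma>)) \<gamma>))"
    by (rule convolution_local[OF f(2), of \<gamma>0]) blast
  define b where "b = (\<lambda>D \<gamma>. mul G (ginv G (a D \<gamma>)) \<gamma>)"
  have b: "continuous_on U (b D)" if "D \<in> J" for D
    unfolding b_def using that
    by (intro continuous_mul continuous_on_compose2[OF continuous_ginv] U continuous_on_id) (auto simp: U)
  define V where "V = U \<inter> (\<Inter>D\<in>J. {\<gamma> \<in> U. f (a D \<gamma>) = f (a D \<gamma>0)} \<inter> {\<gamma> \<in> U. g (b D \<gamma>) = g (b D \<gamma>0)})"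
  have conv: "convolution G f g \<gamma> = (\<Sum>D\<in>J. f (a D \<gamma>) * g (b D \<gamma>))" if "\<gamma> \<in> U" for \<gamma>
    using U(6)[OF that] by (simp add: b_def)
  have "open V"
    unfolding V_def using U f g b by (intro open_Int open_INT ballI locally_constant_vimage) auto
  moreover have "\<gamma>0 \<in> V" using U by (auto simp: V_def)
  moreover have "\<forall>\<gamma>\<in>V. convolution G f g \<gamma> = convolution G f g \<gamma>0"
    using U(2) by (auto simp: V_def conv intro!: sum.cong)
  ultimately show "\<exists>U. open U \<and> \<gamma>0 \<in> U \<and> (\<forall>\<gamma>\<in>U. convolution G f g \<gamma> = convolution G f g \<gamma>0)" by blast
qed

lemma convolution_unit_right:
  assumes "\<And>x. h x \<noteq> 0 \<Longrightarrow> x \<in> units G"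
  shows "convolution G f h \<gamma> = f \<gamma> * h (src G \<gamma>)"
proof -
  have "convolution G f h \<gamma> = (\<Sum>\<alpha>\<in>{\<gamma>}. f \<alpha> * h (mul G (ginv G \<alpha>) \<gamma>))"
  proof (rule convolution_eq_sum)
    fix \<alpha> assume *: "rng G \<alpha> = rng G \<gamma>" "f \<alpha> * h (mul G (ginv G \<alpha>) \<gamma>) \<noteq> 0"
    then have "mul G (ginv G \<alpha>) \<gamma> = src G (mul G (ginv G \<alpha>) \<gamma>)"
      using assms units_iff_rng units_iff_src by (metis mult_zero_right)
    then have "mul G (ginv G \<alpha>) \<gamma> = rng G (mul G (ginv G \<alpha>) \<gamma>)"
      by (metis rng_src)
    then have "mul G (ginv G \<alpha>) \<gamma> = src G \<alpha>" using *(1) by simp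
    then show "\<alpha> \<in> {\<gamma>}" using mul_ginv_cancel[OF *(1)] by simp
  qed auto
  then show ?thesis by simp
qed

lemma convolution_unit_left:
  assumes "\<And>x. h x \<noteq> 0 \<Longrightarrow> x \<in> units G"
  shows "convolution G h f \<gamma> = h (rng G \<gamma>) * f \<gamma>"
proof -
  have "convolution G h f \<gamma> = (\<Sum>\<alpha>\<in>{rng G \<gamma>}. h \<alpha> * f (mul G (ginv G \<alpha>) \<gamma>))"
    by (rule convolution_eq_sum) (use assms units_iff_rng in auto)
  then show ?thesis by (simp add: ginv_unit)
qed

lemma convolution_indicator_ginv:
  assumes "cobis B"
  shows "convolution G (indicator B) (indicator (ginv G ` B)) = indicator (rng G ` B)"
proof
  fix \<gamma>
  have iff: "\<alpha> \<in> B \<and> mul G (ginv G \<alpha>) \<gamma> \<in> ginv G ` B \<longleftrightarrow> \<alpha> \<in> B \<and> \<gamma> = rng G \<alpha>" if r: "rng G \<alpha> = rng G \<gamma>" for \<alpha>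
  proof (intro iffI conjI; elim conjE)
    assume a: "\<alpha> \<in> B" "mul G (ginv G \<alpha>) \<gamma> \<in> ginv G ` B"
    then obtain \<beta> where \<beta>: "\<beta> \<in> B" "mul G (ginv G \<alpha>) \<gamma> = ginv G \<beta>" by auto
    have "src G \<alpha> = src G \<beta>" using arg_cong[OF \<beta>(2), of "rng G"] r by simp
    then have "\<alpha> = \<beta>" using a(1) \<beta>(1) assms inj_onD[of "src G" B \<alpha> \<beta>] by (simp add: cobis_def)
    then show "\<gamma> = rng G \<alpha>" using mul_ginv_cancel[OF r] \<beta>(2) by simp
  next
    assume "\<alpha> \<in> B" "\<gamma> = rng G \<alpha>"
    then show "mul G (ginv G \<alpha>) \<gamma> \<in> ginv G ` B" using mul_src[of "ginv G \<alpha>"] by simp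
  qed
  define F where "F = {\<alpha> \<in> B. \<gamma> = rng G \<alpha>}"
  have F: "\<And>x y. x \<in> F \<Longrightarrow> y \<in> F \<Longrightarrow> x = y" using assms inj_onD[of "rng G" B] by (simp add: F_def cobis_def)
  then have "F = {} \<or> (\<exists>x. F = {x})" by blast
  then have fin: "finite F" by auto
  have "convolution G (indicator B) (indicator (ginv G ` B)) \<gamma>
      = (\<Sum>\<alpha>\<in>F. indicator B \<alpha> * indicator (ginv G ` B) (mul G (ginv G \<alpha>) \<gamma>))"
    by (rule convolution_eq_sum[OF fin]) (use iff in \<open>auto simp: F_def indicator_def split: if_splits\<close>)
  also have "\<dots> = (\<Sum>\<alpha>\<in>F. 1)"
  proof (rule sum.cong[OF refl])
    fix \<alpha> assume "\<alpha> \<in> F"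
    then show "indicator B \<alpha> * indicator (ginv G ` B) (mul G (ginv G \<alpha>) \<gamma>) = (1::complex)"
      using iff[of \<alpha>] by (auto simp: F_def)
  qed
  also have "\<dots> = indicator (rng G ` B) \<gamma>"
    using \<open>F = {} \<or> (\<exists>x. F = {x})\<close>
  proof
    assume e: "F = {}"
    then have "\<gamma> \<notin> rng G ` B" by (auto simp: F_def)
    then show ?thesis by (simp add: e)
  next
    assume "\<exists>x. F = {x}"
    then obtain x where x: "F = {x}" by blast
    then have "x \<in> B \<and> \<gamma> = rng G x" by (auto simp: F_def)
    then show ?thesis by (auto simp: x indicator_def)
  qed
  finally show "convolution G (indicator B) (indicator (ginv G ` B)) \<gamma> = indicator (rng G ` B) \<gamma>" .
qed

section \<open>Minimality and effectiveness\<close>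

lemma minimal_orbit:
  assumes "minimal G" "open W" "W \<subseteq> units G" "W \<noteq> {}" "u \<in> units G"
  obtains \<gamma> where "rng G \<gamma> = u" "src G \<gamma> \<in> W"
proof -
  define U where "U = rng G ` (src G -` W \<inter> UNIV)"
  have "open (src G -` W \<inter> UNIV)" using assms(2) continuous_src by (metis continuous_on_open_vimage open_UNIV)
  then have "open U" unfolding U_def by (rule open_image_rng)
  then have "openin (top_of_set (units G)) U"
    by (intro open_openin_trans[OF open_units]) (auto simp: U_def)
  moreover have "invariant G U"
    unfolding invariant_def
  proof (intro allI iffI)
    fix \<gamma> assume "src G \<gamma> \<in> U"
    then obtain \<alpha> where "src G \<alpha> \<in> W" "src G \<gamma> = rng G \<alpha>" by (auto simp: U_def)
    then show "rng G \<gamma> \<in> U" unfolding U_def by (intro image_eqI[of _ _ "mul G \<gamma> \<alpha>"]) auto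
  next
    fix \<gamma> assume "rng G \<gamma> \<in> U"
    then obtain \<alpha> where "src G \<alpha> \<in> W" "rng G \<gamma> = rng G \<alpha>" by (auto simp: U_def)
    then show "src G \<gamma> \<in> U" unfolding U_def by (intro image_eqI[of _ _ "mul G (ginv G \<gamma>) \<alpha>"]) auto
  qed
  moreover have "U \<noteq> {}"
  proof -
    obtain w where "w \<in> W" using assms(4) by blast
    then have "w \<in> src G -` W" using assms(3) units_iff_src by auto
    then show ?thesis by (auto simp: U_def)
  qed
  ultimately have "U = units G" using assms(1) unfolding minimal_def by blast
  with assms(5) have "u \<in> U" by simp
  then obtain \<gamma> where "src G \<gamma> \<in> W" "u = rng G \<gamma>" by (auto simp: U_def)
  then show thesis using that[of \<gamma>] by simp
qed

lemma effective_avoid_bisection: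
  assumes eff: "effective G" and B: "compact B" "open_bisection G B" "B \<subseteq> - units G"
    and V: "open V" "V \<subseteq> units G" "V \<noteq> {}"
  obtains W where "open W" "W \<subseteq> V" "W \<noteq> {}" "\<And>\<gamma>. \<gamma> \<in> B \<Longrightarrow> \<not> (rng G \<gamma> \<in> W \<and> src G \<gamma> \<in> W)"
proof (cases "\<exists>\<gamma>\<in>B. src G \<gamma> \<in> V \<and> rng G \<gamma> \<in> V \<and> src G \<gamma> \<noteq> rng G \<gamma>")
  case True
  then obtain \<gamma> where \<gamma>: "\<gamma> \<in> B" "src G \<gamma> \<in> V" "rng G \<gamma> \<in> V" "src G \<gamma> \<noteq> rng G \<gamma>" by blast
  obtain V1 V2 where V12: "open V1" "open V2" "src G \<gamma> \<in> V1" "rng G \<gamma> \<in> V2" "V1 \<inter> V2 = {}"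
    using hausdorff[OF \<gamma>(4)] by blast
  have inj: "inj_on (src G) B" and oB: "open B" using cobis_open_bisection[OF B(1,2)] by (auto simp: cobis_def)
  have "open (rng G -` V2 \<inter> UNIV)" using V12(2) continuous_rng by (metis continuous_on_open_vimage open_UNIV)
  then have "open (src G ` (B \<inter> rng G -` V2))" using oB by (intro open_image_src) auto
  then have o: "open (V \<inter> V1 \<inter> src G ` (B \<inter> rng G -` V2))" using V V12 by (intro open_Int) auto
  show thesis
  proof (rule that[OF o])
    show "V \<inter> V1 \<inter> src G ` (B \<inter> rng G -` V2) \<noteq> {}" using \<gamma> V12 by auto
    fix \<gamma>' assume g': "\<gamma>' \<in> B"
    show "\<not> (rng G \<gamma>' \<in> V \<inter> V1 \<inter> src G ` (B \<inter> rng G -` V2) \<and> src G \<gamma>' \<in> V \<inter> V1 \<inter> src G ` (B \<inter> rng G -` V2))"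
    proof
      assume *: "rng G \<gamma>' \<in> V \<inter> V1 \<inter> src G ` (B \<inter> rng G -` V2) \<and> src G \<gamma>' \<in> V \<inter> V1 \<inter> src G ` (B \<inter> rng G -` V2)"
      then obtain \<gamma>'' where "\<gamma>'' \<in> B" "rng G \<gamma>'' \<in> V2" "src G \<gamma>' = src G \<gamma>''" by auto
      then have "\<gamma>' = \<gamma>''" using inj_onD[OF inj] g' by blast
      then have "rng G \<gamma>' \<in> V2" using \<open>rng G \<gamma>'' \<in> V2\<close> by simp
      then show False using * V12(5) by blast
    qed
  qed auto
next
  case False
  have oB: "open B" using B(2) by (simp add: open_bisection_def)
  have "open (rng G -` V \<inter> UNIV)" "open (src G -` V \<inter> UNIV)"
    using V(1) continuous_rng continuous_src by (metis continuous_on_open_vimage open_UNIV)+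
  then have o: "open (B \<inter> rng G -` V \<inter> src G -` V)" using oB by auto
  have "B \<inter> rng G -` V \<inter> src G -` V = {}"
  proof (rule ccontr)
    assume "B \<inter> rng G -` V \<inter> src G -` V \<noteq> {}"
    then obtain x where "x \<in> B \<inter> rng G -` V \<inter> src G -` V" by blast
    then obtain C where C: "compact C" "open_bisection G C" "x \<in> C" "C \<subseteq> B \<inter> rng G -` V \<inter> src G -` V"
      by (metis bisection_nhd[OF o])
    then obtain \<gamma> where "\<gamma> \<in> C" "src G \<gamma> \<noteq> rng G \<gamma>"
      using eff B(3) unfolding effective_def by blast
    then show False using False C(4) by auto
  qed
  then show thesis using V by (intro that[of V]) auto
qed

lemma effective_avoid_compact:
  assumes eff: "effective G" and S: "compact S" "S \<subseteq> - units G" and V: "open V" "V \<subseteq> units G" "V \<noteq> {}"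
  obtains W where "compact W" "open W" "W \<subseteq> V" "W \<noteq> {}" "\<And>\<gamma>. \<gamma> \<in> S \<Longrightarrow> \<not> (rng G \<gamma> \<in> W \<and> src G \<gamma> \<in> W)"
proof -
  obtain \<B> where \<B>: "finite \<B>" "\<And>B. B \<in> \<B> \<Longrightarrow> compact B \<and> open_bisection G B \<and> B \<subseteq> - units G" "S \<subseteq> \<Union>\<B>"
    by (rule finite_cobis_cover[OF S(1) _ S(2)]) (use closed_units in auto)
  have "\<exists>W. open W \<and> W \<subseteq> V \<and> W \<noteq> {} \<and> (\<forall>\<gamma>\<in>\<Union>\<B>. \<not> (rng G \<gamma> \<in> W \<and> src G \<gamma> \<in> W))"
    using \<B>(1,2)
  proof (induction \<B> rule: finite_induct)
    case empty
    then show ?case using V by auto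
  next
    case (insert B \<B>)
    then obtain W where W: "open W" "W \<subseteq> V" "W \<noteq> {}" "\<forall>\<gamma>\<in>\<Union>\<B>. \<not> (rng G \<gamma> \<in> W \<and> src G \<gamma> \<in> W)" by auto
    have "W \<subseteq> units G" using W V by auto
    obtain W' where "open W'" "W' \<subseteq> W" "W' \<noteq> {}" "\<And>\<gamma>. \<gamma> \<in> B \<Longrightarrow> \<not> (rng G \<gamma> \<in> W' \<and> src G \<gamma> \<in> W')"
      by (rule effective_avoid_bisection[OF eff _ _ _ W(1) \<open>W \<subseteq> units G\<close> W(3), of B]) (use insert.prems[of B] in auto)
    then show ?case using W by (intro exI[of _ W']) blast
  qed
  then obtain W where W: "open W" "W \<subseteq> V" "W \<noteq> {}" "\<forall>\<gamma>\<in>\<Union>\<B>. \<not> (rng G \<gamma> \<in> W \<and> src G \<gamma> \<in> W)" by blast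
  then obtain w where "w \<in> W" by blast
  then obtain C where C: "cobis C" "w \<in> C" "C \<subseteq> W" by (metis cobis_nhd[OF W(1)])
  show thesis
  proof (rule that[of C])
    fix \<gamma> assume "\<gamma> \<in> S"
    then have "\<not> (rng G \<gamma> \<in> W \<and> src G \<gamma> \<in> W)" using W(4) \<B>(3) by blast
    then show "\<not> (rng G \<gamma> \<in> C \<and> src G \<gamma> \<in> C)" using C(3) by blast
  qed (use C W in \<open>auto simp: cobis_def\<close>)
qed

end

lemma zero_scaleC [simp]: "0 *\<^sub>C \<xi> = 0"
  by (rule ell2_eqI) (simp add: scaleC.rep_eq zero_ell2.rep_eq)

lemma band_kernel_restrict:
  assumes k: "band_kernel N M k" and k': "\<And>\<eta> \<gamma>. k' \<eta> \<gamma> = k \<eta> \<gamma> \<or> k' \<eta> \<gamma> = 0"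
  shows "band_kernel N M k'"
proof -
  have M: "cmod (k \<eta> \<gamma>) \<le> M" for \<eta> \<gamma> using k by (simp add: band_kernel_def)
  have M0: "0 \<le> M" using M norm_ge_zero order_trans by blast
  have sub: "{\<gamma>. k' \<eta> \<gamma> \<noteq> 0} \<subseteq> {\<gamma>. k \<eta> \<gamma> \<noteq> 0}" "{\<eta>. k' \<eta> \<gamma> \<noteq> 0} \<subseteq> {\<eta>. k \<eta> \<gamma> \<noteq> 0}" for \<eta> \<gamma>
    using k' by force+
  have fin: "finite {\<gamma>. k \<eta> \<gamma> \<noteq> 0}" "card {\<gamma>. k \<eta> \<gamma> \<noteq> 0} \<le> N"
    "finite {\<eta>. k \<eta> \<gamma> \<noteq> 0}" "card {\<eta>. k \<eta> \<gamma> \<noteq> 0} \<le> N" for \<eta> \<gamma>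
    using k by (simp_all add: band_kernel_def)
  show ?thesis
    unfolding band_kernel_def
  proof (intro conjI allI)
    fix \<eta> \<gamma>
    show "finite {\<gamma>. k' \<eta> \<gamma> \<noteq> 0}" "finite {\<eta>. k' \<eta> \<gamma> \<noteq> 0}"
      using finite_subset[OF sub(1) fin(1)] finite_subset[OF sub(2) fin(3)] by auto
    show "card {\<gamma>. k' \<eta> \<gamma> \<noteq> 0} \<le> N" "card {\<eta>. k' \<eta> \<gamma> \<noteq> 0} \<le> N"
      using order_trans[OF card_mono[OF fin(1) sub(1)] fin(2)] order_trans[OF card_mono[OF fin(3) sub(2)] fin(4)] by auto
    show "cmod (k' \<eta> \<gamma>) \<le> M" using k'[of \<eta> \<gamma>] M M0 by auto
  qed
qed

context ample_groupoid
begin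

section \<open>The regular representation\<close>

definition conv_kernel :: "('g \<Rightarrow> complex) \<Rightarrow> 'g \<Rightarrow> 'g \<Rightarrow> complex" where
  "conv_kernel f \<eta> \<gamma> = (if src G \<eta> = src G \<gamma> then f (mul G \<eta> (ginv G \<gamma>)) else 0)"

lemma band_kernel_conv_kernel:
  assumes supp: "\<And>x. f x \<noteq> 0 \<Longrightarrow> x \<in> S" and M: "\<And>x. cmod (f x) \<le> M"
    and r: "\<And>u. finite {x \<in> S. rng G x = u} \<and> card {x \<in> S. rng G x = u} \<le> N"
    and s: "\<And>u. finite {x \<in> S. src G x = u} \<and> card {x \<in> S. src G x = u} \<le> N"
  shows "band_kernel N M (conv_kernel f)"
proof -
  have *: "finite B \<and> card B \<le> N" if "B \<subseteq> h ` A" "finite A \<and> card A \<le> N" for A B :: "'g set" and h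
    using that by (meson card_image_le card_mono finite_imageI finite_subset order_trans)
  have M0: "0 \<le> M" using M norm_ge_zero order_trans by blast
  have row: "{\<gamma>. conv_kernel f \<eta> \<gamma> \<noteq> 0} \<subseteq> (\<lambda>x. mul G (ginv G x) \<eta>) ` {x \<in> S. rng G x = rng G \<eta>}" for \<eta>
  proof
    fix \<gamma> assume "\<gamma> \<in> {\<gamma>. conv_kernel f \<eta> \<gamma> \<noteq> 0}"
    then have e: "src G \<eta> = src G \<gamma>" "f (mul G \<eta> (ginv G \<gamma>)) \<noteq> 0" by (auto simp: conv_kernel_def split: if_splits)
    have "ginv G (mul G \<eta> (ginv G \<gamma>)) = mul G \<gamma> (ginv G \<eta>)" using e by (simp add: ginv_mul)
    then show "\<gamma> \<in> (\<lambda>x. mul G (ginv G x) \<eta>) ` {x \<in> S. rng G x = rng G \<eta>}"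
      using e supp by (intro image_eqI[of _ _ "mul G \<eta> (ginv G \<gamma>)"]) (simp_all add: mul_cancel_ginv)
  qed
  have col: "{\<eta>. conv_kernel f \<eta> \<gamma> \<noteq> 0} \<subseteq> (\<lambda>x. mul G x \<gamma>) ` {x \<in> S. src G x = rng G \<gamma>}" for \<gamma>
  proof
    fix \<eta> assume "\<eta> \<in> {\<eta>. conv_kernel f \<eta> \<gamma> \<noteq> 0}"
    then have e: "src G \<eta> = src G \<gamma>" "f (mul G \<eta> (ginv G \<gamma>)) \<noteq> 0" by (auto simp: conv_kernel_def split: if_splits)
    then show "\<eta> \<in> (\<lambda>x. mul G x \<gamma>) ` {x \<in> S. src G x = rng G \<gamma>}"
      using supp by (intro image_eqI[of _ _ "mul G \<eta> (ginv G \<gamma>)"]) (simp_all add: mul_cancel_ginv)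
  qed
  show ?thesis
    unfolding band_kernel_def using *[OF row r] *[OF col s] M M0 by (auto simp: conv_kernel_def)
qed

lemma Cc_bounded:
  assumes "f \<in> (Cc :: ('g \<Rightarrow> complex) set)"
  obtains M where "\<And>x. cmod (f x) \<le> M"
proof -
  obtain K where K: "compact K" "\<And>x. f x \<noteq> 0 \<Longrightarrow> x \<in> K"
    using compactly_supportedE[of f] assms unfolding Cc_def by blast
  have "compact (f ` K)"
    using assms K(1) by (intro compact_continuous_image) (auto simp: Cc_def intro: continuous_on_subset)
  then obtain M where M: "\<forall>z\<in>f ` K. cmod z \<le> M" using compact_imp_bounded bounded_iff by metis
  have "cmod (f x) \<le> max M 0" for x
    using M K(2)[of x] by (cases "f x = 0") (auto simp: le_max_iff_disj)
  then show thesis by (rule that)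
qed

lemma Cc_band_kernel:
  assumes "f \<in> Cc"
  obtains N M where "band_kernel N M (conv_kernel f)"
proof -
  obtain K where K: "compact K" "\<And>x. f x \<noteq> 0 \<Longrightarrow> x \<in> K"
    using compactly_supportedE[of f] assms unfolding Cc_def by blast
  obtain N where N: "\<And>u. finite {x \<in> K. rng G x = u} \<and> card {x \<in> K. rng G x = u} \<le> N"
    "\<And>u. finite {x \<in> K. src G x = u} \<and> card {x \<in> K. src G x = u} \<le> N"
    using fibre_bound[OF K(1)] by blast
  obtain M where M: "\<And>x. cmod (f x) \<le> M" using Cc_bounded[OF assms] by blast
  show thesis by (rule that[OF band_kernel_conv_kernel[OF K(2) M N]])
qed

lemma finite_support_src:
  assumes "f \<in> Cc"
  shows "finite {\<alpha>. src G \<alpha> = u \<and> f \<alpha> \<noteq> 0}"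
proof -
  obtain K where K: "compact K" "\<And>x. f x \<noteq> 0 \<Longrightarrow> x \<in> K"
    using compactly_supportedE[of f] assms unfolding Cc_def by blast
  obtain N where "finite {x \<in> K. src G x = u} \<and> card {x \<in> K. src G x = u} \<le> N"
    using fibre_bound[OF K(1)] by blast
  then show ?thesis by (rule conjunct1[THEN finite_subset[rotated]]) (use K(2) in blast)
qed

lemma infsum_delta:
  assumes "f \<in> Cc"
  shows "ell2_fun (\<Sum>\<^sub>\<infinity>\<alpha>\<in>{\<alpha>. src G \<alpha> = rng G \<gamma>}. f \<alpha> *\<^sub>C delta (mul G \<alpha> \<gamma>)) \<eta> = conv_kernel f \<eta> \<gamma>"
proof -
  let ?F = "{\<alpha>. src G \<alpha> = rng G \<gamma> \<and> f \<alpha> \<noteq> 0}"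
  have fin: "finite ?F" by (rule finite_support_src[OF assms])
  have "(\<Sum>\<^sub>\<infinity>\<alpha>\<in>{\<alpha>. src G \<alpha> = rng G \<gamma>}. f \<alpha> *\<^sub>C delta (mul G \<alpha> \<gamma>)) = (\<Sum>\<^sub>\<infinity>\<alpha>\<in>?F. f \<alpha> *\<^sub>C delta (mul G \<alpha> \<gamma>))"
    by (rule infsum_cong_neutral) auto
  then have "ell2_fun (\<Sum>\<^sub>\<infinity>\<alpha>\<in>{\<alpha>. src G \<alpha> = rng G \<gamma>}. f \<alpha> *\<^sub>C delta (mul G \<alpha> \<gamma>)) \<eta>
      = (\<Sum>\<alpha>\<in>?F. f \<alpha> * (if \<eta> = mul G \<alpha> \<gamma> then 1 else 0))"
    using fin by (simp add: ell2_fun_sum scaleC.rep_eq ell2_fun_delta)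
  also have "\<dots> = conv_kernel f \<eta> \<gamma>"
  proof (cases "src G \<eta> = src G \<gamma>")
    case True
    have "(\<Sum>\<alpha>\<in>?F. f \<alpha> * (if \<eta> = mul G \<alpha> \<gamma> then 1 else 0))
        = (\<Sum>\<alpha>\<in>?F. if \<alpha> = mul G \<eta> (ginv G \<gamma>) then f \<alpha> else 0)"
    proof (rule sum.cong[OF refl])
      fix \<alpha> assume "\<alpha> \<in> ?F"
      then have "src G \<alpha> = rng G \<gamma>" by simp
      then have "\<eta> = mul G \<alpha> \<gamma> \<longleftrightarrow> \<alpha> = mul G \<eta> (ginv G \<gamma>)"
        using mul_cancel_ginv[OF True] mul_ginv_right_cancel by metis
      then show "f \<alpha> * (if \<eta> = mul G \<alpha> \<gamma> then 1 else 0) = (if \<alpha> = mul G \<eta> (ginv G \<gamma>) then f \<alpha> else 0)" by simp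
    qed
    then show ?thesis using fin True by (simp add: conv_kernel_def)
  next
    case False
    have "f \<alpha> * (if \<eta> = mul G \<alpha> \<gamma> then 1 else 0) = 0" if "\<alpha> \<in> ?F" for \<alpha>
      using that False src_mul[of \<alpha> \<gamma>] by auto
    then show ?thesis using False by (simp add: conv_kernel_def sum.neutral)
  qed
  finally show ?thesis .
qed

abbreviation rep :: "('g \<Rightarrow> complex) \<Rightarrow> 'g op" where
  "rep f \<equiv> regular_rep_sum G f"

lemma regular_rep_eq:
  assumes "f \<in> Cc"
  shows "regular_rep G u f = kernel_op (\<lambda>\<eta> \<gamma>. if src G \<gamma> = u then conv_kernel f \<eta> \<gamma> else 0)"
    (is "_ = kernel_op ?k")
  unfolding regular_rep_def
proof (rule the_equality)
  obtain N M where "band_kernel N M (conv_kernel f)" by (rule Cc_band_kernel[OF assms])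
  then have k: "band_kernel N M ?k" by (rule band_kernel_restrict) auto
  have d: "blinfun_apply (kernel_op ?k) (delta \<gamma>) = (if \<gamma> \<in> fibre G u
         then \<Sum>\<^sub>\<infinity>\<alpha>\<in>{\<alpha>. src G \<alpha> = rng G \<gamma>}. f \<alpha> *\<^sub>C delta (mul G \<alpha> \<gamma>) else 0)" for \<gamma>
    by (rule ell2_eqI, subst ell2_fun_kernel_op_delta[OF k])
       (simp add: infsum_delta[OF assms] fibre_def zero_ell2.rep_eq)
  then show "complex_linear (kernel_op ?k) \<and> (\<forall>\<gamma>. blinfun_apply (kernel_op ?k) (delta \<gamma>) = (if \<gamma> \<in> fibre G u
         then \<Sum>\<^sub>\<infinity>\<alpha>\<in>{\<alpha>. src G \<alpha> = rng G \<gamma>}. f \<alpha> *\<^sub>C delta (mul G \<alpha> \<gamma>) else 0))"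
    using complex_linear_kernel_op[OF k] by blast
  fix T assume T: "complex_linear T \<and> (\<forall>\<gamma>. blinfun_apply T (delta \<gamma>) = (if \<gamma> \<in> fibre G u
         then \<Sum>\<^sub>\<infinity>\<alpha>\<in>{\<alpha>. src G \<alpha> = rng G \<gamma>}. f \<alpha> *\<^sub>C delta (mul G \<alpha> \<gamma>) else 0))"
  show "T = kernel_op ?k"
    by (rule op_eqI_delta[OF conjunct1[OF T] complex_linear_kernel_op[OF k]])
       (simp only: d conjunct2[OF T, rule_format])
qed

lemma rep_eq:
  assumes "f \<in> Cc"
  shows "rep f = kernel_op (conv_kernel f)"
  unfolding regular_rep_sum_def
proof (rule the_equality)
  obtain N M where k: "band_kernel N M (conv_kernel f)" by (rule Cc_band_kernel[OF assms])
  define k' where "k' = (\<lambda>u \<eta> \<gamma>. if src G \<gamma> = u then conv_kernel f \<eta> \<gamma> else 0)"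
  have k': "band_kernel N M (k' u)" for u
    by (rule band_kernel_restrict[OF k]) (simp add: k'_def)
  have R: "regular_rep G u f = kernel_op (k' u)" for u
    using regular_rep_eq[OF assms, of u] by (simp add: k'_def)
  have d: "blinfun_apply (kernel_op (conv_kernel f)) (delta \<gamma>) = blinfun_apply (kernel_op (k' (src G \<gamma>))) (delta \<gamma>)" for \<gamma>
    by (rule ell2_eqI) (simp add: ell2_fun_kernel_op_delta[OF k'] ell2_fun_kernel_op_delta[OF k], simp add: k'_def)
  have "blinfun_apply (kernel_op (conv_kernel f)) \<xi> = blinfun_apply (kernel_op (k' u)) \<xi>" if \<xi>: "\<xi> \<in> ell2_on (fibre G u)" for u \<xi>
  proof (rule op_eq_on[OF complex_linear_kernel_op[OF k] complex_linear_kernel_op[OF k']])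
    fix \<gamma> assume "ell2_fun \<xi> \<gamma> \<noteq> 0"
    then have "src G \<gamma> = u" using \<xi> by (auto simp: ell2_on_def fibre_def)
    then show "blinfun_apply (kernel_op (conv_kernel f)) (delta \<gamma>) = blinfun_apply (kernel_op (k' u)) (delta \<gamma>)"
      using d[of \<gamma>] by simp
  qed
  then show "complex_linear (kernel_op (conv_kernel f)) \<and> (\<forall>u\<in>units G. \<forall>\<xi>\<in>ell2_on (fibre G u).
        blinfun_apply (kernel_op (conv_kernel f)) \<xi> = blinfun_apply (regular_rep G u f) \<xi>)"
    using complex_linear_kernel_op[OF k] by (simp add: R)
  fix T assume T: "complex_linear T \<and> (\<forall>u\<in>units G. \<forall>\<xi>\<in>ell2_on (fibre G u).
        blinfun_apply T \<xi> = blinfun_apply (regular_rep G u f) \<xi>)"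
  show "T = kernel_op (conv_kernel f)"
  proof (rule op_eqI_delta)
    fix \<gamma>
    have "delta \<gamma> \<in> ell2_on (fibre G (src G \<gamma>))" by (auto simp: ell2_on_def fibre_def ell2_fun_delta)
    then show "blinfun_apply T (delta \<gamma>) = blinfun_apply (kernel_op (conv_kernel f)) (delta \<gamma>)"
      using T by (simp add: R d)
  qed (use T complex_linear_kernel_op[OF k] in auto)
qed

lemma complex_linear_rep: "f \<in> Cc \<Longrightarrow> complex_linear (rep f)"
  by (metis Cc_band_kernel complex_linear_kernel_op rep_eq)

lemma ell2_fun_rep_delta:
  assumes "f \<in> Cc"
  shows "ell2_fun (blinfun_apply (rep f) (delta \<gamma>)) \<eta> = conv_kernel f \<eta> \<gamma>"
proof -
  obtain N M where k: "band_kernel N M (conv_kernel f)" by (rule Cc_band_kernel[OF assms])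
  show ?thesis by (simp add: rep_eq[OF assms] ell2_fun_kernel_op_delta[OF k])
qed

lemma rep_eqI:
  assumes "f \<in> Cc" "complex_linear T"
    and "\<And>\<gamma> \<eta>. conv_kernel f \<eta> \<gamma> = ell2_fun (blinfun_apply T (delta \<gamma>)) \<eta>"
  shows "rep f = T"
  by (rule op_eqI_delta[OF complex_linear_rep[OF assms(1)] assms(2)])
     (rule ell2_eqI, simp add: ell2_fun_rep_delta[OF assms(1)] assms(3))

lemma CcI: "continuous_on UNIV f \<Longrightarrow> compactly_supported f \<Longrightarrow> f \<in> Cc"
  by (simp add: Cc_def)

lemma Cc_add:
  assumes f: "f \<in> (Cc :: ('g \<Rightarrow> complex) set)" and g: "g \<in> (Cc :: ('g \<Rightarrow> complex) set)"
  shows "(\<lambda>x. f x + g x) \<in> Cc"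
proof (rule CcI)
  obtain K where K: "compact K" "\<And>x. f x \<noteq> 0 \<Longrightarrow> x \<in> K"
    using compactly_supportedE[of f] f unfolding Cc_def by blast
  obtain L where L: "compact L" "\<And>x. g x \<noteq> 0 \<Longrightarrow> x \<in> L"
    using compactly_supportedE[of g] g unfolding Cc_def by blast
  show "compactly_supported (\<lambda>x. f x + g x)"
    by (rule compactly_supportedI[OF compact_Un[OF K(1) L(1)]]) (metis K(2) L(2) UnCI add.left_neutral)
  show "continuous_on UNIV (\<lambda>x. f x + g x)" using f g by (intro continuous_intros) (auto simp: Cc_def)
qed

lemma Cc_scale:
  assumes f: "f \<in> (Cc :: ('g \<Rightarrow> complex) set)"
  shows "(\<lambda>x. c * f x) \<in> Cc"
proof (rule CcI)
  obtain K where K: "compact K" "\<And>x. f x \<noteq> 0 \<Longrightarrow> x \<in> K"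
    using compactly_supportedE[of f] f unfolding Cc_def by blast
  show "compactly_supported (\<lambda>x. c * f x)"
    by (rule compactly_supportedI[OF K(1)]) (use K(2) in auto)
  show "continuous_on UNIV (\<lambda>x. c * f x)" using f by (intro continuous_intros) (auto simp: Cc_def)
qed

lemma Cc_convolution: "f \<in> Cc \<Longrightarrow> g \<in> Cc \<Longrightarrow> convolution G f g \<in> Cc"
  unfolding Cc_def using continuous_convolution compactly_supported_convolution by simp

lemma Cc_star:
  assumes f: "f \<in> (Cc :: ('g \<Rightarrow> complex) set)"
  shows "(\<lambda>x. cnj (f (ginv G x))) \<in> Cc"
proof (rule CcI)
  obtain K where K: "compact K" "\<And>x. f x \<noteq> 0 \<Longrightarrow> x \<in> K"
    using compactly_supportedE[of f] f unfolding Cc_def by blast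
  have c: "compact (ginv G ` K)" by (rule compact_continuous_image[OF continuous_ginv K(1)])
  show "compactly_supported (\<lambda>x. cnj (f (ginv G x)))"
  proof (rule compactly_supportedI[OF c])
    fix x assume "cnj (f (ginv G x)) \<noteq> 0"
    then have "ginv G x \<in> K" using K(2) by simp
    then show "x \<in> ginv G ` K" by (rule image_eqI[rotated]) simp
  qed
  have "continuous_on UNIV (\<lambda>x. f (ginv G x))"
    using f by (intro continuous_on_compose2[OF _ continuous_ginv]) (auto simp: Cc_def)
  then show "continuous_on UNIV (\<lambda>x. cnj (f (ginv G x)))" by (rule continuous_on_cnj)
qed

lemma Cc_zero: "(\<lambda>_. 0) \<in> (Cc :: ('g \<Rightarrow> complex) set)"
  by (rule CcI) (auto intro: compactly_supportedI[of "{}"])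

lemma rep_add: "f \<in> Cc \<Longrightarrow> g \<in> Cc \<Longrightarrow> rep (\<lambda>x. f x + g x) = rep f + rep g"
  by (rule rep_eqI)
     (auto simp: Cc_add complex_linear_add complex_linear_rep blinfun.bilinear_simps plus_ell2.rep_eq
        ell2_fun_rep_delta conv_kernel_def)

lemma rep_scale: "f \<in> Cc \<Longrightarrow> rep (\<lambda>x. c * f x) = scaleC_op c (rep f)"
  by (rule rep_eqI)
     (auto simp: Cc_scale complex_linear_scaleC_op complex_linear_rep scaleC.rep_eq ell2_fun_rep_delta conv_kernel_def)

lemma is_adjoint_rep:
  assumes f: "f \<in> Cc"
  shows "is_adjoint (rep f) (rep (\<lambda>x. cnj (f (ginv G x))))"
proof -
  obtain N M where k: "band_kernel N M (conv_kernel f)" by (rule Cc_band_kernel[OF f])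
  have "conv_kernel (\<lambda>x. cnj (f (ginv G x))) = (\<lambda>\<eta> \<gamma>. cnj (conv_kernel f \<gamma> \<eta>))"
    by (intro ext) (simp add: conv_kernel_def ginv_mul)
  then show ?thesis
    using is_adjoint_kernel_op[OF k] by (simp add: rep_eq[OF f] rep_eq[OF Cc_star[OF f]])
qed

lemma rep_convolution:
  assumes f: "f \<in> Cc" and g: "g \<in> Cc"
  shows "rep (convolution G f g) = rep f o\<^sub>L rep g"
proof (rule rep_eqI)
  show "convolution G f g \<in> Cc" using Cc_convolution f g by blast
  show "complex_linear (rep f o\<^sub>L rep g)" using complex_linear_compose complex_linear_rep f g by blast
  fix \<zeta> \<eta>
  obtain N M where k: "band_kernel N M (conv_kernel f)" by (rule Cc_band_kernel[OF f])
  let ?row = "{\<gamma>. conv_kernel f \<eta> \<gamma> \<noteq> 0}"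
  have fin: "finite ?row" using k by (simp add: band_kernel_def)
  have "ell2_fun (blinfun_apply (rep f o\<^sub>L rep g) (delta \<zeta>)) \<eta> = (\<Sum>\<gamma>\<in>?row. conv_kernel f \<eta> \<gamma> * conv_kernel g \<gamma> \<zeta>)"
    by (simp add: ell2_fun_rep_delta[OF g] rep_eq[OF f] ell2_fun_kernel_op[OF k] kernel_apply_def)
  also have "\<dots> = conv_kernel (convolution G f g) \<eta> \<zeta>"
  proof (cases "src G \<eta> = src G \<zeta>")
    case True
    let ?h = "\<lambda>\<gamma>. mul G \<eta> (ginv G \<gamma>)" and ?\<omega> = "mul G \<eta> (ginv G \<zeta>)"
    have sr: "src G \<gamma> = src G \<eta>" "f (?h \<gamma>) \<noteq> 0" if "\<gamma> \<in> ?row" for \<gamma>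
      using that by (auto simp: conv_kernel_def split: if_splits)
    have ginv_h: "ginv G (?h \<gamma>) = mul G \<gamma> (ginv G \<eta>)" if "src G \<gamma> = src G \<eta>" for \<gamma>
      using that by (simp add: ginv_mul)
    have recover: "mul G (ginv G (?h \<gamma>)) \<eta> = \<gamma>" if "src G \<gamma> = src G \<eta>" for \<gamma>
      using that mul_cancel_ginv[OF that] ginv_h[OF that] by simp
    have inj: "inj_on ?h ?row"
      by (rule inj_on_inverseI[of _ "\<lambda>x. mul G (ginv G x) \<eta>"]) (use recover sr in blast)
    have "convolution G f g ?\<omega> = (\<Sum>\<alpha>\<in>?h ` ?row. f \<alpha> * g (mul G (ginv G \<alpha>) ?\<omega>))"
    proof (rule convolution_eq_sum)
      show "rng G \<alpha> = rng G ?\<omega>" if "\<alpha> \<in> ?h ` ?row" for \<alpha>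
        using that sr True by auto
      fix \<alpha> assume \<alpha>: "rng G \<alpha> = rng G ?\<omega>" "f \<alpha> * g (mul G (ginv G \<alpha>) ?\<omega>) \<noteq> 0"
      have r: "rng G \<alpha> = rng G \<eta>" using \<alpha>(1) True by simp
      have h: "?h (mul G (ginv G \<alpha>) \<eta>) = \<alpha>"
      proof -
        have "ginv G (mul G (ginv G \<alpha>) \<eta>) = mul G (ginv G \<eta>) \<alpha>" using r by (simp add: ginv_mul)
        then show ?thesis using mul_ginv_cancel[of \<eta> \<alpha>] r by simp
      qed
      have "conv_kernel f \<eta> (mul G (ginv G \<alpha>) \<eta>) = f \<alpha>"
        using h r by (simp add: conv_kernel_def)
      then show "\<alpha> \<in> ?h ` ?row" using \<alpha>(2) h by (intro image_eqI[of _ _ "mul G (ginv G \<alpha>) \<eta>"]) auto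
    qed (use fin in simp)
    also have "\<dots> = (\<Sum>\<gamma>\<in>?row. f (?h \<gamma>) * g (mul G (ginv G (?h \<gamma>)) ?\<omega>))"
      by (simp add: sum.reindex[OF inj])
    also have "\<dots> = (\<Sum>\<gamma>\<in>?row. conv_kernel f \<eta> \<gamma> * conv_kernel g \<gamma> \<zeta>)"
    proof (rule sum.cong[OF refl])
      fix \<gamma> assume \<gamma>: "\<gamma> \<in> ?row"
      have "mul G (ginv G (?h \<gamma>)) ?\<omega> = mul G (mul G (ginv G (?h \<gamma>)) \<eta>) (ginv G \<zeta>)"
        using sr(1)[OF \<gamma>] True by (intro mul_assoc[symmetric]) simp_all
      then have "mul G (ginv G (?h \<gamma>)) ?\<omega> = mul G \<gamma> (ginv G \<zeta>)"
        using recover[OF sr(1)[OF \<gamma>]] by simp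
      then show "f (?h \<gamma>) * g (mul G (ginv G (?h \<gamma>)) ?\<omega>) = conv_kernel f \<eta> \<gamma> * conv_kernel g \<gamma> \<zeta>"
        using sr(1)[OF \<gamma>] True by (simp add: conv_kernel_def)
    qed
    finally show ?thesis using True by (simp add: conv_kernel_def)
  next
    case False
    have "conv_kernel f \<eta> \<gamma> * conv_kernel g \<gamma> \<zeta> = 0" for \<gamma>
      using False by (auto simp: conv_kernel_def)
    then have "(\<Sum>\<gamma>\<in>?row. conv_kernel f \<eta> \<gamma> * conv_kernel g \<gamma> \<zeta>) = 0"
      by (simp only: sum.neutral_const)
    moreover have "conv_kernel (convolution G f g) \<eta> \<zeta> = 0" using False by (simp add: conv_kernel_def)
    ultimately show ?thesis by (simp only:)
  qed
  finally show "conv_kernel (convolution G f g) \<eta> \<zeta> = ell2_fun (blinfun_apply (rep f o\<^sub>L rep g) (delta \<zeta>)) \<eta>" ..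
qed

lemma star_algebra_rep_Cc: "star_algebra (rep ` Cc)"
proof
  fix S T assume "S \<in> rep ` Cc" "T \<in> rep ` Cc"
  then obtain f g where fg: "S = rep f" "f \<in> Cc" "T = rep g" "g \<in> Cc" by blast
  show "S + T \<in> rep ` Cc" using rep_add[OF fg(2,4)] Cc_add[OF fg(2,4)] fg by (metis imageI)
  show "S o\<^sub>L T \<in> rep ` Cc" using rep_convolution[OF fg(2,4)] Cc_convolution[OF fg(2,4)] fg by (metis imageI)
next
  fix T assume "T \<in> rep ` Cc"
  then obtain f where f: "T = rep f" "f \<in> Cc" by blast
  show "scaleC_op c T \<in> rep ` Cc" for c using rep_scale[OF f(2)] Cc_scale[OF f(2)] f(1) by (metis imageI)
  show "complex_linear T" using complex_linear_rep f by blast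
  show "\<exists>S\<in>rep ` Cc. is_adjoint T S" using is_adjoint_rep[OF f(2)] Cc_star[OF f(2)] f(1) by blast
next
  show "rep ` Cc \<noteq> {}" using Cc_zero by blast
qed

lemma star_algebra_reduced_Cstar: "star_algebra (reduced_Cstar G)"
  unfolding reduced_Cstar_def by (rule star_algebra.star_algebra_closure[OF star_algebra_rep_Cc])

sublocale rC: star_algebra "reduced_Cstar G"
  by (rule star_algebra_reduced_Cstar)

lemma rep_in_reduced_Cstar: "f \<in> Cc \<Longrightarrow> rep f \<in> reduced_Cstar G"
  unfolding reduced_Cstar_def by (rule subsetD[OF closure_subset]) (rule imageI)

lemma reduced_Cstar_approx:
  assumes "T \<in> reduced_Cstar G" "\<epsilon> > 0"
  obtains f where "f \<in> Cc" "norm (T - rep f) < \<epsilon>"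
proof -
  obtain S where S: "S \<in> rep ` Cc" "dist S T < \<epsilon>"
    using assms unfolding reduced_Cstar_def closure_approachable by blast
  then show thesis using that by (auto simp: dist_norm norm_minus_commute)
qed

lemma norm_rep_units_le:
  assumes "f \<in> Cc" "\<And>x. f x \<noteq> 0 \<Longrightarrow> x \<in> units G" "\<And>x. cmod (f x) \<le> M"
  shows "norm (rep f) \<le> M"
proof -
  have "finite {x \<in> units G. h x = u} \<and> card {x \<in> units G. h x = u} \<le> 1" if h: "\<And>x. x \<in> units G \<Longrightarrow> h x = x" for h and u :: 'g
  proof -
    have "{x \<in> units G. h x = u} \<subseteq> {u}" using h by auto
    then show ?thesis using card_mono[of "{u}"] finite_subset[of _ "{u}"] by fastforce
  qed
  then have "band_kernel 1 M (conv_kernel f)"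
    using assms units_iff_src units_iff_rng by (intro band_kernel_conv_kernel[of f "units G"]) auto
  from norm_kernel_op_le[OF this] show ?thesis by (simp add: rep_eq[OF assms(1)])
qed

definition compact_open_units :: "'g set \<Rightarrow> bool" where
  "compact_open_units K \<longleftrightarrow> compact K \<and> open K \<and> K \<subseteq> units G"

lemma indicator_Cc: "compact B \<Longrightarrow> open B \<Longrightarrow> (indicator B :: 'g \<Rightarrow> complex) \<in> Cc"
  by (intro CcI locally_constant_continuous locally_constant_indicator compactly_supportedI[of B])
     (auto simp: indicator_def split: if_splits)

abbreviation proj :: "'g set \<Rightarrow> 'g op" where
  "proj K \<equiv> rep (indicator K)"

lemma rep_proj:
  assumes "compact_open_units K" "f \<in> Cc"
  shows "rep f o\<^sub>L proj K = rep (\<lambda>\<gamma>. f \<gamma> * indicator K (src G \<gamma>))"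
    and "proj K o\<^sub>L rep f = rep (\<lambda>\<gamma>. indicator K (rng G \<gamma>) * f \<gamma>)"
    and "(\<lambda>\<gamma>. f \<gamma> * indicator K (src G \<gamma>)) \<in> Cc"
    and "(\<lambda>\<gamma>. indicator K (rng G \<gamma>) * f \<gamma>) \<in> Cc"
proof -
  have K: "(indicator K :: 'g \<Rightarrow> complex) \<in> Cc" "\<And>x. (indicator K x :: complex) \<noteq> 0 \<Longrightarrow> x \<in> units G"
    using assms(1) by (auto simp: compact_open_units_def indicator_Cc split: split_indicator_asm)
  have 1: "convolution G f (indicator K) = (\<lambda>\<gamma>. f \<gamma> * indicator K (src G \<gamma>))"
    using convolution_unit_right[OF K(2)] by blast
  have 2: "convolution G (indicator K) f = (\<lambda>\<gamma>. indicator K (rng G \<gamma>) * f \<gamma>)"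
    using convolution_unit_left[OF K(2)] by blast
  show "rep f o\<^sub>L proj K = rep (\<lambda>\<gamma>. f \<gamma> * indicator K (src G \<gamma>))"
    "proj K o\<^sub>L rep f = rep (\<lambda>\<gamma>. indicator K (rng G \<gamma>) * f \<gamma>)"
    using rep_convolution[OF assms(2) K(1)] rep_convolution[OF K(1) assms(2)] by (simp_all add: 1 2)
  show "(\<lambda>\<gamma>. f \<gamma> * indicator K (src G \<gamma>)) \<in> Cc" "(\<lambda>\<gamma>. indicator K (rng G \<gamma>) * f \<gamma>) \<in> Cc"
    using Cc_convolution[OF assms(2) K(1)] Cc_convolution[OF K(1) assms(2)] by (simp_all add: 1 2)
qed

lemma
  assumes K: "compact_open_units K"
  shows proj_in: "proj K \<in> reduced_Cstar G" and proj_idem: "proj K o\<^sub>L proj K = proj K"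
    and adj_proj: "adj (proj K) = proj K" and norm_proj_le: "norm (proj K) \<le> 1"
proof -
  have C: "(indicator K :: 'g \<Rightarrow> complex) \<in> Cc" using K by (simp add: compact_open_units_def indicator_Cc)
  have u: "x \<in> K \<Longrightarrow> src G x = x \<and> ginv G x = x" for x
    using K units_iff_src ginv_unit unfolding compact_open_units_def by blast
  show "proj K \<in> reduced_Cstar G" by (rule rep_in_reduced_Cstar[OF C])
  have "(\<lambda>\<gamma>. indicator K \<gamma> * indicator K (src G \<gamma>) :: complex) = indicator K"
    using u by (auto simp: indicator_def)
  then show "proj K o\<^sub>L proj K = proj K" using rep_proj(1)[OF K C] by simp
  have "x \<in> K \<longleftrightarrow> ginv G x \<in> K" for x using u ginv_ginv by metis
  then have "(\<lambda>x. cnj (indicator K (ginv G x))) = indicator K" by (auto simp: indicator_def)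
  then show "adj (proj K) = proj K" using adj_eqI[OF is_adjoint_rep[OF C]] by simp
  show "norm (proj K) \<le> 1"
    by (rule norm_rep_units_le[OF C]) (use K in \<open>auto simp: compact_open_units_def indicator_def split: if_splits\<close>)
qed

end

section \<open>Quotients by kernels of characters\<close>

text \<open>The cosets of the kernel of \<open>\<psi>\<close> are the level sets of \<open>\<psi>\<close>.\<close>

lemma character_quotient_division_ring:
  fixes R :: "'a ring" and \<psi> :: "'a \<Rightarrow> 'k::field"
  assumes R: "abelian_group R"
    and mult_closed: "\<And>f g. f \<in> carrier R \<Longrightarrow> g \<in> carrier R \<Longrightarrow> f \<otimes>\<^bsub>R\<^esub> g \<in> carrier R"
    and add: "\<And>f g. f \<in> carrier R \<Longrightarrow> g \<in> carrier R \<Longrightarrow> \<psi> (f \<oplus>\<^bsub>R\<^esub> g) = \<psi> f + \<psi> g"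
    and mult: "\<And>f g. f \<in> carrier R \<Longrightarrow> g \<in> carrier R \<Longrightarrow> \<psi> (f \<otimes>\<^bsub>R\<^esub> g) = \<psi> f * \<psi> g"
    and surj: "\<And>c. \<exists>f\<in>carrier R. \<psi> f = c"
  defines "I \<equiv> {f \<in> carrier R. \<psi> f = 0}"
  shows "two_sided_ideal I R" "division_ring (R Quot I)"
proof -
  interpret R: abelian_group R by (rule R)
  define C where "C = (\<lambda>c. {f \<in> carrier R. \<psi> f = c})"
  have I: "I = C 0" by (simp add: I_def C_def)
  have CI: "f \<in> C c \<longleftrightarrow> f \<in> carrier R \<and> \<psi> f = c" for f c by (simp add: C_def)
  have Cne: "\<exists>f. f \<in> C c" for c using surj[of c] by (auto simp: C_def)
  have inj: "C c = C d \<longleftrightarrow> c = d" for c d using Cne[of c] by (auto simp: C_def)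
  have "\<psi> \<zero>\<^bsub>R\<^esub> = \<psi> \<zero>\<^bsub>R\<^esub> + \<psi> \<zero>\<^bsub>R\<^esub>"
    using add[OF R.zero_closed R.zero_closed] by (simp only: R.l_zero[OF R.zero_closed])
  then have zero: "\<psi> \<zero>\<^bsub>R\<^esub> = 0" by (simp only: add_cancel_right_right)
  have neg: "\<psi> (\<ominus>\<^bsub>R\<^esub> f) = - \<psi> f" if "f \<in> carrier R" for f
    using add[OF R.a_inv_closed[OF that] that] that zero by (simp add: R.l_neg eq_neg_iff_add_eq_0)
  have "subgroup I (add_monoid R)"
    by (rule R.add.subgroupI) (use zero in \<open>auto simp: I_def add neg\<close>)
  then have "additive_subgroup I R" by (rule additive_subgroupI)
  then show "two_sided_ideal I R"
    unfolding two_sided_ideal_def by (auto simp: I_def mult mult_closed)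
  have coset: "I +>\<^bsub>R\<^esub> x = C (\<psi> x)" if x: "x \<in> carrier R" for x
  proof (intro equalityI subsetI)
    fix y assume "y \<in> I +>\<^bsub>R\<^esub> x"
    then show "y \<in> C (\<psi> x)" using x by (auto simp: a_r_coset_def' I_def CI add)
  next
    fix y assume y: "y \<in> C (\<psi> x)"
    have "y \<ominus>\<^bsub>R\<^esub> x \<in> I" using x y by (auto simp: I_def CI add neg a_minus_def)
    moreover have "y = (y \<ominus>\<^bsub>R\<^esub> x) \<oplus>\<^bsub>R\<^esub> x"
      using x y by (simp add: CI a_minus_def R.a_assoc R.l_neg)
    ultimately show "y \<in> I +>\<^bsub>R\<^esub> x" by (auto simp: a_r_coset_def')
  qed
  have carr: "carrier (R Quot I) = range C"
  proof -
    have "carrier (R Quot I) = (\<lambda>x. I +>\<^bsub>R\<^esub> x) ` carrier R"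
      unfolding FactRing_def A_RCOSETS_def' by auto
    also have "\<dots> = C ` \<psi> ` carrier R" using coset by (auto simp: image_image)
    also have "\<psi> ` carrier R = UNIV" by (rule UNIV_eq_I[symmetric]) (metis surj imageI)
    finally show ?thesis .
  qed
  have qmult: "C c \<otimes>\<^bsub>R Quot I\<^esub> C d = C (c * d)" for c d
  proof -
    have "I +>\<^bsub>R\<^esub> (a \<otimes>\<^bsub>R\<^esub> b) = C (c * d)" if "a \<in> C c" "b \<in> C d" for a b
      using that by (simp add: CI coset mult_closed mult)
    then show ?thesis using Cne[of c] Cne[of d] by (auto simp: FactRing_def rcoset_mult_def)
  qed
  have qadd: "C c \<oplus>\<^bsub>R Quot I\<^esub> C d = C (c + d)" for c d
  proof (intro equalityI subsetI)
    fix y assume "y \<in> C c \<oplus>\<^bsub>R Quot I\<^esub> C d"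
    then show "y \<in> C (c + d)" by (auto simp: FactRing_def set_add_def' CI add)
  next
    fix y assume y: "y \<in> C (c + d)"
    obtain k where k: "k \<in> C d" using Cne by blast
    have "y \<ominus>\<^bsub>R\<^esub> k \<in> C c" using k y by (simp add: CI add neg a_minus_def)
    moreover have "y = (y \<ominus>\<^bsub>R\<^esub> k) \<oplus>\<^bsub>R\<^esub> k"
      using k y by (simp add: CI a_minus_def R.a_assoc R.l_neg)
    ultimately show "y \<in> C c \<oplus>\<^bsub>R Quot I\<^esub> C d" using k by (auto simp: FactRing_def set_add_def')
  qed
  have qzero: "\<zero>\<^bsub>R Quot I\<^esub> = C 0" by (simp add: FactRing_def I)
  let ?D = "(R Quot I)\<lparr>one := C 1\<rparr>"
  have carr': "carrier ?D = range C" using carr by simp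
  have qmult': "C c \<otimes>\<^bsub>?D\<^esub> C d = C (c * d)" for c d using qmult by simp
  have qadd': "C c \<oplus>\<^bsub>?D\<^esub> C d = C (c + d)" for c d using qadd by simp
  have qzero': "\<zero>\<^bsub>?D\<^esub> = C 0" using qzero by simp
  have qone': "\<one>\<^bsub>?D\<^esub> = C 1" by simp
  note q = carr' qmult' qadd' qzero' qone'
  have "Ring.ring ?D"
  proof (rule ringI)
    show "abelian_group ?D"
    proof (rule abelian_groupI)
      fix x assume "x \<in> carrier ?D"
      then obtain c where "x = C c" unfolding q by blast
      then have "C (- c) \<oplus>\<^bsub>?D\<^esub> x = \<zero>\<^bsub>?D\<^esub>" unfolding q by (simp only: q) simp
      then show "\<exists>y\<in>carrier ?D. y \<oplus>\<^bsub>?D\<^esub> x = \<zero>\<^bsub>?D\<^esub>" unfolding carr' by blast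
    qed (unfold q, auto simp: qadd add_ac)
    show "monoid ?D"
      by (rule monoidI) (unfold q, auto simp: qmult mult_ac)
  qed (unfold q, auto simp: qmult qadd algebra_simps)
  moreover have "Units ?D = carrier (R Quot I) - {\<zero>\<^bsub>R Quot I\<^esub>}"
  proof (intro equalityI subsetI)
    fix x assume "x \<in> Units ?D"
    then obtain c d where "x = C c" "C d \<otimes>\<^bsub>?D\<^esub> C c = C 1"
      unfolding Units_def carr' qone' by blast
    then have "c \<noteq> 0" "x = C c" by (auto simp: qmult inj)
    then show "x \<in> carrier (R Quot I) - {\<zero>\<^bsub>R Quot I\<^esub>}" by (auto simp: carr qzero inj)
  next
    fix x assume "x \<in> carrier (R Quot I) - {\<zero>\<^bsub>R Quot I\<^esub>}"
    then obtain c where c: "x = C c" "c \<noteq> 0" by (auto simp: carr qzero inj)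
    then have "C (inverse c) \<otimes>\<^bsub>?D\<^esub> x = \<one>\<^bsub>?D\<^esub>" "x \<otimes>\<^bsub>?D\<^esub> C (inverse c) = \<one>\<^bsub>?D\<^esub>"
      by (simp_all add: qmult)
    then show "x \<in> Units ?D" unfolding Units_def carr' using c(1) by blast
  qed
  ultimately show "division_ring (R Quot I)" unfolding division_ring_def by blast
qed

context ample_groupoid
begin

section \<open>The Steinberg algebra\<close>

abbreviation SA :: "('g \<Rightarrow> complex) ring" where
  "SA \<equiv> steinberg_algebra G"

lemma SA_simps [simp]:
  "mult SA = convolution G" "zero SA = (\<lambda>_. 0)" "add SA = (\<lambda>f g x. f x + g x)"
  by (simp_all add: steinberg_algebra_def)

lemma SA_carrier: "f \<in> carrier SA \<longleftrightarrow> locally_constant f \<and> compactly_supported f"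
  by (simp add: steinberg_algebra_def)

lemma SA_Cc: "f \<in> carrier SA \<Longrightarrow> f \<in> Cc"
  by (simp add: SA_carrier CcI locally_constant_continuous)

lemma SA_convolution: "f \<in> carrier SA \<Longrightarrow> g \<in> carrier SA \<Longrightarrow> convolution G f g \<in> carrier SA"
  by (simp add: SA_carrier locally_constant_convolution compactly_supported_convolution)

lemma SA_add:
  assumes f: "f \<in> carrier SA" and g: "g \<in> carrier SA"
  shows "(\<lambda>x. f x + g x) \<in> carrier SA"
proof -
  have "locally_constant (\<lambda>x. f x + g x)"
  proof (rule locally_constantI)
    fix x
    have "open (f -` {f x} \<inter> g -` {g x})"
      using f g by (intro open_Int open_vimage_locally_constant) (simp_all add: SA_carrier)
    then show "\<exists>U. open U \<and> x \<in> U \<and> (\<forall>y\<in>U. f y + g y = f x + g x)"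
      by (intro exI[of _ "f -` {f x} \<inter> g -` {g x}"]) simp
  qed
  moreover have "compactly_supported (\<lambda>x. f x + g x)"
    using Cc_add[OF SA_Cc[OF f] SA_Cc[OF g]] by (simp add: Cc_def)
  ultimately show ?thesis by (simp add: SA_carrier)
qed

lemma SA_scale:
  assumes f: "f \<in> carrier SA"
  shows "(\<lambda>x. c * f x) \<in> carrier SA"
proof -
  have "locally_constant (\<lambda>x. c * f x)"
  proof (rule locally_constantI)
    fix x
    have "open (f -` {f x})"
      using f by (intro open_vimage_locally_constant) (simp add: SA_carrier)
    then show "\<exists>U. open U \<and> x \<in> U \<and> (\<forall>y\<in>U. c * f y = c * f x)"
      by (intro exI[of _ "f -` {f x}"]) simp
  qed
  moreover have "compactly_supported (\<lambda>x. c * f x)"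
    using Cc_scale[OF SA_Cc[OF f]] by (simp add: Cc_def)
  ultimately show ?thesis by (simp add: SA_carrier)
qed

lemma indicator_SA: "compact B \<Longrightarrow> open B \<Longrightarrow> indicator B \<in> carrier SA"
  using indicator_Cc[of B] by (simp add: SA_carrier locally_constant_indicator Cc_def)

lemma abelian_group_SA: "abelian_group SA"
proof (rule abelian_groupI)
  show "\<zero>\<^bsub>SA\<^esub> \<in> carrier SA"
    using indicator_SA[of "{}"] by (simp add: indicator_def[abs_def])
  fix f assume f: "f \<in> carrier SA"
  show "\<exists>g\<in>carrier SA. g \<oplus>\<^bsub>SA\<^esub> f = \<zero>\<^bsub>SA\<^esub>"
    by (rule bexI[OF _ SA_scale[OF f, of "-1"]]) simp
qed (simp_all add: SA_add add_ac)

lemma indicator_in_RaR: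
  assumes min: "minimal G" and W: "compact_open_units W" "W \<noteq> {}" and K: "compact_open_units K"
  shows "indicator K \<in> ring_RaR SA (indicator W)"
proof -
  define \<U> where "\<U> = {rng G ` B | B. cobis B \<and> src G ` B \<subseteq> W}"
  have oW: "open W" "W \<subseteq> units G" "compact W" using W by (auto simp: compact_open_units_def)
  have oU: "open U" "compact U" if "U \<in> \<U>" for U
    using that cobis_image_units by (auto simp: \<U>_def)
  have one: "indicator L \<in> ring_RaR SA (indicator W)" if U: "U \<in> \<U>" and L: "compact_open_units L" "L \<subseteq> U" for U L
  proof -
    obtain B where B: "cobis B" "src G ` B \<subseteq> W" "U = rng G ` B" using U by (auto simp: \<U>_def)
    define C where "C = B \<inter> (rng G -` L \<inter> UNIV)"
    have "open L" "closed L" using L by (auto simp: compact_open_units_def compact_imp_closed)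
    then have o: "open (rng G -` L \<inter> UNIV)" and c: "closed (rng G -` L \<inter> UNIV)"
      using continuous_rng[of UNIV] continuous_on_open_vimage[of UNIV "rng G"]
        continuous_on_closed_vimage[of UNIV "rng G"] by auto
    have C: "cobis C"
      unfolding C_def using B(1) o c
      by (intro cobis_subset[OF B(1)]) (auto simp: cobis_def compact_Int_closed simp del: Int_UNIV_right)
    have im: "rng G ` C = L" using L(2) B(3) by (auto simp: C_def)
    have "convolution G (indicator C) (indicator W) = (indicator C :: 'g \<Rightarrow> complex)"
    proof
      fix \<gamma>
      have "convolution G (indicator C) (indicator W) \<gamma> = (indicator C \<gamma> * indicator W (src G \<gamma>) :: complex)"
        by (rule convolution_unit_right) (use oW in \<open>auto split: split_indicator_asm\<close>)
      also have "\<dots> = indicator C \<gamma>" using B(2) by (auto simp: C_def indicator_def)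
      finally show "convolution G (indicator C) (indicator W) \<gamma> = (indicator C \<gamma> :: complex)" .
    qed
    then have "convolution G (convolution G (indicator C) (indicator W)) (indicator (ginv G ` C)) = (indicator L :: 'g \<Rightarrow> complex)"
      using convolution_indicator_ginv[OF C] im by simp
    moreover have "indicator C \<in> carrier SA" "indicator (ginv G ` C) \<in> carrier SA"
      using C cobis_ginv[OF C] by (auto simp: cobis_def intro: indicator_SA)
    ultimately show ?thesis
      unfolding ring_RaR_def by (intro generate.incl CollectI exI[of _ "indicator C"] exI[of _ "indicator (ginv G ` C)"])
        simp
  qed
  have "K \<subseteq> \<Union>\<U>"
  proof
    fix u assume "u \<in> K"
    then have "u \<in> units G" using K by (auto simp: compact_open_units_def)
    then obtain \<gamma> where \<gamma>: "rng G \<gamma> = u" "src G \<gamma> \<in> W"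
      by (rule minimal_orbit[OF min oW(1,2) W(2)])
    have "open (src G -` W \<inter> UNIV)"
      using continuous_src[of UNIV] continuous_on_open_vimage[of UNIV "src G"] oW(1) by auto
    moreover have "\<gamma> \<in> src G -` W \<inter> UNIV" using \<gamma>(2) by simp
    ultimately obtain B where B: "cobis B" "\<gamma> \<in> B" "B \<subseteq> src G -` W \<inter> UNIV"
      by (rule cobis_nhd)
    have "rng G ` B \<in> \<U>" using B by (auto simp: \<U>_def)
    moreover have "u \<in> rng G ` B" using B(2) \<gamma>(1) by auto
    ultimately show "u \<in> \<Union>\<U>" by blast
  qed
  have "compact K" using K by (simp add: compact_open_units_def)
  then obtain \<D> where \<D>: "\<D> \<subseteq> \<U>" "finite \<D>" "K \<subseteq> \<Union>\<D>"
    by (rule compactE[OF _ \<open>K \<subseteq> \<Union>\<U>\<close> oU(1)])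
  have "\<forall>L. compact_open_units L \<longrightarrow> L \<subseteq> \<Union>\<D> \<longrightarrow> indicator L \<in> ring_RaR SA (indicator W)"
    using \<D>(2,1)
  proof (induction \<D> rule: finite_induct)
    case empty
    have e: "(indicator {} :: 'g \<Rightarrow> complex) = \<one>\<^bsub>add_monoid SA\<^esub>" by (simp add: indicator_def[abs_def])
    have "indicator {} \<in> ring_RaR SA (indicator W)"
      unfolding ring_RaR_def e by (rule generate.one)
    then show ?case by (simp only: Union_empty subset_empty) blast
  next
    case (insert U \<D>)
    show ?case
    proof (intro allI impI)
      fix L assume L: "compact_open_units L" "L \<subseteq> \<Union>(insert U \<D>)"
      have U: "U \<in> \<U>" "open U" "closed U" using insert.prems oU[of U] compact_imp_closed by auto
      have LU: "compact_open_units (L \<inter> U)" "compact_open_units (L - U)"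
        using L(1) U by (auto simp: compact_open_units_def Diff_eq intro: compact_Int_closed closed_Compl)
      have "indicator (L \<inter> U) \<in> ring_RaR SA (indicator W)" by (rule one[OF U(1) LU(1)]) simp
      moreover have "indicator (L - U) \<in> ring_RaR SA (indicator W)"
        using insert.IH insert.prems LU(2) L(2) by blast
      ultimately have "indicator (L \<inter> U) \<otimes>\<^bsub>add_monoid SA\<^esub> indicator (L - U) \<in> ring_RaR SA (indicator W)"
        unfolding ring_RaR_def by (rule generate.eng)
      moreover have "indicator (L \<inter> U) \<otimes>\<^bsub>add_monoid SA\<^esub> indicator (L - U) = (indicator L :: 'g \<Rightarrow> complex)"
        by (auto simp: indicator_def)
      ultimately show "indicator L \<in> ring_RaR SA (indicator W)" by simp
    qed
  qed
  then show ?thesis using K \<D>(3) by blast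
qed

lemma proj_factors:
  assumes api: "algebraically_purely_infinite SA" and min: "minimal G"
    and W: "compact_open_units W" "W \<noteq> {}" and K: "compact_open_units K"
  obtains y z where "y \<in> Cc" "z \<in> Cc" "proj K = rep y o\<^sub>L proj W o\<^sub>L rep z"
proof -
  interpret SA: abelian_group SA by (rule abelian_group_SA)
  have Wc: "indicator W \<in> carrier SA" using W(1) by (auto simp: compact_open_units_def intro: indicator_SA)
  have "ring_precsim SA 1 (\<lambda>_ _. indicator K) 1 (\<lambda>_ _. indicator W)"
    using api Wc indicator_in_RaR[OF min W K] unfolding algebraically_purely_infinite_def by blast
  then obtain \<alpha> \<beta> where ab: "\<alpha> 0 0 \<in> carrier SA" "\<beta> 0 0 \<in> carrier SA"
    and eq: "indicator K = (\<Oplus>\<^bsub>SA\<^esub>p\<in>{..<1::nat}. \<Oplus>\<^bsub>SA\<^esub>q\<in>{..<1::nat}. \<alpha> 0 p \<otimes>\<^bsub>SA\<^esub> indicator W \<otimes>\<^bsub>SA\<^esub> \<beta> q (0::nat))"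
    unfolding ring_precsim_def by auto
  define x where "x = convolution G (convolution G (\<alpha> 0 0) (indicator W)) (\<beta> 0 0)"
  have x: "x \<in> carrier SA" unfolding x_def using ab Wc by (intro SA_convolution)
  have fs: "finsum SA f {..<1::nat} = f 0" if "f 0 \<in> carrier SA" for f
  proof -
    have "{..<1::nat} = {0}" by auto
    then show ?thesis using that SA.finsum_insert[of "{}" 0 f] SA.finsum_empty by simp
  qed
  have inner: "(\<Oplus>\<^bsub>SA\<^esub>q\<in>{..<1::nat}. \<alpha> 0 0 \<otimes>\<^bsub>SA\<^esub> indicator W \<otimes>\<^bsub>SA\<^esub> \<beta> q 0) = x"
    using fs[of "\<lambda>q. \<alpha> 0 0 \<otimes>\<^bsub>SA\<^esub> indicator W \<otimes>\<^bsub>SA\<^esub> \<beta> q 0"] x by (simp add: x_def)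
  have "indicator K = x"
    using eq fs[of "\<lambda>p. \<Oplus>\<^bsub>SA\<^esub>q\<in>{..<1::nat}. \<alpha> 0 p \<otimes>\<^bsub>SA\<^esub> indicator W \<otimes>\<^bsub>SA\<^esub> \<beta> q 0"] x
    unfolding inner by simp
  then have "proj K = rep x" by simp
  also have "\<dots> = rep (\<alpha> 0 0) o\<^sub>L proj W o\<^sub>L rep (\<beta> 0 0)"
    unfolding x_def using ab Wc by (simp add: rep_convolution Cc_convolution SA_Cc)
  finally show thesis using that ab SA_Cc by blast
qed

section \<open>Pure infiniteness\<close>

lemma cmod_coord_le: "cmod (ell2_fun (blinfun_apply T (delta \<gamma>)) \<eta>) \<le> norm T"
  using ell2_coord_le_norm[of "blinfun_apply T (delta \<gamma>)" \<eta>] norm_blinfun[of T "delta \<gamma>"]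
  by (simp add: norm_delta)

lemma dominates_projection:
  assumes eff: "effective G" and d: "d \<in> reduced_Cstar G" "d \<noteq> 0"
  obtains W Y where "compact_open_units W" "W \<noteq> {}" "Y \<in> reduced_Cstar G"
    "norm (proj W - (Y o\<^sub>L (adj d o\<^sub>L d) o\<^sub>L proj W)) < 1"
proof -
  define a where "a = adj d o\<^sub>L d"
  have aA: "a \<in> reduced_Cstar G" unfolding a_def using d by (intro rC.compose_closed rC.adj_closed)
  obtain \<gamma> where \<gamma>: "blinfun_apply d (delta \<gamma>) \<noteq> 0"
  proof (rule ccontr)
    assume "\<not> thesis"
    then have "blinfun_apply d (delta \<gamma>) = blinfun_apply 0 (delta \<gamma>)" for \<gamma> using that by auto
    then have "d = 0"
      by (intro op_eqI_delta rC.complex_linear d rC.zero_closed)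
    then show False using d by simp
  qed
  define t where "t = (norm (blinfun_apply d (delta \<gamma>)))\<^sup>2"
  have t: "t > 0" using \<gamma> by (simp add: t_def)
  have "inner \<xi> (\<i> *\<^sub>C \<xi>) = 0" for \<xi> :: "'g ell2"
    using inner_scaleC_ii[of \<xi> \<xi>] by (simp add: inner_commute)
  then have "cinner \<xi> \<xi> = of_real ((norm \<xi>)\<^sup>2)" for \<xi> :: "'g ell2"
    by (simp add: cinner_eq_Complex power2_norm_eq_inner complex_of_real_def)
  then have at: "ell2_fun (blinfun_apply a (delta \<gamma>)) \<gamma> = of_real t"
    using rC.is_adjoint_adj'[OF d(1)] unfolding is_adjoint_def
    by (simp add: cinner_delta_right[symmetric] a_def t_def)
  obtain f where f: "f \<in> Cc" "norm (a - rep f) < t / 4"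
    using reduced_Cstar_approx[OF aA, of "t / 4"] t by auto
  define u where "u = rng G \<gamma>"
  have "ell2_fun (blinfun_apply (a - rep f) (delta \<gamma>)) \<gamma> = of_real t - f u"
    using at f(1) by (simp add: blinfun.bilinear_simps minus_ell2.rep_eq ell2_fun_rep_delta conv_kernel_def u_def)
  then have fu: "cmod (of_real t - f u) < t / 4"
    using cmod_coord_le[of "a - rep f" \<gamma> \<gamma>] f(2) by simp
  define V where "V = units G \<inter> {v. cmod (of_real t - f v) < t / 2}"
  have cf: "continuous_on UNIV f" using f(1) by (simp add: Cc_def)
  have oV: "open V"
    unfolding V_def by (intro open_Int open_units open_Collect_less continuous_intros cf)
  have "u \<in> V" using fu t by (simp add: V_def u_def)
  then have Vne: "V \<noteq> {}" by blast
  obtain S where S: "compact S" "\<And>x. f x \<noteq> 0 \<Longrightarrow> x \<in> S"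
    using compactly_supportedE[of f] f(1) unfolding Cc_def by blast
  have S': "compact (S \<inter> - units G)"
    using S(1) open_units by (intro compact_Int_closed) (auto intro: closed_Compl)
  obtain W where W: "compact W" "open W" "W \<subseteq> V" "W \<noteq> {}"
    "\<And>\<gamma>. \<gamma> \<in> S \<inter> - units G \<Longrightarrow> \<not> (rng G \<gamma> \<in> W \<and> src G \<gamma> \<in> W)"
    using effective_avoid_compact[OF eff S' _ oV _ Vne] unfolding V_def by blast
  have cou: "compact_open_units W" using W by (auto simp: compact_open_units_def V_def)
  have pW: "proj W \<in> reduced_Cstar G" by (rule proj_in[OF cou])
  define h where "h = (\<lambda>\<gamma>. indicator W (rng G \<gamma>) * f \<gamma> * indicator W (src G \<gamma>))"
  have iC: "(indicator W :: 'g \<Rightarrow> complex) \<in> Cc" using W by (simp add: indicator_Cc)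
  have h: "h \<in> Cc" "proj W o\<^sub>L rep f o\<^sub>L proj W = rep h"
    unfolding h_def using rep_proj(1,3)[OF cou rep_proj(4)[OF cou f(1)]] rep_proj(2)[OF cou f(1)] by simp_all
  define g where "g = (\<lambda>\<gamma>. indicator W \<gamma> + of_real (- 1 / t) * h \<gamma>)"
  have g: "g \<in> Cc" unfolding g_def by (intro Cc_add Cc_scale iC h)
  have "rep g = proj W + rep (\<lambda>\<gamma>. of_real (- 1 / t) * h \<gamma>)"
    unfolding g_def by (rule rep_add[OF iC Cc_scale[OF h(1)]])
  also have "rep (\<lambda>\<gamma>. of_real (- 1 / t) * h \<gamma>) = scaleC_op (of_real (- 1 / t)) (rep h)"
    by (rule rep_scale[OF h(1)])
  also have "scaleC_op (of_real (- 1 / t)) (rep h) = - ((1 / t) *\<^sub>R rep h)"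
    by (rule blinfun_eqI) (simp only: scaleC_op_apply scaleC_of_real blinfun.bilinear_simps, simp)
  finally have rg: "rep g = proj W - (1 / t) *\<^sub>R rep h" by simp
  have g_supp: "x \<in> units G" if "g x \<noteq> 0" for x
  proof (rule ccontr)
    assume x: "x \<notin> units G"
    then have "x \<notin> W" using cou by (auto simp: compact_open_units_def)
    then have "h x \<noteq> 0" using that by (auto simp: g_def)
    then have "f x \<noteq> 0" "rng G x \<in> W" "src G x \<in> W" by (auto simp: h_def split: split_indicator_asm)
    then show False using W(5)[of x] S(2)[of x] x by blast
  qed
  have g_bound: "cmod (g x) \<le> 1 / 2" for x
  proof (cases "x \<in> W")
    case True
    then have x: "src G x = x" "rng G x = x" "x \<in> V"
      using cou units_iff_src units_iff_rng W(3) unfolding compact_open_units_def by blast+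
    then have "g x = (of_real t - f x) / of_real t"
      using True t by (simp add: g_def h_def divide_simps)
    then have "cmod (g x) = cmod (of_real t - f x) / t" using t by (simp add: norm_divide)
    also have "\<dots> \<le> 1 / 2" using x(3) t by (simp add: V_def divide_simps)
    finally show ?thesis .
  next
    case False
    have "g x = 0"
    proof (cases "g x = 0")
      case nz: False
      then have "rng G x = x" using g_supp units_iff_rng by blast
      then show ?thesis using False by (simp add: g_def h_def)
    qed
    then show ?thesis by simp
  qed
  have n1: "norm (rep g) \<le> 1 / 2" by (rule norm_rep_units_le[OF g g_supp g_bound])
  define E where "E = proj W o\<^sub>L (a - rep f) o\<^sub>L proj W"
  have "norm E \<le> norm (proj W o\<^sub>L (a - rep f)) * norm (proj W)"
    unfolding E_def by (rule norm_blinfun_compose)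
  also have "\<dots> \<le> norm (proj W o\<^sub>L (a - rep f)) * 1"
    using norm_proj_le[OF cou] by (intro mult_left_mono) auto
  also have "\<dots> \<le> norm (proj W) * norm (a - rep f)" using norm_blinfun_compose by simp
  also have "\<dots> \<le> 1 * norm (a - rep f)" using norm_proj_le[OF cou] by (intro mult_right_mono) auto
  finally have nE: "norm E < t / 4" using f(2) by simp
  define Y where "Y = (1 / t) *\<^sub>R proj W"
  have YA: "Y \<in> reduced_Cstar G" unfolding Y_def by (rule rC.scaleR_closed[OF pW])
  have "proj W - (Y o\<^sub>L a o\<^sub>L proj W) = rep g - (1 / t) *\<^sub>R E"
    unfolding rg h(2)[symmetric] E_def Y_def
    by (rule blinfun_eqI) (simp add: blinfun.bilinear_simps algebra_simps)
  also have "norm \<dots> \<le> norm (rep g) + norm ((1 / t) *\<^sub>R E)" by (rule norm_triangle_ineq4)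
  also have "\<dots> = norm (rep g) + norm E / t" using t by simp
  also have "\<dots> < 1 / 2 + 1 / 2"
  proof (rule add_le_less_mono[OF n1])
    show "norm E / t < 1 / 2" using nE t by (simp add: pos_divide_less_eq)
  qed
  finally have "norm (proj W - (Y o\<^sub>L a o\<^sub>L proj W)) < 1" by simp
  then show thesis using that[OF cou W(4) YA] by (simp add: a_def)
qed

lemma local_unit_Cc:
  assumes f: "f \<in> Cc"
  obtains K where "compact_open_units K" "proj K o\<^sub>L rep f = rep f"
proof -
  obtain S where S: "compact S" "\<And>x. f x \<noteq> 0 \<Longrightarrow> x \<in> S"
    using compactly_supportedE[of f] f(1) unfolding Cc_def by blast
  have "compact (rng G ` S)" by (rule compact_continuous_image[OF continuous_rng S(1)])
  then obtain \<B> where \<B>: "finite \<B>" "\<And>B. B \<in> \<B> \<Longrightarrow> compact B \<and> open_bisection G B \<and> B \<subseteq> units G" "rng G ` S \<subseteq> \<Union>\<B>"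
    using finite_cobis_cover[of "rng G ` S" "units G"] open_units by (metis image_subsetI rng_in_units)
  have K: "compact_open_units (\<Union>\<B>)"
    using \<B>(1,2) by (auto simp: compact_open_units_def open_bisection_def intro!: compact_Union open_Union)
  have "(\<lambda>\<gamma>. indicator (\<Union>\<B>) (rng G \<gamma>) * f \<gamma>) = f"
  proof
    fix \<gamma>
    show "indicator (\<Union>\<B>) (rng G \<gamma>) * f \<gamma> = f \<gamma>"
    proof (cases "f \<gamma> = 0")
      case False
      then have "rng G \<gamma> \<in> \<Union>\<B>" using S(2) \<B>(3) by blast
      then show ?thesis by (simp only: indicator_simps) simp
    qed simp
  qed
  then show thesis using that[OF K] rep_proj(2)[OF K f] by simp
qed

lemma approximate_unit:
  assumes c: "c \<in> reduced_Cstar G" and "\<epsilon> > 0"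
  obtains K where "compact_open_units K" "norm (c - (proj K o\<^sub>L c)) < \<epsilon>"
proof -
  obtain f where f: "f \<in> Cc" "norm (c - rep f) < \<epsilon> / 2"
    using reduced_Cstar_approx[OF c, of "\<epsilon> / 2"] \<open>\<epsilon> > 0\<close> by auto
  obtain K where K: "compact_open_units K" "proj K o\<^sub>L rep f = rep f" by (rule local_unit_Cc[OF f(1)])
  have Kf: "blinfun_apply (proj K) (blinfun_apply (rep f) \<xi>) = blinfun_apply (rep f) \<xi>" for \<xi>
    by (metis K(2) blinfun_apply_blinfun_compose)
  have "c - (proj K o\<^sub>L c) = (c - rep f) - (proj K o\<^sub>L (c - rep f))"
    by (rule blinfun_eqI) (simp add: blinfun.bilinear_simps Kf)
  also have "norm \<dots> \<le> norm (c - rep f) + norm (proj K o\<^sub>L (c - rep f))" by (rule norm_triangle_ineq4)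
  also have "norm (proj K o\<^sub>L (c - rep f)) \<le> norm (proj K) * norm (c - rep f)" by (rule norm_blinfun_compose)
  also have "\<dots> \<le> 1 * norm (c - rep f)" using norm_proj_le[OF K(1)] by (intro mult_right_mono) auto
  finally have "norm (c - (proj K o\<^sub>L c)) < \<epsilon>" using f(2) by simp
  then show thesis using that K(1) by blast
qed

lemma projection_from_nonzero:
  assumes eff: "effective G" and min: "minimal G" and api: "algebraically_purely_infinite SA"
    and d: "d \<in> reduced_Cstar G" "d \<noteq> 0" and K: "compact_open_units K" and "\<epsilon> > 0"
  obtains x where "x \<in> reduced_Cstar G" "norm (proj K - (x o\<^sub>L (adj d o\<^sub>L d) o\<^sub>L adj x)) < \<epsilon>"
proof -
  let ?A = "reduced_Cstar G" and ?a = "adj d o\<^sub>L d"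
  obtain W Y where W: "compact_open_units W" "W \<noteq> {}" "Y \<in> ?A" "norm (proj W - (Y o\<^sub>L ?a o\<^sub>L proj W)) < 1"
    by (rule dominates_projection[OF eff d])
  obtain y z where yz: "y \<in> Cc" "z \<in> Cc" "proj K = rep y o\<^sub>L proj W o\<^sub>L rep z"
    by (rule proj_factors[OF api min W(1,2) K])
  define e where "e = 1 / (norm (rep y) * norm (rep z) + 1)"
  have e: "e > 0" by (simp add: e_def add_nonneg_pos)
  obtain w where w: "w \<in> ?A" "norm (proj W - (w o\<^sub>L ?a o\<^sub>L adj w)) < e"
    using rC.projection_precsim[OF proj_in[OF W(1)] proj_idem[OF W(1)] adj_proj[OF W(1)] d(1) W(3)
        proj_in[OF W(1)] W(4) e] by blast
  define E where "E = proj W - (w o\<^sub>L ?a o\<^sub>L adj w)"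
  have "proj K - ((rep y o\<^sub>L w) o\<^sub>L ?a o\<^sub>L (adj w o\<^sub>L rep z)) = rep y o\<^sub>L E o\<^sub>L rep z"
    unfolding yz(3) E_def by (rule blinfun_eqI) (simp add: blinfun.bilinear_simps)
  also have "norm \<dots> \<le> norm (rep y o\<^sub>L E) * norm (rep z)" by (rule norm_blinfun_compose)
  also have "\<dots> \<le> (norm (rep y) * norm E) * norm (rep z)"
    by (intro mult_right_mono norm_blinfun_compose) auto
  also have "\<dots> \<le> (norm (rep y) * e) * norm (rep z)"
    using w(2) by (intro mult_right_mono mult_left_mono) (auto simp: E_def)
  also have "\<dots> < 1" by (simp add: e_def divide_simps add_nonneg_pos)
  finally have "norm (proj K - ((rep y o\<^sub>L w) o\<^sub>L ?a o\<^sub>L (adj w o\<^sub>L rep z))) < 1" .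
  from rC.projection_precsim[OF proj_in[OF K] proj_idem[OF K] adj_proj[OF K] d(1) _ _ this \<open>\<epsilon> > 0\<close>]
  show thesis
    using that w(1) yz(1,2) by (meson rC.adj_closed rC.compose_closed rep_in_reduced_Cstar)
qed

lemma precsim_of_nonzero:
  assumes eff: "effective G" and min: "minimal G" and api: "algebraically_purely_infinite SA"
    and d: "d \<in> reduced_Cstar G" "d \<noteq> 0" and c: "c \<in> reduced_Cstar G"
  shows "Cstar_precsim (reduced_Cstar G) (adj c o\<^sub>L c) (adj d o\<^sub>L d)"
proof -
  let ?A = "reduced_Cstar G" and ?a = "adj d o\<^sub>L d" and ?b = "adj c o\<^sub>L c"
  have ex: "\<exists>\<alpha>\<in>?A. norm ((\<alpha> o\<^sub>L ?a o\<^sub>L adj \<alpha>) - ?b) < \<epsilon>" if "\<epsilon> > 0" for \<epsilon> :: real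
  proof -
    define n where "n = norm c"
    have n: "n \<ge> 0" by (simp add: n_def)
    have nc: "norm (adj c) = n" using rC.norm_adj[OF c] by (simp add: n_def)
    define e1 where "e1 = \<epsilon> / (2 * (n + 1))"
    define e2 where "e2 = \<epsilon> / (2 * (n * n + 1))"
    have e: "e1 > 0" "e2 > 0" using that n by (auto simp: e1_def e2_def add_nonneg_pos)
    obtain K where K: "compact_open_units K" "norm (c - (proj K o\<^sub>L c)) < e1"
      by (rule approximate_unit[OF c e(1)])
    obtain x where x: "x \<in> ?A" "norm (proj K - (x o\<^sub>L ?a o\<^sub>L adj x)) < e2"
      by (rule projection_from_nonzero[OF eff min api d K(1) e(2)])
    define E where "E = proj K - (x o\<^sub>L ?a o\<^sub>L adj x)"
    define \<alpha> where "\<alpha> = adj c o\<^sub>L x"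
    have adj_\<alpha>: "adj \<alpha> = adj x o\<^sub>L c"
      unfolding \<alpha>_def using x(1) c by (simp add: rC.adj_compose rC.adj_closed rC.adj_adj)
    have "(\<alpha> o\<^sub>L ?a o\<^sub>L adj \<alpha>) - ?b = - (adj c o\<^sub>L E o\<^sub>L c) - (adj c o\<^sub>L (c - (proj K o\<^sub>L c)))"
      unfolding adj_\<alpha> E_def unfolding \<alpha>_def by (rule blinfun_eqI) (simp add: blinfun.bilinear_simps)
    also have "norm \<dots> \<le> norm (adj c o\<^sub>L E o\<^sub>L c) + norm (adj c o\<^sub>L (c - (proj K o\<^sub>L c)))"
      by (rule order_trans[OF norm_triangle_ineq4]) simp
    also have "norm (adj c o\<^sub>L E o\<^sub>L c) \<le> n * norm E * n"
    proof -
      have "norm (adj c o\<^sub>L E o\<^sub>L c) \<le> norm (adj c o\<^sub>L E) * n" unfolding n_def by (rule norm_blinfun_compose)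
      also have "\<dots> \<le> n * norm E * n"
        using norm_blinfun_compose[of "adj c" E] nc n by (intro mult_right_mono) auto
      finally show ?thesis .
    qed
    also have "norm (adj c o\<^sub>L (c - (proj K o\<^sub>L c))) \<le> n * norm (c - (proj K o\<^sub>L c))"
      using norm_blinfun_compose[of "adj c"] nc by metis
    also have "n * norm E * n \<le> n * n * e2"
      using x(2) n mult_left_mono[of "norm E" e2 "n * n"] by (simp add: E_def mult_ac)
    also have "n * norm (c - (proj K o\<^sub>L c)) \<le> n * e1"
      using K(2) n by (intro mult_left_mono) auto
    also have "n * n * e2 + n * e1 < \<epsilon>"
    proof -
      have "n * n * e2 < (n * n + 1) * e2" "n * e1 < (n + 1) * e1" using e by (auto simp: algebra_simps)
      moreover have "(n * n + 1) * e2 = \<epsilon> / 2" "(n + 1) * e1 = \<epsilon> / 2"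
        using n by (auto simp: e1_def e2_def divide_simps add_nonneg_eq_0_iff)
      ultimately show ?thesis by linarith
    qed
    finally have "norm ((\<alpha> o\<^sub>L ?a o\<^sub>L adj \<alpha>) - ?b) < \<epsilon>" by simp
    moreover have "\<alpha> \<in> ?A" unfolding \<alpha>_def using c x(1) by (intro rC.compose_closed rC.adj_closed)
    ultimately show ?thesis by blast
  qed
  have "\<forall>i. \<exists>\<alpha>\<in>?A. norm ((\<alpha> o\<^sub>L ?a o\<^sub>L adj \<alpha>) - ?b) < inverse (real (Suc i))"
    by (intro allI ex) simp
  then obtain \<alpha> where \<alpha>: "\<And>i. \<alpha> i \<in> ?A" "\<And>i. norm ((\<alpha> i o\<^sub>L ?a o\<^sub>L adj (\<alpha> i)) - ?b) < inverse (real (Suc i))"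
    by metis
  have "(\<lambda>i. (\<alpha> i o\<^sub>L ?a o\<^sub>L adj (\<alpha> i)) - ?b) \<longlonglongrightarrow> 0"
    by (rule Lim_null_comparison[OF _ LIMSEQ_inverse_real_of_nat])
       (intro always_eventually allI less_imp_le \<alpha>(2))
  then have "(\<lambda>i. \<alpha> i o\<^sub>L ?a o\<^sub>L adj (\<alpha> i)) \<longlonglongrightarrow> ?b" by (rule LIM_zero_cancel)
  then show ?thesis unfolding Cstar_precsim_def using \<alpha>(1) by blast
qed

text \<open>A character cannot take the value 1 on \<open>a\<close> with \<open>\<parallel>a\<parallel> < 1\<close>: apply it to \<open>s = a + a s\<close> for the Neumann series \<open>s\<close>.\<close>

lemma star_hom_contractive:
  assumes \<phi>: "star_hom_to_complex (reduced_Cstar G) \<phi>" and a: "a \<in> reduced_Cstar G" "norm a < 1"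
  shows "\<phi> a \<noteq> 1"
proof
  assume one: "\<phi> a = 1"
  let ?A = "reduced_Cstar G"
  define p where "p = (\<lambda>n. ((o\<^sub>L) a ^^ n) a)"
  have p0: "p 0 = a" and pS: "p (Suc n) = a o\<^sub>L p n" for n by (simp_all add: p_def)
  have pA: "p n \<in> ?A" for n by (induction n) (auto simp: p0 pS a intro: rC.compose_closed)
  have np: "norm (p n) \<le> norm a ^ Suc n" for n
  proof (induction n)
    case (Suc n)
    have "norm (p (Suc n)) \<le> norm a * norm (p n)" unfolding pS by (rule norm_blinfun_compose)
    also have "\<dots> \<le> norm a * norm a ^ Suc n" using Suc by (intro mult_left_mono) auto
    finally show ?case by simp
  qed (simp add: p0)
  have "summable (\<lambda>n. norm a ^ Suc n)"
    using summable_mult[OF summable_geometric[of "norm a"], of "norm a"] a(2) by simp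
  then have sp: "summable p" by (rule summable_comparison_test'[of _ 0]) (use np in auto)
  define s where "s = suminf p"
  have "closed ?A" by (simp add: reduced_Cstar_def)
  moreover have "(\<Sum>i<n. p i) \<in> ?A" for n
    by (induction n) (auto intro: rC.zero_closed rC.add_closed pA)
  moreover have "(\<lambda>n. \<Sum>i<n. p i) \<longlonglongrightarrow> s"
    using sp unfolding s_def by (rule summable_LIMSEQ)
  ultimately have sA: "s \<in> ?A" by (metis closed_sequentially)
  have tail: "(\<Sum>n. p (Suc n)) = a o\<^sub>L s"
    unfolding pS s_def
    by (rule bounded_linear.suminf[OF bounded_bilinear.bounded_linear_right[OF bounded_bilinear_blinfun_compose] sp, symmetric])
  have "s = a + (a o\<^sub>L s)"
    using suminf_split_head[OF sp] unfolding tail p0 s_def[symmetric] by (simp add: eq_diff_eq add.commute)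
  then have "\<phi> s = \<phi> (a + (a o\<^sub>L s))" by simp
  also have "\<dots> = \<phi> a + \<phi> a * \<phi> s"
    using \<phi> a(1) sA rC.compose_closed[OF a(1) sA] unfolding star_hom_to_complex_def by metis
  finally show False using one by simp
qed

lemma star_hom_zero:
  assumes api: "algebraically_purely_infinite SA" and \<phi>: "star_hom_to_complex (reduced_Cstar G) \<phi>"
    and a: "a \<in> reduced_Cstar G"
  shows "\<phi> a = 0"
proof -
  let ?A = "reduced_Cstar G"
  have add: "\<phi> (S + T) = \<phi> S + \<phi> T" and mult: "\<phi> (S o\<^sub>L T) = \<phi> S * \<phi> T" if "S \<in> ?A" "T \<in> ?A" for S T
    using \<phi> that unfolding star_hom_to_complex_def by blast+
  have scale: "\<phi> (scaleC_op c T) = c * \<phi> T" if "T \<in> ?A" for c T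
    using \<phi> that unfolding star_hom_to_complex_def by blast
  have SA0: "\<phi> (rep f) = 0" if f: "f \<in> carrier SA" for f
  proof (rule ccontr)
    assume nz: "\<phi> (rep f) \<noteq> 0"
    have "\<phi> (rep (\<lambda>x. (c / \<phi> (rep f)) * f x)) = c" for c
      unfolding rep_scale[OF SA_Cc[OF f]] scale[OF rep_in_reduced_Cstar[OF SA_Cc[OF f]]] using nz by simp
    then have surj: "\<exists>g\<in>carrier SA. \<phi> (rep g) = c" for c
      using SA_scale[OF f] by blast
    have "two_sided_ideal {f \<in> carrier SA. \<phi> (rep f) = 0} SA \<and> division_ring (SA Quot {f \<in> carrier SA. \<phi> (rep f) = 0})"
      by (intro conjI character_quotient_division_ring[OF abelian_group_SA] surj)
         (auto simp: SA_convolution rep_add rep_convolution SA_Cc add mult rep_in_reduced_Cstar)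
    then show False using api unfolding algebraically_purely_infinite_def by blast
  qed
  have Cc0: "\<phi> (rep f) = 0" if f: "f \<in> Cc" for f
  proof -
    obtain K where K: "compact_open_units K" "proj K o\<^sub>L rep f = rep f" by (rule local_unit_Cc[OF f])
    have "\<phi> (proj K) = 0" using K(1) by (intro SA0 indicator_SA) (auto simp: compact_open_units_def)
    then show ?thesis using mult[OF proj_in[OF K(1)] rep_in_reduced_Cstar[OF f]] K(2) by simp
  qed
  show ?thesis
  proof (rule ccontr)
    assume nz: "\<phi> a \<noteq> 0"
    define b where "b = scaleC_op (1 / \<phi> a) a"
    have b: "b \<in> ?A" "\<phi> b = 1" using a nz by (auto simp: b_def rC.scaleC_closed scale)
    obtain f where f: "f \<in> Cc" "norm (b - rep f) < 1" by (rule reduced_Cstar_approx[OF b(1) zero_less_one])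
    have rf: "rep f \<in> ?A" by (rule rep_in_reduced_Cstar[OF f(1)])
    have "\<phi> b = \<phi> ((b - rep f) + rep f)" by simp
    also have "\<dots> = \<phi> (b - rep f)" using add[OF rC.diff_closed[OF b(1) rf] rf] Cc0[OF f(1)] by simp
    finally show False
      using star_hom_contractive[OF \<phi> rC.diff_closed[OF b(1) rf] f(2)] b(2) by simp
  qed
qed

lemma Cstar_purely_infinite_reduced_Cstar:
  assumes eff: "effective G" and min: "minimal G" and api: "algebraically_purely_infinite SA"
  shows "Cstar_purely_infinite (reduced_Cstar G)"
  unfolding Cstar_purely_infinite_def
proof (intro conjI allI impI ballI)
  let ?A = "reduced_Cstar G"
  show "\<phi> a = 0" if "star_hom_to_complex ?A \<phi>" "a \<in> ?A" for \<phi> a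
    using star_hom_zero[OF api that] .
  fix a b assume "a \<in> positive_elements ?A" "b \<in> positive_elements ?A"
  then obtain d c where d: "d \<in> ?A" "a = adj d o\<^sub>L d" and c: "c \<in> ?A" "b = adj c o\<^sub>L c"
    by (auto simp: positive_elements_def)
  show "Cstar_precsim ?A b a \<longleftrightarrow> b \<in> closure (Cstar_AaA ?A a)"
  proof
    assume "Cstar_precsim ?A b a"
    then obtain \<alpha> where \<alpha>: "\<And>i. \<alpha> i \<in> ?A" "(\<lambda>i. \<alpha> i o\<^sub>L a o\<^sub>L adj (\<alpha> i)) \<longlonglongrightarrow> b"
      unfolding Cstar_precsim_def by blast
    have "\<alpha> i o\<^sub>L a o\<^sub>L adj (\<alpha> i) \<in> Cstar_AaA ?A a" for i
      unfolding Cstar_AaA_def using \<alpha>(1)[of i] rC.adj_closed[OF \<alpha>(1)[of i]] by (intro op.span_base) blast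
    then show "b \<in> closure (Cstar_AaA ?A a)"
      unfolding closure_sequential using \<alpha>(2) by (intro exI[of _ "\<lambda>i. \<alpha> i o\<^sub>L a o\<^sub>L adj (\<alpha> i)"]) simp
  next
    assume b: "b \<in> closure (Cstar_AaA ?A a)"
    show "Cstar_precsim ?A b a"
    proof (cases "d = 0")
      case True
      then have a0: "a = 0" using d(2) by simp
      have "x = 0" if "x \<in> {c o\<^sub>L a o\<^sub>L d | c d. c \<in> ?A \<and> d \<in> ?A}" for x
        using that by (auto simp: a0)
      then have "Cstar_AaA ?A a \<subseteq> op.span {0}" unfolding Cstar_AaA_def by (intro op.span_mono) auto
      then have "Cstar_AaA ?A a \<subseteq> {0}" by simp
      then have "closure (Cstar_AaA ?A a) \<subseteq> {0}" by (intro closure_minimal) auto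
      then have "b = 0" using b by blast
      then show ?thesis unfolding Cstar_precsim_def
        by (intro exI[of _ "\<lambda>_. 0"]) (simp add: a0 rC.zero_closed)
    next
      case False
      then show ?thesis using precsim_of_nonzero[OF eff min api d(1) _ c(1)] d(2) c(2) by simp
    qed
  qed
qed

end

theorem corollary3p1:
  fixes G :: "'g::{t2_space, second_countable_topology} groupoid"
  assumes "ample G"
    and "minimal G"
    and "effective G"
    and "algebraically_purely_infinite (steinberg_algebra G)"
  shows "Cstar_purely_infinite (reduced_Cstar G)"
proof -
  interpret ample_groupoid G using assms(1) by unfold_locales
  show ?thesis using Cstar_purely_infinite_reduced_Cstar assms by blast
qed

end
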